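(* The problem of listing maximal connected obstacle-free convex hulls is proximity searchable, and it can be solved (every solution output exactly once) with $O(jh(m+j(h+\log j)))=O(n^4)$ time delay.
   Context: Input: a set $V$ of $j$ points and a set $X$ of $h$ obstacle points in the plane, $n=j+h$, and a graph $G=(V,E)$ on the points of $V$ with $m=|E|$ edges. A connected obstacle-free convex hull is a set $S\subseteq V$ whose convex hull contains no point of $X$ and such that $G[S]$ is connected; solutions to list are the inclusion-maximal such sets. A listing problem with universe $\mathcal{U}$ (here $V$) and set $\mathcal{S}$ of solutions to list is proximity searchable if there exist $\tilde{\cap}:\mathcal{S}\times\mathcal{S}\to 2^{\mathcal{U}}$ and $\mathrm{neighbors}:\mathcal{S}\to 2^{\mathcal{S}}$ such that one solution can be found in time polynomial in $|\mathcal{U}|$, $\mathrm{neighbors}$ is computable in time polynomial in $|\mathcal{U}|$, and for any two distinct $S,S^*\in\mathcal{S}$ some $S'\in\mathrm{neighbors}(S)$ satisfies $|S'\,\tilde{\cap}\,S^*|>|S\,\tilde{\cap}\,S^*|$. Delay is the maximum time before the first output, between consecutive outputs, and after the last output.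
   Formalization: "Polynomial in |U|" (U = V) is read as polynomial in n = j+h, since all h obstacles must be read even when |V| = 2; the bound O(jh(m+j(h+log j))) is claimed for j,h ≥ 1 only (otherwise it is 0), while O(n^4) covers all n ≥ 1. *)

theory Defs
  imports "HOL-Analysis.Analysis" "HOL-Computational_Algebra.Polynomial"
begin

section \<open>A real RAM with timed output\<close>

text \<open>
  The machine model is a unit-cost real RAM, presented as a small structured language.  A program
  works on finitely many unbounded zero-initialised arrays, indexed by natural numbers: integer
  arrays, holding natural numbers, and real arrays.  (Interleaving the arrays of a fixed program in
  one memory costs a constant factor only.)  Scalar variables are cells of arrays.  On integers
  there is no multiplication, since unit-cost multiplication of unbounded integers would be
  unreasonably powerful.  On reals there are field operations and comparisons, but neither rounding
  nor any other conversion to integers.  Program constants are natural numbers and integers, so that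
  no real constant can carry hidden information.
\<close>

datatype iexp =
    INum nat
  | IRead nat iexp  \<comment> \<open>array, index\<close>
  | IAdd iexp iexp
  | ISub iexp iexp

datatype rexp =
    RNum int
  | RRead nat iexp
  | RAdd rexp rexp
  | RSub rexp rexp
  | RMul rexp rexp
  | RDiv rexp rexp

datatype bexp =
    ILess iexp iexp
  | RLess rexp rexp
  | BNot bexp
  | BAnd bexp bexp

text \<open>
  \<open>Emit e\<close> appends the value of \<open>e\<close> to the output item under construction; \<open>Flush\<close> completes
  and outputs that item.
\<close>

datatype com =
    Skip
  | IWrite nat iexp iexp  \<comment> \<open>array, index, new value\<close>
  | RWrite nat iexp rexp
  | Emit iexp
  | Flush
  | Seq com com
  | Cond bexp com com
  | While bexp com

record state =
  imem :: "nat \<Rightarrow> nat \<Rightarrow> nat"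
  rmem :: "nat \<Rightarrow> nat \<Rightarrow> real"
  clock :: nat
  buffer :: "nat list"
  outputs :: "(nat \<times> nat list) list"  \<comment> \<open>completed items with completion times, oldest first\<close>

primrec ival :: "iexp \<Rightarrow> state \<Rightarrow> nat" where
  "ival (INum k) s = k"
| "ival (IRead a e) s = imem s a (ival e s)"
| "ival (IAdd e f) s = ival e s + ival f s"
| "ival (ISub e f) s = ival e s - ival f s"

primrec rval :: "rexp \<Rightarrow> state \<Rightarrow> real" where
  "rval (RNum k) s = of_int k"
| "rval (RRead a e) s = rmem s a (ival e s)"
| "rval (RAdd e f) s = rval e s + rval f s"
| "rval (RSub e f) s = rval e s - rval f s"
| "rval (RMul e f) s = rval e s * rval f s"
| "rval (RDiv e f) s = rval e s / rval f s"

primrec bval :: "bexp \<Rightarrow> state \<Rightarrow> bool" where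
  "bval (ILess e f) s \<longleftrightarrow> ival e s < ival f s"
| "bval (RLess e f) s \<longleftrightarrow> rval e s < rval f s"
| "bval (BNot b) s \<longleftrightarrow> \<not> bval b s"
| "bval (BAnd b c) s \<longleftrightarrow> bval b s \<and> bval c s"

primrec icost :: "iexp \<Rightarrow> nat" where
  "icost (INum k) = 1"
| "icost (IRead a e) = 1 + icost e"
| "icost (IAdd e f) = 1 + icost e + icost f"
| "icost (ISub e f) = 1 + icost e + icost f"

primrec rcost :: "rexp \<Rightarrow> nat" where
  "rcost (RNum k) = 1"
| "rcost (RRead a e) = 1 + icost e"
| "rcost (RAdd e f) = 1 + rcost e + rcost f"
| "rcost (RSub e f) = 1 + rcost e + rcost f"
| "rcost (RMul e f) = 1 + rcost e + rcost f"
| "rcost (RDiv e f) = 1 + rcost e + rcost f"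

primrec bcost :: "bexp \<Rightarrow> nat" where
  "bcost (ILess e f) = 1 + icost e + icost f"
| "bcost (RLess e f) = 1 + rcost e + rcost f"
| "bcost (BNot b) = 1 + bcost b"
| "bcost (BAnd b c) = 1 + bcost b + bcost c"

definition tick :: "nat \<Rightarrow> state \<Rightarrow> state" where
  "tick t s = s\<lparr>clock := clock s + t\<rparr>"

definition upd :: "(nat \<Rightarrow> nat \<Rightarrow> 'v) \<Rightarrow> nat \<Rightarrow> nat \<Rightarrow> 'v \<Rightarrow> nat \<Rightarrow> nat \<Rightarrow> 'v" where
  "upd mem a i v = mem(a := (mem a)(i := v))"

text \<open>\<open>exec c s s'\<close>: started in \<open>s\<close>, the program \<open>c\<close> terminates in \<open>s'\<close>.\<close>

inductive exec :: "com \<Rightarrow> state \<Rightarrow> state \<Rightarrow> bool" where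
  Skip: "exec Skip s s"
| IWrite: "exec (IWrite a e f) s
    (tick (1 + icost e + icost f) (s\<lparr>imem := upd (imem s) a (ival e s) (ival f s)\<rparr>))"
| RWrite: "exec (RWrite a e f) s
    (tick (1 + icost e + rcost f) (s\<lparr>rmem := upd (rmem s) a (ival e s) (rval f s)\<rparr>))"
| Emit: "exec (Emit e) s (tick (1 + icost e) (s\<lparr>buffer := buffer s @ [ival e s]\<rparr>))"
| Flush: "exec Flush s
    (tick 1 (s\<lparr>buffer := [], outputs := outputs s @ [(clock s + 1, buffer s)]\<rparr>))"
| Seq: "exec c s s' \<Longrightarrow> exec d s' s'' \<Longrightarrow> exec (Seq c d) s s''"
| CondTrue: "bval b s \<Longrightarrow> exec c (tick (1 + bcost b) s) s' \<Longrightarrow> exec (Cond b c d) s s'"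
| CondFalse: "\<not> bval b s \<Longrightarrow> exec d (tick (1 + bcost b) s) s' \<Longrightarrow> exec (Cond b c d) s s'"
| WhileFalse: "\<not> bval b s \<Longrightarrow> exec (While b c) s (tick (1 + bcost b) s)"
| WhileTrue: "bval b s \<Longrightarrow> exec c (tick (1 + bcost b) s) s' \<Longrightarrow> exec (While b c) s' s'' \<Longrightarrow>
    exec (While b c) s s''"

inductive_cases SkipE: "exec Skip s t"
inductive_cases IWriteE: "exec (IWrite a e f) s t"
inductive_cases RWriteE: "exec (RWrite a e f) s t"
inductive_cases EmitE: "exec (Emit e) s t"
inductive_cases FlushE: "exec Flush s t"
inductive_cases SeqE: "exec (Seq c d) s t"
inductive_cases CondE: "exec (Cond b c d) s t"
inductive_cases WhileE: "exec (While b c) s t"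

lemma exec_deterministic: "exec c s s' \<Longrightarrow> exec c s s'' \<Longrightarrow> s'' = s'"
proof (induction arbitrary: s'' rule: exec.induct)
  case (Skip s)
  then show ?case by (elim SkipE)
next
  case (IWrite a e f s)
  then show ?case by (elim IWriteE) simp
next
  case (RWrite a e f s)
  then show ?case by (elim RWriteE) simp
next
  case (Emit e s)
  then show ?case by (elim EmitE) simp
next
  case (Flush s)
  then show ?case by (elim FlushE) simp
next
  case (Seq c s s' d t)
  from Seq.prems obtain u where u: "exec c s u" "exec d u s''"
    by (rule SeqE)
  from Seq.IH(1)[OF u(1)] u(2) have "exec d s' s''" by (rule subst)
  then show ?case by (rule Seq.IH(2))
next
  case (CondTrue b s c s' d)
  from CondTrue.prems CondTrue.hyps(1) have "exec c (tick (1 + bcost b) s) s''"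
    by (elim CondE) simp_all
  then show ?case by (rule CondTrue.IH)
next
  case (CondFalse b s d s' c)
  from CondFalse.prems CondFalse.hyps(1) have "exec d (tick (1 + bcost b) s) s''"
    by (elim CondE) simp_all
  then show ?case by (rule CondFalse.IH)
next
  case (WhileFalse b s c)
  from WhileFalse.prems WhileFalse.hyps show ?case
    by (cases rule: WhileE) auto
next
  case (WhileTrue b s c s' t)
  from WhileTrue.prems WhileTrue.hyps(1) obtain u where
    u: "exec c (tick (1 + bcost b) s) u" "exec (While b c) u s''"
    by (cases rule: WhileE) auto
  from WhileTrue.IH(1)[OF u(1)] u(2) have "exec (While b c) s' s''" by (rule subst)
  then show ?case by (rule WhileTrue.IH(2))
qed

type_synonym input = "nat list list \<times> real list list"  \<comment> \<open>initial contents of the arrays\<close>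

definition load :: "'v::zero list list \<Rightarrow> nat \<Rightarrow> nat \<Rightarrow> 'v" where
  "load xss a i = (if a < length xss \<and> i < length (xss ! a) then xss ! a ! i else 0)"

definition init_state :: "input \<Rightarrow> state" where
  "init_state inp =
    \<lparr>imem = load (fst inp), rmem = load (snd inp), clock = 0, buffer = [], outputs = []\<rparr>"

text \<open>
  The delay of a terminated run: the maximum of the time before the first output, the times between
  consecutive outputs, and the time from the last output to termination.
\<close>

definition delay :: "state \<Rightarrow> nat" where
  "delay s = (let ts = 0 # map fst (outputs s) @ [clock s]
    in Max {ts ! Suc i - ts ! i |i. Suc i < length ts})"


section \<open>Listing problems and proximity searchability\<close>

text \<open>
  The universe of an instance is given by an enumeration without repetitions of its elements, whose
  positions serve as the names of the elements on the machine.  \<open>inp\<close> is the machine input for an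
  instance.
\<close>

record ('i, 'u) listing_problem =
  instances :: "'i set"
  elems :: "'i \<Rightarrow> 'u list"
  solutions :: "'i \<Rightarrow> 'u set set"
  inp :: "'i \<Rightarrow> input"
  inp_size :: "'i \<Rightarrow> nat"

definition universe :: "('i, 'u) listing_problem \<Rightarrow> 'i \<Rightarrow> 'u set" where
  "universe P I = set (elems P I)"

definition represents :: "('i, 'u) listing_problem \<Rightarrow> 'i \<Rightarrow> nat list \<Rightarrow> 'u set \<Rightarrow> bool" where
  "represents P I ns S \<longleftrightarrow>
    distinct ns \<and> (\<forall>k\<in>set ns. k < length (elems P I)) \<and> S = (\<lambda>k. elems P I ! k) ` set ns"

definition outputs_sets ::
  "('i, 'u) listing_problem \<Rightarrow> 'i \<Rightarrow> state \<Rightarrow> 'u set list \<Rightarrow> bool" where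
  "outputs_sets P I s Ss \<longleftrightarrow> list_all2 (represents P I) (map snd (outputs s)) Ss"

text \<open>The machine input for an instance together with a set of elements.\<close>

definition inp_with :: "('i, 'u) listing_problem \<Rightarrow> 'i \<Rightarrow> nat list \<Rightarrow> input" where
  "inp_with P I ns = (fst (inp P I) @ [[length ns], ns], snd (inp P I))"

definition finds_solution_polytime :: "('i, 'u) listing_problem \<Rightarrow> com \<Rightarrow> bool" where
  "finds_solution_polytime P c \<longleftrightarrow>
    (\<exists>q :: nat poly. \<forall>I\<in>instances P. \<exists>s S.
      exec c (init_state (inp P I)) s \<and> outputs_sets P I s [S] \<and> S \<in> solutions P I \<and>
      clock s \<le> poly q (inp_size P I))"

text \<open>
  The function \<open>nb I\<close> must be computed correctly whatever the order in which the elements of its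
  argument are presented, and its value may be listed in any order, possibly with repetitions.
\<close>

definition computes_polytime ::
  "('i, 'u) listing_problem \<Rightarrow> com \<Rightarrow> ('i \<Rightarrow> 'u set \<Rightarrow> 'u set set) \<Rightarrow> bool" where
  "computes_polytime P c nb \<longleftrightarrow>
    (\<exists>q :: nat poly. \<forall>I\<in>instances P. \<forall>S\<in>solutions P I. \<forall>ns. represents P I ns S \<longrightarrow>
      (\<exists>s Ss. exec c (init_state (inp_with P I ns)) s \<and> outputs_sets P I s Ss \<and>
        set Ss = nb I S \<and> clock s \<le> poly q (inp_size P I)))"

definition proximity_searchable :: "('i, 'u) listing_problem \<Rightarrow> bool" where
  "proximity_searchable P \<longleftrightarrow>
    (\<exists>(cap :: 'i \<Rightarrow> 'u set \<Rightarrow> 'u set \<Rightarrow> 'u set) (nb :: 'i \<Rightarrow> 'u set \<Rightarrow> 'u set set).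
      (\<forall>I\<in>instances P.
        (\<forall>S\<in>solutions P I. \<forall>S'\<in>solutions P I. cap I S S' \<subseteq> universe P I) \<and>
        (\<forall>S\<in>solutions P I. nb I S \<subseteq> solutions P I)) \<and>
      (\<exists>c. finds_solution_polytime P c) \<and>
      (\<exists>c. computes_polytime P c nb) \<and>
      (\<forall>I\<in>instances P. \<forall>S\<in>solutions P I. \<forall>T\<in>solutions P I. S \<noteq> T \<longrightarrow>
        (\<exists>S'\<in>nb I S. card (cap I S' T) > card (cap I S T))))"

text \<open>A terminated run that has output every solution exactly once, and nothing else.\<close>

definition lists_solutions :: "('i, 'u) listing_problem \<Rightarrow> 'i \<Rightarrow> state \<Rightarrow> bool" where
  "lists_solutions P I s \<longleftrightarrow>
    (\<exists>Ss. outputs_sets P I s Ss \<and> distinct Ss \<and> set Ss = solutions P I)"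


section \<open>Maximal connected obstacle-free convex hulls\<close>

type_synonym point = "real \<times> real"

text \<open>
  \<open>E\<close> is the edge set of a simple graph, as a set of two-element sets.  The empty set counts as
  connected.
\<close>

definition induces_connected :: "'a set set \<Rightarrow> 'a set \<Rightarrow> bool" where
  "induces_connected E S \<longleftrightarrow>
    (\<forall>a\<in>S. \<forall>b\<in>S. (a, b) \<in> {(x, y). x \<in> S \<and> y \<in> S \<and> {x, y} \<in> E}\<^sup>*)"

definition connected_obstacle_free_hull ::
  "point set \<Rightarrow> point set \<Rightarrow> point set set \<Rightarrow> point set \<Rightarrow> bool" where
  "connected_obstacle_free_hull V X E S \<longleftrightarrow>
    S \<subseteq> V \<and> convex hull S \<inter> X = {} \<and> induces_connected E S"

definition maximal_connected_obstacle_free_hulls ::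
  "point set \<Rightarrow> point set \<Rightarrow> point set set \<Rightarrow> point set set" where
  "maximal_connected_obstacle_free_hulls V X E =
    {S. connected_obstacle_free_hull V X E S \<and>
      (\<forall>T. connected_obstacle_free_hull V X E T \<and> S \<subseteq> T \<longrightarrow> T = S)}"

record hull_instance =
  pts :: "point list"
  obstacles :: "point list"
  edges :: "(nat \<times> nat) list"  \<comment> \<open>pairs of positions in \<open>pts\<close>, each edge given once\<close>

definition valid_hull_instance :: "hull_instance \<Rightarrow> bool" where
  "valid_hull_instance I \<longleftrightarrow>
    distinct (pts I) \<and> distinct (obstacles I) \<and>
    (\<forall>(u, v)\<in>set (edges I). u < length (pts I) \<and> v < length (pts I) \<and> u \<noteq> v) \<and>
    distinct (map (\<lambda>(u, v). {u, v}) (edges I))"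

definition V_of :: "hull_instance \<Rightarrow> point set" where
  "V_of I = set (pts I)"

definition X_of :: "hull_instance \<Rightarrow> point set" where
  "X_of I = set (obstacles I)"

definition E_of :: "hull_instance \<Rightarrow> point set set" where
  "E_of I = (\<lambda>(u, v). {pts I ! u, pts I ! v}) ` set (edges I)"

definition hull_problem :: "(hull_instance, point) listing_problem" where
  "hull_problem =
    \<lparr>instances = {I. valid_hull_instance I},
     elems = pts,
     solutions = (\<lambda>I. maximal_connected_obstacle_free_hulls (V_of I) (X_of I) (E_of I)),
     inp = (\<lambda>I.
       ([[length (pts I), length (obstacles I), length (edges I)],
         map fst (edges I), map snd (edges I)],
        [map fst (pts I), map snd (pts I), map fst (obstacles I), map snd (obstacles I)])),
     inp_size = (\<lambda>I. length (pts I) + length (obstacles I))\<rparr>"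

definition delay_bound :: "nat \<Rightarrow> nat \<Rightarrow> nat \<Rightarrow> real" where
  "delay_bound j h m = real j * real h * (real m + real j * (real h + log 2 (real j)))"

end

theory Submission
  imports Defs
begin

text \<open>
  An obstacle avoids the hull of a point set iff the points lie in an open half plane bounded by a
  line through it.  So it suffices to maintain, for every obstacle, the two extreme points of the
  current set as seen from there; testing and adding a new point then takes time \<open>O(h)\<close>.  Rejected
  points stay rejected when the set grows, so one graph search extends a connected obstacle-free
  set to a maximal one in time \<open>O(m + j h)\<close>.

  The proximity of \<open>S\<close> and \<open>T\<close> is the size of a largest connected subset \<open>C\<close> of \<open>S \<inter> T\<close>.  If
  \<open>S \<noteq> T\<close> and \<open>C\<close> is nonempty, then some \<open>v \<in> T - C\<close> is adjacent to \<open>C\<close>, and maximality puts \<open>v\<close> outside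
  the hull of \<open>S\<close>.  The lines from \<open>v\<close> through the obstacles in the hull of \<open>S \<union> {v}\<close> divide \<open>S\<close> into at
  most \<open>h + 1\<close> wedges.  If \<open>C\<close> met two of them or one of the lines, then an obstacle would lie in the hull of
  \<open>C \<union> {v}\<close> or of \<open>S\<close>; so \<open>C\<close> is contained in one wedge, and a wedge together with \<open>v\<close> is
  obstacle-free.  Growing \<open>{v}\<close> first within the wedge and then within all points yields a solution
  that contains \<open>C \<union> {v}\<close>.

  Listing is a breadth-first search over these \<open>O(j h)\<close> neighbors that outputs every solution when
  it leaves the queue.  Since integers are unbounded and arrays are sparse, a set of point indices
  is recognised as known by a table lookup at its code \<open>\<Sum>v\<in>S. 2 ^ v\<close>, computed in linear time.
\<close>

section \<open>Weakest preconditions for the machine\<close>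

text \<open>The search that builds a neighbor of \<open>S\<close> knows neither the target
  \<open>T\<close> nor the common part \<open>C\<close>, and it breaks ties by the order of the
  adjacency lists. Therefore \<open>neighbor\<close> is a relation: it only promises that the
  solution contains \<open>v\<close> and every part of the wedge that is connected together with
  \<open>v\<close>, and the proximity argument works for every set that keeps this promise.
  Proximity searchability, however, asks for a function of the set \<open>S\<close>. The argument is
  therefore turned into a characteristic function first, and two runs that agree on all arrays read
  are shown to produce the same output.

  Every loop is bounded in terms of \<open>Suc np\<close> and \<open>Suc nx\<close>, so that
  instances without points or obstacles are no special case; the resulting quantity
  \<open>work\<close> is compared with the stated bounds only at the end. A growth is amortized: it
  tests every vertex at most once against all obstacles and reads every adjacency list at most once.
  A solution is output before its neighbors are built, so the delay is governed by one enumeration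
  of neighbors.\<close>

definition wp :: "com \<Rightarrow> (state \<Rightarrow> bool) \<Rightarrow> state \<Rightarrow> bool" where
  "wp c Q s \<longleftrightarrow> (\<exists>s'. exec c s s' \<and> Q s')"

lemma upd_apply: "upd M a i v b = (if b = a then (M a)(i := v) else M b)"
  by (simp add: upd_def)

lemma wp_Skip [simp]: "wp Skip Q s \<longleftrightarrow> Q s"
  unfolding wp_def by (blast intro: exec.Skip elim: SkipE)

text \<open>Termination is part of \<open>wp\<close>. Since \<open>exec\<close> is deterministic,
  some run satisfies \<open>Q\<close> iff the only run does; this makes the rule an equation for the
  simplifier.\<close>

lemma wp_IWrite [simp]:
  "wp (IWrite a e f) Q s \<longleftrightarrow>
    Q (s\<lparr>imem := upd (imem s) a (ival e s) (ival f s), clock := clock s + (1 + icost e + icost f)\<rparr>)"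
  (is "_ \<longleftrightarrow> Q ?t")
proof -
  have "exec (IWrite a e f) s ?t"
    using exec.IWrite[of a e f s] by (simp add: tick_def)
  then show ?thesis unfolding wp_def by (blast dest: exec_deterministic)
qed

lemma wp_Emit [simp]:
  "wp (Emit e) Q s \<longleftrightarrow> Q (s\<lparr>buffer := buffer s @ [ival e s], clock := clock s + (1 + icost e)\<rparr>)"
  (is "_ \<longleftrightarrow> Q ?t")
proof -
  have "exec (Emit e) s ?t"
    using exec.Emit[of e s] by (simp add: tick_def)
  then show ?thesis unfolding wp_def by (blast dest: exec_deterministic)
qed

lemma wp_Flush [simp]:
  "wp Flush Q s \<longleftrightarrow>
    Q (s\<lparr>buffer := [], outputs := outputs s @ [(clock s + 1, buffer s)], clock := clock s + 1\<rparr>)"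
  (is "_ \<longleftrightarrow> Q ?t")
proof -
  have "exec Flush s ?t"
    using exec.Flush[of s] by (simp add: tick_def)
  then show ?thesis unfolding wp_def by (blast dest: exec_deterministic)
qed

lemma wp_Seq [simp]: "wp (Seq c d) Q s \<longleftrightarrow> wp c (wp d Q) s"
  unfolding wp_def by (blast intro: exec.Seq elim: SeqE)

lemma wp_Cond [simp]:
  "wp (Cond b c d) Q s \<longleftrightarrow>
    (if bval b s then wp c Q (s\<lparr>clock := clock s + (1 + bcost b)\<rparr>)
     else wp d Q (s\<lparr>clock := clock s + (1 + bcost b)\<rparr>))"
  unfolding wp_def tick_def[symmetric]
  by (auto intro: exec.CondTrue[simplified] exec.CondFalse[simplified] elim!: CondE)

lemma wp_conseq: "wp c Q s \<Longrightarrow> (\<And>s'. Q s' \<Longrightarrow> Q' s') \<Longrightarrow> wp c Q' s"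
  unfolding wp_def by blast

text \<open>Each evaluation of the guard is charged to the clock before the body or the exit is
  considered, so a time bound can be part of the invariant \<open>I\<close>. The measure provides
  termination.\<close>

lemma wp_While:
  fixes \<mu> :: "state \<Rightarrow> nat"
  assumes "I s"
    and step: "\<And>s. I s \<Longrightarrow> bval b s \<Longrightarrow>
      wp c (\<lambda>s'. I s' \<and> \<mu> s' < \<mu> s) (s\<lparr>clock := clock s + (1 + bcost b)\<rparr>)"
    and exit: "\<And>s. I s \<Longrightarrow> \<not> bval b s \<Longrightarrow> Q (s\<lparr>clock := clock s + (1 + bcost b)\<rparr>)"
  shows "wp (While b c) Q s"
  using \<open>I s\<close>
proof (induction "\<mu> s" arbitrary: s rule: less_induct)
  case less
  show ?case
  proof (cases "bval b s")
    case True
    from step[OF less.prems True] obtain s' where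
      s': "exec c (tick (1 + bcost b) s) s'" "I s'" "\<mu> s' < \<mu> s"
      unfolding wp_def tick_def by blast
    from less.hyps[OF s'(3,2)] obtain s'' where "exec (While b c) s' s''" "Q s''"
      unfolding wp_def by blast
    with True s'(1) show ?thesis
      unfolding wp_def using exec.WhileTrue by blast
  next
    case False
    then show ?thesis
      unfolding wp_def using exec.WhileFalse[OF False] exit[OF less.prems False]
      by (auto simp: tick_def)
  qed
qed

section \<open>Frame conditions read off the program text\<close>

primrec writes :: "com \<Rightarrow> nat set" where
  "writes Skip = {}"
| "writes (IWrite a e f) = {a}"
| "writes (RWrite a e f) = {}"
| "writes (Emit e) = {}"
| "writes Flush = {}"
| "writes (Seq c d) = writes c \<union> writes d"
| "writes (Cond b c d) = writes c \<union> writes d"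
| "writes (While b c) = writes c"

primrec real_free :: "com \<Rightarrow> bool" where
  "real_free Skip = True"
| "real_free (IWrite a e f) = True"
| "real_free (RWrite a e f) = False"
| "real_free (Emit e) = True"
| "real_free Flush = True"
| "real_free (Seq c d) = (real_free c \<and> real_free d)"
| "real_free (Cond b c d) = (real_free c \<and> real_free d)"
| "real_free (While b c) = real_free c"

primrec quiet :: "com \<Rightarrow> bool" where
  "quiet Skip = True"
| "quiet (IWrite a e f) = True"
| "quiet (RWrite a e f) = True"
| "quiet (Emit e) = False"
| "quiet Flush = False"
| "quiet (Seq c d) = (quiet c \<and> quiet d)"
| "quiet (Cond b c d) = (quiet c \<and> quiet d)"
| "quiet (While b c) = quiet c"

text \<open>Integer arrays are framed one by one, but the real memory only as a whole: none of the
  programs below writes a real.\<close>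

definition frame :: "com \<Rightarrow> state \<Rightarrow> state \<Rightarrow> bool" where
  "frame c s s' \<longleftrightarrow> (\<forall>a. a \<notin> writes c \<longrightarrow> imem s' a = imem s a) \<and>
    (real_free c \<longrightarrow> rmem s' = rmem s) \<and>
    (quiet c \<longrightarrow> buffer s' = buffer s \<and> outputs s' = outputs s)"

lemma exec_frame: "exec c s s' \<Longrightarrow> frame c s s'"
  by (induction rule: exec.induct) (auto simp: frame_def upd_def tick_def)

lemma frame_imem: "frame c s s' \<Longrightarrow> a \<notin> writes c \<Longrightarrow> imem s' a = imem s a"
  and frame_buffer: "frame c s s' \<Longrightarrow> quiet c \<Longrightarrow> buffer s' = buffer s"
  and frame_outputs: "frame c s s' \<Longrightarrow> quiet c \<Longrightarrow> outputs s' = outputs s"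
  by (auto simp: frame_def)

lemma wp_frame:
  "wp c Q s \<Longrightarrow> (\<And>s'. Q s' \<Longrightarrow> frame c s s' \<Longrightarrow> Q' s') \<Longrightarrow> wp c Q' s"
  unfolding wp_def using exec_frame by blast

text \<open>The second command may use the frame condition of the first, so a specification has to
  mention only what its program changes.\<close>

lemma wp_SeqI:
  "wp c Q s \<Longrightarrow> (\<And>s'. Q s' \<Longrightarrow> frame c s s' \<Longrightarrow> wp d Q' s') \<Longrightarrow> wp (Seq c d) Q' s"
  unfolding wp_Seq by (rule wp_frame)

section \<open>Counted loops and their running time\<close>

abbreviation Var :: "nat \<Rightarrow> iexp" where
  "Var a \<equiv> IRead a (INum 0)"

definition For :: "nat \<Rightarrow> iexp \<Rightarrow> com \<Rightarrow> com" where
  "For i n c = Seq (IWrite i (INum 0) (INum 0))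
    (While (ILess (Var i) n) (Seq c (IWrite i (INum 0) (IAdd (Var i) (INum 1)))))"

lemma writes_For [simp]: "writes (For i n c) = insert i (writes c)"
  and real_free_For [simp]: "real_free (For i n c) = real_free c"
  and quiet_For [simp]: "quiet (For i n c) = quiet c"
  by (auto simp: For_def)

text \<open>The invariant speaks about memory and output but not about the clock; a uniform bound
  \<open>t\<close> for the body becomes a bound for the loop. The counter is incremented after the
  body, so \<open>step\<close> asks for the invariant at \<open>Suc k\<close> in the memory where
  the increment has been done.\<close>

lemma wp_For:
  fixes I :: "nat \<Rightarrow> (nat \<Rightarrow> nat \<Rightarrow> nat) \<Rightarrow> nat list \<Rightarrow> (nat \<times> nat list) list \<Rightarrow> bool"
  assumes init: "I 0 (upd (imem s) i 0 0) (buffer s) (outputs s)"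
    and bound: "\<And>k s'. I k (imem s') (buffer s') (outputs s') \<Longrightarrow> frame (For i n c) s s' \<Longrightarrow>
      ival n s' = N"
    and step: "\<And>k s'. k < N \<Longrightarrow> I k (imem s') (buffer s') (outputs s') \<Longrightarrow> imem s' i 0 = k \<Longrightarrow>
      frame (For i n c) s s' \<Longrightarrow>
      wp c (\<lambda>s''. clock s'' \<le> clock s' + t \<and>
        I (Suc k) (upd (imem s'') i 0 (Suc k)) (buffer s'') (outputs s'')) s'"
    and i: "i \<notin> writes c"
    and cost: "icost n \<le> 4"
    and post: "\<And>s'. frame (For i n c) s s' \<Longrightarrow> I N (imem s') (buffer s') (outputs s') \<Longrightarrow>
      clock s' \<le> clock s + (t + 20) * Suc N \<Longrightarrow> Q s'"
  shows "wp (For i n c) Q s"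
proof -
  let ?b = "ILess (Var i) n"
  let ?F = "For i n c"
  \<comment> \<open>With \<open>icost n \<le> 4\<close> the guard costs at most 8 and the increment
    6, hence 14 per round; the initial assignment costs 3.\<close>
  let ?I = "\<lambda>s'. frame ?F s s' \<and> (\<exists>k\<le>N. imem s' i 0 = k \<and>
    I k (imem s') (buffer s') (outputs s') \<and> clock s' \<le> clock s + (t + 14) * k + 3)"
  let ?s = "s\<lparr>imem := upd (imem s) i 0 0, clock := clock s + 3\<rparr>"
  have "wp (While ?b (Seq c (IWrite i (INum 0) (IAdd (Var i) (INum 1))))) Q ?s"
  proof (rule wp_While[where I = ?I and \<mu> = "\<lambda>s. N - imem s i 0"])
    show "?I ?s"
      using init by (auto simp: frame_def upd_apply)
  next
    fix s' assume I: "?I s'" and b: "bval ?b s'"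
    from I obtain k where k: "k \<le> N" "imem s' i 0 = k" "I k (imem s') (buffer s') (outputs s')"
      "clock s' \<le> clock s + (t + 14) * k + 3" and fr: "frame ?F s s'" by blast
    have "k < N" using b bound[OF k(3) fr] k(2) by simp
    let ?u = "s'\<lparr>clock := clock s' + (1 + bcost ?b)\<rparr>"
    have "wp c (\<lambda>s''. clock s'' \<le> clock ?u + t \<and>
        I (Suc k) (upd (imem s'') i 0 (Suc k)) (buffer s'') (outputs s'')) ?u"
      by (rule step[OF \<open>k < N\<close>]) (use k fr in \<open>auto simp: frame_def\<close>)
    then show "wp (Seq c (IWrite i (INum 0) (IAdd (Var i) (INum 1))))
      (\<lambda>s''. ?I s'' \<and> N - imem s'' i 0 < N - imem s' i 0) ?u"
    proof (rule wp_SeqI)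
      fix v assume v: "clock v \<le> clock ?u + t \<and>
          I (Suc k) (upd (imem v) i 0 (Suc k)) (buffer v) (outputs v)" and fv: "frame c ?u v"
      have iv: "imem v i 0 = k" using fv i k(2) by (simp add: frame_def)
      have "frame ?F s v"
        using fr fv by (auto simp: frame_def)
      moreover have "clock v + 6 \<le> clock s + (t + 14) * Suc k + 3"
        using v k(4) cost by (simp add: algebra_simps)
      ultimately show "wp (IWrite i (INum 0) (IAdd (Var i) (INum 1)))
        (\<lambda>s''. ?I s'' \<and> N - imem s'' i 0 < N - imem s' i 0) v"
        using iv v \<open>k < N\<close> k(2) by (simp add: upd_apply frame_def)
    qed
  next
    fix s' assume I: "?I s'" and b: "\<not> bval ?b s'"
    from I obtain k where k: "k \<le> N" "imem s' i 0 = k" "I k (imem s') (buffer s') (outputs s')"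
      "clock s' \<le> clock s + (t + 14) * k + 3" and fr: "frame ?F s s'" by blast
    have "k = N" using b bound[OF k(3) fr] k(1,2) by simp
    with k fr cost show "Q (s'\<lparr>clock := clock s' + (1 + bcost ?b)\<rparr>)"
      by (intro post) (auto simp: frame_def algebra_simps)
  qed
  then show ?thesis by (simp add: For_def eval_nat_numeral)
qed

lemma wp_For':
  fixes I :: "nat \<Rightarrow> (nat \<Rightarrow> nat \<Rightarrow> nat) \<Rightarrow> bool"
  assumes init: "I 0 (upd (imem s) i 0 0)"
    and bound: "\<And>k s'. I k (imem s') \<Longrightarrow> frame (For i n c) s s' \<Longrightarrow> ival n s' = N"
    and step: "\<And>k s'. k < N \<Longrightarrow> I k (imem s') \<Longrightarrow> imem s' i 0 = k \<Longrightarrow> frame (For i n c) s s' \<Longrightarrow>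
      wp c (\<lambda>s''. clock s'' \<le> clock s' + t \<and> I (Suc k) (upd (imem s'') i 0 (Suc k))) s'"
    and i: "i \<notin> writes c"
    and cost: "icost n \<le> 4"
  shows "wp (For i n c) (\<lambda>s'. clock s' \<le> clock s + (t + 20) * Suc N \<and> I N (imem s')) s"
  by (rule wp_For[where I = "\<lambda>k M b os. I k M" and N = N and t = t]) (use assms in auto)

section \<open>Runs that agree on the arrays they read\<close>

primrec ireads :: "iexp \<Rightarrow> nat set" where
  "ireads (INum k) = {}"
| "ireads (IRead a e) = insert a (ireads e)"
| "ireads (IAdd e f) = ireads e \<union> ireads f"
| "ireads (ISub e f) = ireads e \<union> ireads f"

text \<open>For a real array only its index expression is recorded, because \<open>agree\<close>
  compares the real memory as a whole.\<close>

primrec rreads :: "rexp \<Rightarrow> nat set" where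
  "rreads (RNum k) = {}"
| "rreads (RRead a e) = ireads e"
| "rreads (RAdd e f) = rreads e \<union> rreads f"
| "rreads (RSub e f) = rreads e \<union> rreads f"
| "rreads (RMul e f) = rreads e \<union> rreads f"
| "rreads (RDiv e f) = rreads e \<union> rreads f"

primrec breads :: "bexp \<Rightarrow> nat set" where
  "breads (ILess e f) = ireads e \<union> ireads f"
| "breads (RLess e f) = rreads e \<union> rreads f"
| "breads (BNot b) = breads b"
| "breads (BAnd b c) = breads b \<union> breads c"

primrec reads :: "com \<Rightarrow> nat set" where
  "reads Skip = {}"
| "reads (IWrite a e f) = ireads e \<union> ireads f"
| "reads (RWrite a e f) = ireads e \<union> rreads f"
| "reads (Emit e) = ireads e"
| "reads Flush = {}"
| "reads (Seq c d) = reads c \<union> reads d"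
| "reads (Cond b c d) = breads b \<union> reads c \<union> reads d"
| "reads (While b c) = breads b \<union> reads c"

lemma reads_For [simp]: "reads (For i n c) = insert i (ireads n \<union> reads c)"
  by (auto simp: For_def)

definition agree :: "nat set \<Rightarrow> state \<Rightarrow> state \<Rightarrow> bool" where
  "agree A s t \<longleftrightarrow> (\<forall>a\<in>A. imem s a = imem t a) \<and> rmem s = rmem t \<and> buffer s = buffer t \<and>
    map snd (outputs s) = map snd (outputs t)"

lemma ival_agree: "ireads e \<subseteq> A \<Longrightarrow> agree A s t \<Longrightarrow> ival e s = ival e t"
  by (induction e) (auto simp: agree_def)

lemma rval_agree: "rreads e \<subseteq> A \<Longrightarrow> agree A s t \<Longrightarrow> rval e s = rval e t"
proof (induction e)
  case (RRead a e)
  then show ?case using ival_agree[of e A s t] by (auto simp: agree_def)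
qed auto

lemma bval_agree: "breads b \<subseteq> A \<Longrightarrow> agree A s t \<Longrightarrow> bval b s = bval b t"
  by (induction b) (auto simp: ival_agree[of _ A s t] rval_agree[of _ A s t])

lemma agree_tick: "agree A s t \<Longrightarrow> agree A (tick n s) (tick n' t)"
  by (simp add: agree_def tick_def)

text \<open>Guards, addresses and values are computed from arrays in \<open>A\<close> only, so both
  runs take the same branches and perform the same writes. This will show that the neighbor program
  depends on a set and not on the order in which it is presented.\<close>

lemma exec_agree:
  "exec c s s' \<Longrightarrow> reads c \<subseteq> A \<Longrightarrow> agree A s t \<Longrightarrow> \<exists>t'. exec c t t' \<and> agree A s' t'"
proof (induction arbitrary: t rule: exec.induct)
  case (Skip s)
  then show ?case using exec.Skip by blast
next
  case (IWrite a e f s)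
  have "ival e s = ival e t" "ival f s = ival f t"
    using IWrite ival_agree[of e A s t] ival_agree[of f A s t] by auto
  then have "agree A (tick (1 + icost e + icost f) (s\<lparr>imem := upd (imem s) a (ival e s) (ival f s)\<rparr>))
      (tick (1 + icost e + icost f) (t\<lparr>imem := upd (imem t) a (ival e t) (ival f t)\<rparr>))"
    using IWrite.prems by (simp add: agree_def tick_def upd_apply)
  then show ?case using exec.IWrite by blast
next
  case (RWrite a e f s)
  have "ival e s = ival e t" "rval f s = rval f t"
    using RWrite ival_agree[of e A s t] rval_agree[of f A s t] by auto
  then have "agree A (tick (1 + icost e + rcost f) (s\<lparr>rmem := upd (rmem s) a (ival e s) (rval f s)\<rparr>))
      (tick (1 + icost e + rcost f) (t\<lparr>rmem := upd (rmem t) a (ival e t) (rval f t)\<rparr>))"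
    using RWrite.prems by (simp add: agree_def tick_def)
  then show ?case using exec.RWrite by blast
next
  case (Emit e s)
  have "ival e s = ival e t"
    using Emit ival_agree[of e A s t] by auto
  then have "agree A (tick (1 + icost e) (s\<lparr>buffer := buffer s @ [ival e s]\<rparr>))
      (tick (1 + icost e) (t\<lparr>buffer := buffer t @ [ival e t]\<rparr>))"
    using Emit.prems by (simp add: agree_def tick_def)
  then show ?case using exec.Emit by blast
next
  case (Flush s)
  then have "agree A (tick 1 (s\<lparr>buffer := [], outputs := outputs s @ [(clock s + 1, buffer s)]\<rparr>))
      (tick 1 (t\<lparr>buffer := [], outputs := outputs t @ [(clock t + 1, buffer t)]\<rparr>))"
    by (simp add: agree_def tick_def)
  then show ?case using exec.Flush by blast
next
  case (Seq c s s' d s'')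
  then show ?case
    by simp (blast intro: exec.Seq)
next
  case (CondTrue b s c s' d)
  have "bval b t" "reads c \<subseteq> A"
    using CondTrue bval_agree[of b A s t] by auto
  then show ?case
    using CondTrue.IH[OF _ agree_tick[OF CondTrue.prems(2)]] by (blast intro: exec.CondTrue)
next
  case (CondFalse b s d s' c)
  have "\<not> bval b t" "reads d \<subseteq> A"
    using CondFalse bval_agree[of b A s t] by auto
  then show ?case
    using CondFalse.IH[OF _ agree_tick[OF CondFalse.prems(2)]] by (blast intro: exec.CondFalse)
next
  case (WhileFalse b s c)
  then have "\<not> bval b t"
    using bval_agree[of b A s t] by auto
  then show ?case using exec.WhileFalse agree_tick[OF WhileFalse.prems(2)] by blast
next
  case (WhileTrue b s c s' s'')
  have "bval b t" "reads c \<subseteq> A"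
    using WhileTrue bval_agree[of b A s t] by auto
  then obtain t' where "exec c (tick (1 + bcost b) t) t'" "agree A s' t'"
    using WhileTrue.IH(1)[OF _ agree_tick[OF WhileTrue.prems(2)]] by blast
  with \<open>bval b t\<close> WhileTrue.IH(2)[OF WhileTrue.prems(1)] show ?case
    by (blast intro: exec.WhileTrue)
qed

section \<open>Obstacles seen as cones\<close>

text \<open>The determinant of \<open>a - x\<close> and \<open>b - x\<close>: positive iff, seen
  from \<open>x\<close>, the point \<open>b\<close> lies counterclockwise of \<open>a\<close> by
  less than a half turn.\<close>

definition orient :: "point \<Rightarrow> point \<Rightarrow> point \<Rightarrow> real" where
  "orient x a b = (fst a - fst x) * (snd b - snd x) - (snd a - snd x) * (fst b - fst x)"

text \<open>The inner product of \<open>a - x\<close> and \<open>b - x\<close>, in the coordinates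
  that the machine works with.\<close>

definition pinner :: "point \<Rightarrow> point \<Rightarrow> point \<Rightarrow> real" where
  "pinner x a b = (fst a - fst x) * (fst b - fst x) + (snd a - snd x) * (snd b - snd x)"

lemma orient_same [simp]: "orient x a a = 0" "orient x x a = 0" "orient x a x = 0"
  by (simp_all add: orient_def)

lemma orient_swap: "orient x b a = - orient x a b"
  by (simp add: orient_def algebra_simps)

lemma orient_convex_comb:
  assumes "s + t = 1"
  shows "orient x a (s *\<^sub>R b + t *\<^sub>R c) = s * orient x a b + t * orient x a c"
proof -
  have t: "t = 1 - s" using assms by simp
  show ?thesis unfolding t orient_def by (simp add: algebra_simps)
qed

lemma convex_orient_ge: "convex {p. 0 \<le> orient x a p}"
  unfolding convex_def by (simp add: orient_convex_comb)

lemma convex_orient_gt: "convex {p. 0 < orient x a p}"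
  unfolding convex_def by (simp add: orient_convex_comb) (smt (verit) mult_nonneg_nonneg mult_pos_pos)

lemma hull_orient_ge: "(\<And>p. p \<in> T \<Longrightarrow> 0 \<le> orient x a p) \<Longrightarrow> s \<in> convex hull T \<Longrightarrow> 0 \<le> orient x a s"
  using hull_minimal[of T "{p. 0 \<le> orient x a p}" convex] convex_orient_ge by blast

lemma hull_orient_gt: "(\<And>p. p \<in> T \<Longrightarrow> 0 < orient x a p) \<Longrightarrow> s \<in> convex hull T \<Longrightarrow> 0 < orient x a s"
  using hull_minimal[of T "{p. 0 < orient x a p}" convex] convex_orient_gt by blast

lemma convex_orient_le: "convex {p. 0 \<le> orient x p a}"
proof -
  have "{p. 0 \<le> orient x p a} = {p. 0 \<le> - orient x a p}" by (simp add: orient_swap[of x _ a])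
  then show ?thesis unfolding convex_def
    by (simp add: orient_convex_comb) (smt (verit) mult_nonneg_nonpos)
qed

lemma hull_orient_le: "(\<And>p. p \<in> T \<Longrightarrow> 0 \<le> orient x p a) \<Longrightarrow> s \<in> convex hull T \<Longrightarrow> 0 \<le> orient x s a"
  using hull_minimal[of T "{p. 0 \<le> orient x p a}" convex] convex_orient_le by blast

text \<open>The vector \<open>d\<close> witnesses an open half plane at \<open>x\<close> that
  contains all of \<open>T\<close>. Within it the sign of \<open>orient x\<close> is a total
  preorder of directions, which is false in the whole plane; the transitivity lemmas below rest on
  such a \<open>d\<close>.\<close>

lemma strict_separation:
  fixes x :: point
  assumes "finite T" "x \<notin> convex hull T"
  obtains d where "\<And>s. s \<in> convex hull T \<Longrightarrow> 0 < d \<bullet> (s - x)"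
proof -
  have "closed (convex hull T)"
    using assms(1) by (simp add: finite_imp_compact_convex_hull compact_imp_closed)
  with assms(2) obtain d b where "d \<bullet> x < b" "\<forall>s\<in>convex hull T. b < d \<bullet> s"
    using separating_hyperplane_closed_point[of "convex hull T" x] by auto
  then show thesis
    by (intro that[of d]) (fastforce simp: inner_diff_right)
qed

lemma hull_insert_point:
  fixes p :: "'a::real_vector"
  assumes "s \<in> convex hull (insert p T)" "T \<noteq> {}"
  obtains t q where "0 \<le> t" "t \<le> 1" "q \<in> convex hull T" "s = (1 - t) *\<^sub>R p + t *\<^sub>R q"
proof -
  from assms obtain u v q where "0 \<le> u" "0 \<le> v" "u + v = 1" "q \<in> convex hull T" "s = u *\<^sub>R p + v *\<^sub>R q"
    unfolding convex_hull_insert[OF assms(2)] by auto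
  then show thesis
    by (intro that[of v q]) (auto simp: eq_diff_eq)
qed

text \<open>Three plane vectors satisfy a linear relation whose coefficients are their pairwise
  determinants. This is that relation for \<open>a - x\<close>, \<open>b - x\<close> and
  \<open>c - x\<close>, paired with \<open>d\<close>.\<close>

lemma orient_cycle:
  "(d \<bullet> (b - x)) * orient x a c = (d \<bullet> (c - x)) * orient x a b + (d \<bullet> (a - x)) * orient x b c"
  by (cases a; cases b; cases c; cases d; cases x) (simp add: orient_def algebra_simps)

lemma orient_trans:
  assumes "0 < d \<bullet> (a - x)" "0 < d \<bullet> (b - x)" "0 < d \<bullet> (c - x)"
    and "0 \<le> orient x a b" "0 \<le> orient x b c"
  shows "0 \<le> orient x a c"
proof -
  have "0 \<le> (d \<bullet> (b - x)) * orient x a c"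
    unfolding orient_cycle[of d b x a c] using assms by simp
  with assms(2) show ?thesis by (simp add: zero_le_mult_iff)
qed

lemma orient_strict_trans:
  assumes "0 < d \<bullet> (a - x)" "0 < d \<bullet> (b - x)" "0 < d \<bullet> (c - x)"
    and "0 < orient x a b" "0 \<le> orient x b c"
  shows "0 < orient x a c"
proof -
  have "0 < (d \<bullet> (b - x)) * orient x a c"
    unfolding orient_cycle[of d b x a c] using assms by (simp add: add_pos_nonneg)
  with assms(2) show ?thesis by (simp add: zero_less_mult_iff)
qed

text \<open>Seen from \<open>x\<close>, \<open>l\<close> is the clockwise end of \<open>T\<close>
  and \<open>r\<close> the counterclockwise end. Membership of \<open>l\<close> in \<open>T\<close>
  makes \<open>T\<close> nonempty.\<close>

definition cone_at :: "point \<Rightarrow> point set \<Rightarrow> point \<Rightarrow> point \<Rightarrow> bool" where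
  "cone_at x T l r \<longleftrightarrow> x \<notin> convex hull T \<and> l \<in> T \<and> r \<in> T \<and>
    (\<forall>p\<in>T. 0 \<le> orient x l p \<and> 0 \<le> orient x p r)"

text \<open>
  For the extreme points \<open>l\<close> and \<open>r\<close> of a cone at \<open>x\<close>, this says that \<open>x\<close> is not in the hull of
  \<open>{l, r, p}\<close>; the last disjunct treats the degenerate cone, where \<open>l\<close> and \<open>r\<close> have the same direction.
\<close>

definition fits :: "point \<Rightarrow> point \<Rightarrow> point \<Rightarrow> point \<Rightarrow> bool" where
  "fits x l r p \<longleftrightarrow> \<not> (orient x l p \<le> 0 \<and> orient x p r \<le> 0 \<and>
    (0 < orient x l r \<or> pinner x l p \<le> 0))"

lemma cone_at_singleton: "x \<noteq> p \<Longrightarrow> cone_at x {p} p p"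
  by (simp add: cone_at_def)

text \<open>Dividing the vanishing combination by its total weight turns it into a convex
  combination equal to \<open>x\<close>.\<close>

lemma null_combination_in_hull:
  fixes x :: point
  assumes "0 \<le> a" "0 \<le> b" "0 \<le> c" "0 < a + b + c"
    and "a *\<^sub>R (p - x) + b *\<^sub>R (l - x) + c *\<^sub>R (r - x) = 0"
  shows "x \<in> convex hull {p, l, r}"
proof -
  define k where "k = a + b + c"
  have k: "k > 0" using assms(4) k_def by simp
  have "a *\<^sub>R p + b *\<^sub>R l + c *\<^sub>R r = k *\<^sub>R x"
    using assms(5) unfolding k_def by (simp add: algebra_simps)
  then have "x = (1 / k) *\<^sub>R (a *\<^sub>R p + b *\<^sub>R l + c *\<^sub>R r)"
    using k by simp
  then have "x = (a / k) *\<^sub>R p + (b / k) *\<^sub>R l + (c / k) *\<^sub>R r"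
    by (simp add: scaleR_add_right)
  moreover have "a / k + b / k + c / k = 1"
    using k by (simp add: k_def flip: add_divide_distrib)
  ultimately show ?thesis
    using assms(1-3) k unfolding convex_hull_3
    by (intro CollectI exI[of _ "a / k"] exI[of _ "b / k"] exI[of _ "c / k"]) auto
qed

text \<open>If \<open>p\<close> brings \<open>x\<close> into the hull, then \<open>p\<close> lies
  opposite to some point \<open>q\<close> of the old hull, and the signs known for \<open>q\<close>
  are reversed at \<open>p\<close>. Conversely, these signs are what makes the coefficients of an
  explicit vanishing combination of \<open>p\<close>, \<open>l\<close> and \<open>r\<close>
  nonnegative.\<close>

lemma fits_iff:
  assumes T: "finite T" and cone: "cone_at x T l r"
  shows "fits x l r p \<longleftrightarrow> x \<notin> convex hull (insert p T)"
proof
  have lr: "l \<in> T" "r \<in> T" and x: "x \<notin> convex hull T"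
    and lr0: "\<And>q. q \<in> T \<Longrightarrow> 0 \<le> orient x l q" "\<And>q. q \<in> T \<Longrightarrow> 0 \<le> orient x q r"
    using cone by (auto simp: cone_at_def)
  obtain d where d: "\<And>s. s \<in> convex hull T \<Longrightarrow> 0 < d \<bullet> (s - x)"
    using strict_separation[OF T x] by blast
  have dl: "0 < d \<bullet> (l - x)" and dr: "0 < d \<bullet> (r - x)"
    using d lr hull_inc by metis+
  show "x \<notin> convex hull (insert p T)" if f: "fits x l r p"
  proof
    assume "x \<in> convex hull (insert p T)"
    then obtain t q where t: "0 \<le> t" "t \<le> 1" and q: "q \<in> convex hull T"
      and eq: "x = (1 - t) *\<^sub>R p + t *\<^sub>R q"
      using hull_insert_point lr(1) by (metis empty_iff)
    have "t < 1" using t eq q x by (cases "t = 1") auto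
    have e1: "(1 - t) * fst p + t * fst q = fst x" "(1 - t) * snd p + t * snd q = snd x"
      using eq by (metis fst_add fst_scaleR real_scaleR_def, metis snd_add snd_scaleR real_scaleR_def)
    \<comment> \<open>\<open>p - x\<close> is a nonpositive multiple of \<open>q - x\<close>; the
      factor \<open>- t / (1 - t)\<close> is kept multiplied out.\<close>
    have e: "(1 - t) * (fst p - fst x) = - t * (fst q - fst x)"
      "(1 - t) * (snd p - snd x) = - t * (snd q - snd x)"
      using e1 by (simp_all add: algebra_simps)
    have lq: "0 \<le> orient x l q" "0 \<le> orient x q r"
      using hull_orient_ge[OF lr0(1) q] hull_orient_le[OF lr0(2) q] by auto
    have "(1 - t) * orient x l p = (fst l - fst x) * ((1 - t) * (snd p - snd x))
        - (snd l - snd x) * ((1 - t) * (fst p - fst x))"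
      by (simp add: orient_def algebra_simps)
    also have "\<dots> = - t * orient x l q"
      unfolding e by (simp add: orient_def algebra_simps)
    finally have e2: "(1 - t) * orient x l p = - t * orient x l q" .
    have "(1 - t) * orient x p r = ((1 - t) * (fst p - fst x)) * (snd r - snd x)
        - ((1 - t) * (snd p - snd x)) * (fst r - fst x)"
      by (simp add: orient_def algebra_simps)
    also have "\<dots> = - t * orient x q r"
      unfolding e by (simp add: orient_def algebra_simps)
    finally have e3: "(1 - t) * orient x p r = - t * orient x q r" .
    have "(1 - t) * orient x l p \<le> 0" "(1 - t) * orient x p r \<le> 0"
      unfolding e2 e3 using lq t by simp_all
    then have le: "orient x l p \<le> 0" "orient x p r \<le> 0"
      using \<open>t < 1\<close> by (simp_all add: mult_le_0_iff)
    \<comment> \<open>In a degenerate cone all hull points, \<open>q\<close> in particular, lie on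
      the ray from \<open>x\<close> through \<open>l\<close>, so the opposite point \<open>p\<close>
      has a nonpositive inner product with \<open>l\<close>.\<close>
    have "pinner x l p \<le> 0" if "\<not> 0 < orient x l r"
    proof -
      have lr_0: "orient x l r = 0" using that lr0(1)[OF lr(2)] by simp
      have dq: "0 < d \<bullet> (q - x)" using d[OF q] .
      have "(d \<bullet> (r - x)) * orient x l q = - (d \<bullet> (l - x)) * orient x q r"
        using orient_cycle[of d q x l r] orient_cycle[of d r x l q] lr_0
        by (simp add: orient_swap[of x r q])
      moreover have "0 \<le> (d \<bullet> (r - x)) * orient x l q" using dr lq by simp
      moreover have "- (d \<bullet> (l - x)) * orient x q r \<le> 0" using dl lq by simp
      ultimately have "(d \<bullet> (r - x)) * orient x l q = 0" by linarith
      then have "orient x l q = 0" using dr by simp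
      \<comment> \<open>The Binet-Cauchy identity in the plane, for the pairs \<open>d\<close>,
        \<open>l - x\<close> and \<open>l - x\<close>, \<open>q - x\<close>.\<close>
      have "(d \<bullet> (l - x)) * pinner x l q = (d \<bullet> (q - x)) * ((l - x) \<bullet> (l - x)) +
          ((fst d) * (snd l - snd x) - (snd d) * (fst l - fst x)) * orient x l q"
        by (cases d; cases l; cases q; cases x) (simp add: pinner_def orient_def algebra_simps)
      then have "(d \<bullet> (l - x)) * pinner x l q = (d \<bullet> (q - x)) * ((l - x) \<bullet> (l - x))"
        using \<open>orient x l q = 0\<close> by simp
      then have "0 \<le> (d \<bullet> (l - x)) * pinner x l q"
        using dq by simp
      then have "0 \<le> pinner x l q" using dl by (simp add: zero_le_mult_iff)
      have "(1 - t) * pinner x l p = (fst l - fst x) * ((1 - t) * (fst p - fst x))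
        + (snd l - snd x) * ((1 - t) * (snd p - snd x))"
        by (simp add: pinner_def algebra_simps)
      also have "\<dots> = - t * pinner x l q"
        unfolding e by (simp add: pinner_def algebra_simps)
      also have "\<dots> \<le> 0" using t \<open>0 \<le> pinner x l q\<close> by simp
      finally show ?thesis using \<open>t < 1\<close> by (simp add: mult_le_0_iff)
    qed
    with le f show False by (auto simp: fits_def)
  qed
  show "fits x l r p" if "x \<notin> convex hull (insert p T)"
  proof (rule ccontr)
    assume "\<not> fits x l r p"
    then have le: "orient x l p \<le> 0" "orient x p r \<le> 0" and alt: "0 < orient x l r \<or> pinner x l p \<le> 0"
      by (auto simp: fits_def)
    have "x \<in> convex hull {p, l, r}"
    proof (cases "0 < orient x l r")
      case True
      \<comment> \<open>The linear relation of three plane vectors again. In this case all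
        coefficients are nonnegative and the first is positive.\<close>
      have "orient x l r *\<^sub>R (p - x) + (- orient x p r) *\<^sub>R (l - x) + (- orient x l p) *\<^sub>R (r - x) = 0"
        by (cases l; cases r; cases p; cases x) (simp add: orient_def algebra_simps zero_prod_def)
      then show ?thesis
        by (rule null_combination_in_hull[rotated 4]) (use True le in auto)
    next
      case False
      then have lr_0: "orient x l r = 0" and pin: "pinner x l p \<le> 0"
        using lr0(1)[OF lr(2)] alt by auto
      have "(d \<bullet> (r - x)) * orient x l p = - (d \<bullet> (l - x)) * orient x p r"
        using orient_cycle[of d r x l p] lr_0 by (simp add: orient_swap[of x r p])
      moreover have "(d \<bullet> (r - x)) * orient x l p \<le> 0" using dr le by (simp add: mult_le_0_iff)
      moreover have "0 \<le> - (d \<bullet> (l - x)) * orient x p r" using dl le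
        by (simp add: mult_le_0_iff)
      ultimately have "(d \<bullet> (r - x)) * orient x l p = 0" by linarith
      then have lp: "orient x l p = 0" using dr by simp
      \<comment> \<open>Projecting \<open>p - x\<close> to the direction of \<open>l - x\<close>
        leaves a defect proportional to \<open>orient x l p\<close>, which vanishes here.\<close>
      have "((l - x) \<bullet> (l - x)) *\<^sub>R (p - x) + (- pinner x l p) *\<^sub>R (l - x) + 0 *\<^sub>R (r - x) =
        orient x l p *\<^sub>R (snd x - snd l, fst l - fst x)"
        by (cases l; cases p; cases x) (simp add: pinner_def orient_def algebra_simps)
      then have *: "((l - x) \<bullet> (l - x)) *\<^sub>R (p - x) + (- pinner x l p) *\<^sub>R (l - x) + 0 *\<^sub>R (r - x) = 0"
        using lp by (simp add: zero_prod_def[symmetric])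
      have "l - x \<noteq> 0" using dl by auto
      then have "0 < (l - x) \<bullet> (l - x)" by simp
      then show ?thesis
        by (intro null_combination_in_hull[OF _ _ _ _ *]; use pin in linarith)
    qed
    moreover have "convex hull {p, l, r} \<subseteq> convex hull (insert p T)"
      using lr by (intro hull_mono) auto
    ultimately show False using that by blast
  qed
qed

text \<open>The enlarged set still lies in an open half plane at \<open>x\<close>, where the order
  of directions is transitive. Comparing \<open>p\<close> with the two old ends therefore compares
  it with all of \<open>T\<close>.\<close>

lemma cone_at_insert:
  assumes T: "finite T" and cone: "cone_at x T l r" and x: "x \<notin> convex hull (insert p T)"
  shows "cone_at x (insert p T) (if orient x l p < 0 then p else l) (if orient x p r < 0 then p else r)"
proof -
  obtain d where d: "\<And>s. s \<in> convex hull (insert p T) \<Longrightarrow> 0 < d \<bullet> (s - x)"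
    using strict_separation[OF _ x] T by blast
  have d': "0 < d \<bullet> (s - x)" if "s \<in> insert p T" for s
    using d that hull_inc by metis
  have lr: "l \<in> T" "r \<in> T" and q: "\<And>q. q \<in> T \<Longrightarrow> 0 \<le> orient x l q" "\<And>q. q \<in> T \<Longrightarrow> 0 \<le> orient x q r"
    using cone by (auto simp: cone_at_def)
  have "0 \<le> orient x p q" if "orient x l p < 0" "q \<in> T" for q
    by (rule orient_trans[of d p x l q]) (use that d' q lr orient_swap[of x p l] in auto)
  moreover have "0 \<le> orient x q p" if "orient x p r < 0" "q \<in> T" for q
    by (rule orient_trans[of d q x r p]) (use that d' q lr orient_swap[of x p r] in auto)
  ultimately show ?thesis
    using x lr q by (auto simp: cone_at_def)
qed

section \<open>Wedges between obstacles\<close>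

text \<open>
  The wedges at \<open>v\<close> cut out by the lines through \<open>v\<close> and the obstacles in \<open>B\<close>; the wedge is given
  by the obstacle \<open>y\<close> following it counterclockwise, if any.
\<close>

definition wedge :: "point \<Rightarrow> point set \<Rightarrow> point option \<Rightarrow> point set" where
  "wedge v B y = {w. \<forall>x\<in>B.
    if (case y of None \<Rightarrow> False | Some z \<Rightarrow> orient v x z \<le> 0) then 0 < orient v w x else 0 < orient v x w}"

text \<open>On a wedge, \<open>orient v z\<close> has a constant strict sign, which carries over to
  the hull of \<open>M\<close>. A point \<open>z\<close> between \<open>v\<close> and a point of
  that hull would make it vanish, unless \<open>z\<close> is \<open>v\<close> itself.\<close>

lemma wedge_hull:
  assumes M: "M \<subseteq> wedge v B y" and z: "z \<in> B" "z \<in> convex hull (insert v M)"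
  shows "z = v"
proof (cases "M = {}")
  case True
  then show ?thesis using z by simp
next
  case False
  then obtain t q where t: "0 \<le> t" and q: "q \<in> convex hull M" and eq: "z = (1 - t) *\<^sub>R v + t *\<^sub>R q"
    using hull_insert_point[OF z(2)] by metis
  have "0 = orient v z ((1 - t) *\<^sub>R v + t *\<^sub>R q)" using eq by simp
  also have "\<dots> = t * orient v z q" by (subst orient_convex_comb) auto
  finally have 0: "t * orient v z q = 0" by simp
  have "orient v z q \<noteq> 0"
  proof (cases "case y of None \<Rightarrow> False | Some u \<Rightarrow> orient v z u \<le> 0")
    case True
    then have "0 < orient v p z" if "p \<in> M" for p
      using M z(1) that by (auto simp: wedge_def)
    then have *: "orient v z p < 0" if "p \<in> M" for p
      using that orient_swap[of v z p] by auto
    have "convex {p. orient v z p < 0}"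
      unfolding convex_def
      by (simp add: orient_convex_comb) (smt (verit) mult_nonneg_nonpos mult_pos_neg)
    with * have "convex hull M \<subseteq> {p. orient v z p < 0}"
      by (intro hull_minimal) auto
    with q show ?thesis by auto
  next
    case False
    then have "0 < orient v z p" if "p \<in> M" for p
      using M z(1) that by (auto simp: wedge_def)
    then have "0 < orient v z q" using q by (rule hull_orient_gt)
    then show ?thesis by simp
  qed
  with 0 have "t = 0" by simp
  then show ?thesis using eq by simp
qed

text \<open>The segment from \<open>a\<close> to \<open>b\<close> meets the line through
  \<open>v\<close> and \<open>z\<close> in a point \<open>c\<close> of the hull of \<open>C\<close>.
  If \<open>z\<close> lies between \<open>v\<close> and \<open>c\<close>, it is in the hull of
  \<open>insert v C\<close>. Otherwise \<open>z\<close> lies between \<open>c\<close> and the hull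
  point \<open>q\<close> of \<open>S\<close> behind \<open>z\<close>, hence in the hull of
  \<open>S\<close>.\<close>

lemma obstacle_splits:
  assumes z: "z \<in> convex hull (insert v S)" "z \<notin> convex hull S" "z \<notin> convex hull (insert v C)"
    and C: "C \<subseteq> S" "a \<in> C" "b \<in> C" and ab: "orient v z a \<le> 0" "0 \<le> orient v z b"
  shows False
proof -
  have "z \<noteq> v" using z(3) by (metis hull_inc insertI1)
  obtain t q where t: "0 \<le> t" "t \<le> 1" and q: "q \<in> convex hull S" and eq: "z = (1 - t) *\<^sub>R v + t *\<^sub>R q"
    using hull_insert_point[OF z(1)] C by (metis empty_iff subsetD)
  have t01: "0 < t" "t < 1"
  proof -
    have "t \<noteq> 1" using eq q z(2) by auto
    moreover have "t \<noteq> 0" using eq \<open>z \<noteq> v\<close> by auto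
    ultimately show "0 < t" "t < 1" using t by auto
  qed
  \<comment> \<open>The parameter of the crossing point on the segment from \<open>a\<close> to
    \<open>b\<close>. If the two values coincide, the sign conditions force both to be 0 and
    \<open>a\<close> itself will do.\<close>
  define u where "u = (if orient v z b = orient v z a then 0
    else - orient v z a / (orient v z b - orient v z a))"
  have u: "0 \<le> u" "u \<le> 1" "(1 - u) * orient v z a + u * orient v z b = 0"
    using ab by (auto simp: u_def divide_simps)
  define c where "c = (1 - u) *\<^sub>R a + u *\<^sub>R b"
  have cC: "c \<in> convex hull C"
    unfolding c_def using C u by (intro convexD[OF convex_convex_hull]) (auto intro: hull_inc)
  have "orient v z c = 0" unfolding c_def by (subst orient_convex_comb) (use u in auto)
  have zv: "0 < (z - v) \<bullet> (z - v)" using \<open>z \<noteq> v\<close> by simp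
  \<comment> \<open>The coordinate of \<open>c\<close> on the line where \<open>v\<close> has
    coordinate 0 and \<open>z\<close> has coordinate 1.\<close>
  define k where "k = (c - v) \<bullet> (z - v) / ((z - v) \<bullet> (z - v))"
  have "((z - v) \<bullet> (z - v)) *\<^sub>R (c - v) = ((c - v) \<bullet> (z - v)) *\<^sub>R (z - v) +
      orient v z c *\<^sub>R (snd v - snd z, fst z - fst v)"
    by (cases z; cases v; cases c) (simp add: orient_def algebra_simps)
  then have "((z - v) \<bullet> (z - v)) *\<^sub>R (c - v) = ((c - v) \<bullet> (z - v)) *\<^sub>R (z - v)"
    using \<open>orient v z c = 0\<close> by (simp add: zero_prod_def[symmetric])
  then have "(1 / ((z - v) \<bullet> (z - v))) *\<^sub>R (((z - v) \<bullet> (z - v)) *\<^sub>R (c - v)) = k *\<^sub>R (z - v)"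
    by (simp add: k_def)
  then have "c - v = k *\<^sub>R (z - v)" using zv by simp
  then have ck: "c = v + k *\<^sub>R (z - v)" by (simp add: algebra_simps)
  show False
  proof (cases "1 \<le> k")
    case True
    have "z = (1 - 1 / k) *\<^sub>R v + (1 / k) *\<^sub>R c"
      unfolding ck using True by (simp add: algebra_simps)
    moreover have "c \<in> convex hull (insert v C)" "v \<in> convex hull (insert v C)"
      using cC hull_mono[of C "insert v C"] by (auto intro: hull_inc)
    ultimately have "z \<in> convex hull (insert v C)"
      using True convexD[OF convex_convex_hull, of v _ c "1 - 1 / k" "1 / k"] by simp
    with z(3) show False by simp
  next
    case False
    have cS: "c \<in> convex hull S" using cC hull_mono[OF C(1)] by blast
    have zv2: "z - v = t *\<^sub>R (q - v)" using eq by (simp add: algebra_simps)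
    \<comment> \<open>Now measured with \<open>q\<close> at 1, so that \<open>c\<close> is at
      \<open>k * t\<close> and \<open>z\<close> at \<open>t\<close>; \<open>e\<close> is the
      position of \<open>z\<close> on the segment from \<open>c\<close> to \<open>q\<close>.\<close>
    define e where "e = (1 - k) * t / (1 - k * t)"
    have kt: "k * t < 1"
    proof (cases "k \<le> 0")
      case True
      then have "k * t \<le> 0" using t01 by (simp add: mult_le_0_iff)
      then show ?thesis by simp
    next
      case False
      then have "k * t < k * 1" using t01 by (intro mult_strict_left_mono) auto
      then show ?thesis using \<open>\<not> 1 \<le> k\<close> by simp
    qed
    have "0 \<le> (1 - k) * t" using False t01 by simp
    moreover have "(1 - k) * t \<le> 1 - k * t" using t01 by (simp add: left_diff_distrib)
    ultimately have e: "0 \<le> e" "e \<le> 1"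
      using kt by (simp_all add: e_def)
    have "e * (1 - k * t) = (1 - k) * t" using kt by (simp add: e_def)
    then have e': "(1 - e) * k * t + e = t" by (simp add: algebra_simps)
    have "(1 - e) *\<^sub>R c + e *\<^sub>R q = v + ((1 - e) * k * t + e) *\<^sub>R (q - v)"
      unfolding ck zv2 by (simp add: algebra_simps)
    also have "\<dots> = z" unfolding e' eq by (simp add: algebra_simps)
    finally have "(1 - e) *\<^sub>R c + e *\<^sub>R q = z" .
    moreover have "(1 - e) *\<^sub>R c + e *\<^sub>R q \<in> convex hull S"
      using e by (intro convexD[OF convex_convex_hull] cS q) auto
    ultimately show False using z(2) by simp
  qed
qed

lemma orient_minimum:
  assumes "finite Z" "Z \<noteq> {}" and d: "\<And>z. z \<in> Z \<Longrightarrow> 0 < d \<bullet> (z - x)"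
  shows "\<exists>y\<in>Z. \<forall>z\<in>Z. 0 \<le> orient x y z"
  using assms
proof (induction rule: finite_ne_induct)
  case (insert a Z)
  then obtain y where y: "y \<in> Z" "\<And>z. z \<in> Z \<Longrightarrow> 0 \<le> orient x y z" by blast
  show ?case
  proof (cases "0 \<le> orient x y a")
    case True
    then show ?thesis using y by auto
  next
    case False
    then have "0 \<le> orient x a y" using orient_swap[of x a y] by simp
    then have "0 \<le> orient x a z" if "z \<in> Z" for z
      using insert.prems y that by (intro orient_trans[of d a x y z]) auto
    then show ?thesis by auto
  qed
qed auto

text \<open>By \<open>obstacle_splits\<close>, the line from \<open>v\<close> through an obstacle of
  \<open>B\<close> has all of \<open>C\<close> strictly on one side. So the wedge of a single point
  \<open>c\<close> of \<open>C\<close> is the wedge of all of \<open>C\<close>, and the first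
  obstacle counterclockwise of \<open>c\<close>, if there is one, names it.\<close>

lemma wedge_exists:
  assumes S: "finite S" "v \<notin> convex hull S" and B: "finite B" "B \<subseteq> convex hull (insert v S)"
    and BS: "B \<inter> convex hull S = {}" and C: "C \<subseteq> S" "B \<inter> convex hull (insert v C) = {}"
  shows "C \<subseteq> wedge v B None \<or> (\<exists>y\<in>B. C \<subseteq> wedge v B (Some y))"
proof (cases "C = {}")
  case False
  then obtain c where c: "c \<in> C" by blast
  have side: "0 < orient v a x" if "0 \<le> orient v b x" "a \<in> C" "b \<in> C" "x \<in> B" for a b x
    using that obstacle_splits[of x v S C b a] B BS C orient_swap[of v x a] orient_swap[of v x b]
    by fastforce
  have side': "0 < orient v x a" if "0 \<le> orient v x b" "a \<in> C" "b \<in> C" "x \<in> B" for a b x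
    using that obstacle_splits[of x v S C a b] B BS C by fastforce
  obtain d where d: "\<And>s. s \<in> convex hull S \<Longrightarrow> 0 < d \<bullet> (s - v)"
    using strict_separation[OF S] by blast
  \<comment> \<open>An obstacle of \<open>B\<close> lies between \<open>v\<close> and the hull of
    \<open>S\<close>, so the directions of obstacles and points at \<open>v\<close> share one open
    half plane and are ordered together.\<close>
  have dB: "0 < d \<bullet> (x - v)" if "x \<in> B" for x
  proof -
    obtain t q where t: "0 \<le> t" and q: "q \<in> convex hull S" and eq: "x = (1 - t) *\<^sub>R v + t *\<^sub>R q"
      using hull_insert_point[of x v S] B(2) \<open>x \<in> B\<close> C(1) c by (metis empty_iff subsetD)
    have "x \<noteq> v" using C(2) that by (metis disjoint_iff hull_inc insertI1)
    then have "t \<noteq> 0" using eq by auto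
    have "x - v = t *\<^sub>R (q - v)" using eq by (simp add: algebra_simps)
    then show ?thesis using d[OF q] t \<open>t \<noteq> 0\<close> by simp
  qed
  have dC: "0 < d \<bullet> (c - v)" using d c C hull_inc by (metis subsetD)
  \<comment> \<open>The obstacles counterclockwise of \<open>c\<close>; by \<open>side\<close> and
    \<open>side'\<close> every other point of \<open>C\<close> gives the same set.\<close>
  define Z where "Z = {x \<in> B. 0 < orient v c x}"
  have out: "0 < orient v x a" if "x \<in> B" "x \<notin> Z" "a \<in> C" for x a
    using side'[of x c a] that c orient_swap[of v x c] by (auto simp: Z_def)
  show ?thesis
  proof (cases "Z = {}")
    case True
    then show ?thesis using out by (auto simp: wedge_def)
  next
    case False
    then obtain y where y: "y \<in> Z" "\<And>z. z \<in> Z \<Longrightarrow> 0 \<le> orient v y z"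
      using orient_minimum[of Z d v] B(1) dB by (auto simp: Z_def)
    have "0 < orient v a x" if "a \<in> C" "x \<in> B" "orient v x y \<le> 0" for a x
    proof -
      have "0 < orient v c x"
        using that y(1) dB dC orient_swap[of v y x]
        by (intro orient_strict_trans[of d c v y x]) (auto simp: Z_def)
      then show ?thesis using side[of c x a] that c by simp
    qed
    moreover have "0 < orient v x a" if "a \<in> C" "x \<in> B" "\<not> orient v x y \<le> 0" for a x
      using out[of x a] that y(2)[of x] orient_swap[of v x y] by auto
    ultimately have "C \<subseteq> wedge v B (Some y)" by (auto simp: wedge_def)
    then show ?thesis using y(1) by (auto simp: Z_def)
  qed
qed simp

section \<open>Instances in terms of point indices\<close>

text \<open>\<open>f\<close> is injective on a set containing all edges, so an image edge determines
  the original edge and paths can be pulled back.\<close>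

lemma induces_connected_image:
  assumes "inj_on f U" "S \<subseteq> U" "\<And>e. e \<in> E \<Longrightarrow> e \<subseteq> U"
  shows "induces_connected ((`) f ` E) (f ` S) \<longleftrightarrow> induces_connected E S"
proof -
  let ?R = "{(x, y). x \<in> S \<and> y \<in> S \<and> {x, y} \<in> E}"
  let ?R' = "{(x, y). x \<in> f ` S \<and> y \<in> f ` S \<and> {x, y} \<in> (`) f ` E}"
  have edge: "{f a, f b} \<in> (`) f ` E \<longleftrightarrow> {a, b} \<in> E" if "a \<in> S" "b \<in> S" for a b
  proof
    assume "{f a, f b} \<in> (`) f ` E"
    then obtain e where e: "e \<in> E" "f ` {a, b} = f ` e" by auto
    then have "{a, b} = e"
      using inj_on_image_eq_iff[OF assms(1), of "{a, b}" e] assms(2,3) that by blast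
    with e show "{a, b} \<in> E" by simp
  next
    assume "{a, b} \<in> E"
    then show "{f a, f b} \<in> (`) f ` E" by (intro image_eqI[of _ _ "{a, b}"]) auto
  qed
  have 1: "(f a, f b) \<in> ?R'\<^sup>*" if "(a, b) \<in> ?R\<^sup>*" for a b
    using that
  proof (induction rule: rtrancl_induct)
    case (step b c)
    then have "(f b, f c) \<in> ?R'" using edge by auto
    with step.IH show ?case by (rule rtrancl_into_rtrancl)
  qed simp
  have 2: "\<exists>b\<in>S. c = f b \<and> (a, b) \<in> ?R\<^sup>*" if "(f a, c) \<in> ?R'\<^sup>*" "a \<in> S" for a c
    using that(1)
  proof (induction rule: rtrancl_induct)
    case base
    then show ?case using that(2) by auto
  next
    case (step c d)
    then obtain b b' where b: "b \<in> S" "c = f b" "(a, b) \<in> ?R\<^sup>*" "b' \<in> S" "d = f b'" by auto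
    with step have "(b, b') \<in> ?R" using edge by auto
    with b(3) have "(a, b') \<in> ?R\<^sup>*" by (rule rtrancl_into_rtrancl)
    with b show ?case by blast
  qed
  have 3: "(a, b) \<in> ?R\<^sup>*" if ab: "a \<in> S" "b \<in> S" and R': "(f a, f b) \<in> ?R'\<^sup>*" for a b
  proof -
    obtain b' where "b' \<in> S" "f b = f b'" "(a, b') \<in> ?R\<^sup>*" using 2[OF R' ab(1)] by blast
    moreover have "b = b'" using calculation ab assms(1,2) by (meson inj_onD subsetD)
    ultimately show ?thesis by simp
  qed
  show ?thesis unfolding induces_connected_def using 1 3 by blast
qed

lemma induces_connected_empty [simp]: "induces_connected E {}"
  and induces_connected_singleton [simp]: "induces_connected E {v}"
  by (auto simp: induces_connected_def)

lemma induces_connected_insert: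
  assumes S: "induces_connected E S" and u: "u \<in> S" "{u, w} \<in> E"
  shows "induces_connected E (insert w S)"
proof -
  let ?R = "\<lambda>S. {(x, y). x \<in> S \<and> y \<in> S \<and> {x, y} \<in> E}"
  have sub: "(?R S)\<^sup>* \<subseteq> (?R (insert w S))\<^sup>*" by (intro rtrancl_mono) auto
  have uw: "(u, w) \<in> ?R (insert w S)" "(w, u) \<in> ?R (insert w S)"
    using u by (auto simp: insert_commute)
  have to_u: "(a, u) \<in> (?R (insert w S))\<^sup>*" "(u, a) \<in> (?R (insert w S))\<^sup>*" if "a \<in> insert w S" for a
    using that S u sub uw unfolding induces_connected_def by blast+
  show ?thesis
    unfolding induces_connected_def using to_u by (meson rtrancl_trans)
qed

text \<open>A path in \<open>T\<close> from a point of \<open>S\<close> to a point outside must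
  leave \<open>S\<close> along some edge. This is the only form in which connectivity is exploited
  later.\<close>

lemma induces_connected_crossing:
  assumes "induces_connected E T" "S \<subset> T" "S \<noteq> {}"
  obtains u w where "u \<in> S" "w \<in> T - S" "{u, w} \<in> E"
proof -
  obtain a b where a: "a \<in> S" and b: "b \<in> T - S" using assms by blast
  let ?R = "{(x, y). x \<in> T \<and> y \<in> T \<and> {x, y} \<in> E}"
  have "(a, b) \<in> ?R\<^sup>*" using assms a b by (auto simp: induces_connected_def)
  then have "b \<in> S \<or> (\<exists>u\<in>S. \<exists>w\<in>T - S. {u, w} \<in> E)"
    by (induction rule: rtrancl_induct) (use a in auto)
  then show thesis using b that by blast
qed

locale hull_inst =
  fixes I :: hull_instance
  assumes valid: "valid_hull_instance I"
begin

abbreviation "np \<equiv> length (pts I)"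
abbreviation "nx \<equiv> length (obstacles I)"
abbreviation "ne \<equiv> length (edges I)"
abbreviation "P v \<equiv> pts I ! v"
abbreviation "X x \<equiv> obstacles I ! x"

definition E :: "nat set set" where
  "E = (\<lambda>(u, v). {u, v}) ` set (edges I)"

text \<open>Stated for an arbitrary edge list, so that the adjacency arrays can be described after a
  prefix of the edges has been processed.\<close>

definition nbrs_of :: "(nat \<times> nat) list \<Rightarrow> nat \<Rightarrow> nat list" where
  "nbrs_of es u = concat (map (\<lambda>(a, b). (if a = u then [b] else []) @ (if b = u then [a] else [])) es)"

abbreviation nbrs :: "nat \<Rightarrow> nat list" where
  "nbrs \<equiv> nbrs_of (edges I)"

definition free :: "nat set \<Rightarrow> bool" where
  "free T \<longleftrightarrow> convex hull (P ` T) \<inter> X_of I = {}"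

definition sol :: "nat set \<Rightarrow> bool" where
  "sol T \<longleftrightarrow> T \<subseteq> {..<np} \<and> free T \<and> induces_connected E T \<and>
    (\<forall>T'. T' \<subseteq> {..<np} \<and> free T' \<and> induces_connected E T' \<and> T \<subseteq> T' \<longrightarrow> T' = T)"

lemma edge_bounds: "(u, v) \<in> set (edges I) \<Longrightarrow> u < np \<and> v < np \<and> u \<noteq> v"
  using valid by (auto simp: valid_hull_instance_def)

lemma inj_P: "inj_on P {..<np}"
  using valid by (auto simp: valid_hull_instance_def inj_on_def nth_eq_iff_index_eq)

lemma V_of_eq: "V_of I = P ` {..<np}"
  by (auto simp: V_of_def set_conv_nth)

lemma X_of_iff: "z \<in> X_of I \<longleftrightarrow> (\<exists>x<nx. z = X x)"
  by (auto simp: X_of_def set_conv_nth)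

lemma E_bounds: "e \<in> E \<Longrightarrow> e \<subseteq> {..<np}"
  using edge_bounds by (auto simp: E_def)

lemma E_of_eq: "E_of I = (`) P ` E"
  by (auto simp: E_of_def E_def image_image case_prod_beta)

lemma connected_P:
  "T \<subseteq> {..<np} \<Longrightarrow> induces_connected (E_of I) (P ` T) \<longleftrightarrow> induces_connected E T"
  unfolding E_of_eq by (rule induces_connected_image[OF inj_P]) (use E_bounds in auto)

lemma card_V: "card (V_of I) = np"
  using valid by (simp add: V_of_def valid_hull_instance_def distinct_card)

lemma card_X: "card (X_of I) = nx"
  using valid by (simp add: X_of_def valid_hull_instance_def distinct_card)

lemma card_E: "card (E_of I) = ne"
proof -
  have "inj_on ((`) P) E"
  proof (rule inj_onI)
    fix e f assume "e \<in> E" "f \<in> E" "P ` e = P ` f"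
    then show "e = f" using inj_on_image_eq_iff[OF inj_P] E_bounds by blast
  qed
  then have "card (E_of I) = card E" by (simp add: E_of_eq card_image)
  also have "E = set (map (\<lambda>(u, v). {u, v}) (edges I))" by (simp add: E_def)
  also have "card \<dots> = length (map (\<lambda>(u, v). {u, v}) (edges I))"
    by (rule distinct_card) (use valid in \<open>simp add: valid_hull_instance_def\<close>)
  finally show ?thesis by simp
qed

text \<open>The input size counts points and obstacles only, so polynomial bounds require the number
  of edges to be bounded by the number of points.\<close>

lemma ne_le: "ne \<le> np * np"
proof -
  have "set (edges I) \<subseteq> {..<np} \<times> {..<np}" using edge_bounds by auto
  then have "card (set (edges I)) \<le> np * np"
    using card_mono[of "{..<np} \<times> {..<np}" "set (edges I)"] by (simp add: card_cartesian_product)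
  moreover have "distinct (edges I)"
    using valid unfolding valid_hull_instance_def by (metis distinct_map)
  ultimately show ?thesis by (simp add: distinct_card)
qed

text \<open>From here on sets of positions replace sets of points. Since \<open>P\<close> is
  injective on positions, the translation preserves inclusion in both directions and therefore
  maximality.\<close>

lemma solutions_eq: "solutions hull_problem I = (`) P ` {T. sol T}"
proof -
  have eq: "connected_obstacle_free_hull (V_of I) (X_of I) (E_of I) S \<longleftrightarrow>
      (\<exists>T\<subseteq>{..<np}. S = P ` T \<and> free T \<and> induces_connected E T)" for S
  proof
    assume c: "connected_obstacle_free_hull (V_of I) (X_of I) (E_of I) S"
    then obtain T where "T \<subseteq> {..<np}" "S = P ` T"
      unfolding connected_obstacle_free_hull_def V_of_eq by (meson subset_imageE)
    with c show "\<exists>T\<subseteq>{..<np}. S = P ` T \<and> free T \<and> induces_connected E T"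
      using connected_P by (auto simp: connected_obstacle_free_hull_def free_def)
  next
    assume "\<exists>T\<subseteq>{..<np}. S = P ` T \<and> free T \<and> induces_connected E T"
    then show "connected_obstacle_free_hull (V_of I) (X_of I) (E_of I) S"
      using connected_P by (auto simp: connected_obstacle_free_hull_def free_def V_of_eq)
  qed
  have sub: "P ` T \<subseteq> P ` T' \<longleftrightarrow> T \<subseteq> T'" "P ` T' = P ` T \<longleftrightarrow> T' = T"
    if "T \<subseteq> {..<np}" "T' \<subseteq> {..<np}" for T T'
    using that by (simp_all add: inj_on_image_subset_iff[OF inj_P] inj_on_image_eq_iff[OF inj_P])
  have mx: "(\<forall>S. connected_obstacle_free_hull (V_of I) (X_of I) (E_of I) S \<and> P ` T \<subseteq> S \<longrightarrow> S = P ` T) \<longleftrightarrow>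
      (\<forall>T'. T' \<subseteq> {..<np} \<and> free T' \<and> induces_connected E T' \<and> T \<subseteq> T' \<longrightarrow> T' = T)"
    if T: "T \<subseteq> {..<np}" for T
  proof (intro iffI allI impI)
    fix T' assume *: "\<forall>S. connected_obstacle_free_hull (V_of I) (X_of I) (E_of I) S \<and> P ` T \<subseteq> S \<longrightarrow> S = P ` T"
      and T': "T' \<subseteq> {..<np} \<and> free T' \<and> induces_connected E T' \<and> T \<subseteq> T'"
    then have "connected_obstacle_free_hull (V_of I) (X_of I) (E_of I) (P ` T')" unfolding eq by blast
    moreover have "P ` T \<subseteq> P ` T'" using T' by blast
    ultimately have "P ` T' = P ` T" using * by blast
    then show "T' = T" using sub(2)[OF T] T' by blast
  next
    fix S assume *: "\<forall>T'. T' \<subseteq> {..<np} \<and> free T' \<and> induces_connected E T' \<and> T \<subseteq> T' \<longrightarrow> T' = T"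
      and S: "connected_obstacle_free_hull (V_of I) (X_of I) (E_of I) S \<and> P ` T \<subseteq> S"
    then obtain T' where T': "T' \<subseteq> {..<np}" "S = P ` T'" "free T'" "induces_connected E T'"
      unfolding eq by blast
    then have "T \<subseteq> T'" using sub(1)[OF T T'(1)] S by blast
    then show "S = P ` T" using * T' by blast
  qed
  have sol_iff: "sol T \<longleftrightarrow> T \<subseteq> {..<np} \<and> P ` T \<in> solutions hull_problem I" for T
  proof (cases "T \<subseteq> {..<np}")
    case True
    have c: "connected_obstacle_free_hull (V_of I) (X_of I) (E_of I) (P ` T) \<longleftrightarrow> free T \<and> induces_connected E T"
      using True by (simp add: connected_obstacle_free_hull_def free_def connected_P V_of_eq image_mono)
    have "P ` T \<in> solutions hull_problem I \<longleftrightarrow> connected_obstacle_free_hull (V_of I) (X_of I) (E_of I) (P ` T) \<and>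
        (\<forall>S. connected_obstacle_free_hull (V_of I) (X_of I) (E_of I) S \<and> P ` T \<subseteq> S \<longrightarrow> S = P ` T)"
      by (simp add: hull_problem_def maximal_connected_obstacle_free_hulls_def)
    then show ?thesis
      unfolding mx[OF True] sol_def c using True by simp
  qed (simp add: sol_def)
  have "\<exists>T\<subseteq>{..<np}. S = P ` T" if "S \<in> solutions hull_problem I" for S
    using that eq by (auto simp: hull_problem_def maximal_connected_obstacle_free_hulls_def)
  then show ?thesis using sol_iff by blast
qed

lemma sol_subset: "sol T \<Longrightarrow> T \<subseteq> {..<np}"
  by (simp add: sol_def)

lemma sol_finite: "sol T \<Longrightarrow> finite T"
  using finite_subset[OF sol_subset] by blast

lemma finite_sols: "finite {T. sol T}"
  by (rule finite_subset[of _ "Pow {..<np}"]) (auto simp: sol_def)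

lemma nbrs_of_append: "nbrs_of (es @ es') u = nbrs_of es u @ nbrs_of es' u"
  by (simp add: nbrs_of_def)

lemma set_nbrs: "w \<in> set (nbrs u) \<longleftrightarrow> {u, w} \<in> E"
  by (auto simp: nbrs_of_def E_def doubleton_eq_iff split: if_splits) force+

text \<open>The handshake count; it pays for reading all adjacency lists once.\<close>

lemma sum_nbrs: "(\<Sum>u<np. length (nbrs u)) = 2 * ne"
proof -
  have "(\<Sum>u<np. length (nbrs_of es u)) = 2 * length es" if "set es \<subseteq> set (edges I)" for es
    using that
  proof (induction es)
    case Nil
    then show ?case by (simp add: nbrs_of_def)
  next
    case (Cons e es)
    obtain a b where e: "e = (a, b)" by (cases e)
    then have ab: "a < np" "b < np" using Cons.prems edge_bounds[of a b] by auto
    have *: "length (nbrs_of (e # es) u) =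
        (if a = u then 1 else 0) + (if b = u then 1 else 0) + length (nbrs_of es u)" for u
      by (simp add: nbrs_of_def e)
    show ?case unfolding * sum.distrib using Cons ab by simp
  qed
  then show ?thesis by simp
qed

lemma free_mono: "S \<subseteq> T \<Longrightarrow> free T \<Longrightarrow> free S"
  unfolding free_def by (meson disjoint_iff hull_mono image_mono subset_iff)

lemma free_singleton: "free {v} \<longleftrightarrow> P v \<notin> X_of I"
  by (auto simp: free_def)

lemma free_point: "free T \<Longrightarrow> v \<in> T \<Longrightarrow> P v \<notin> X_of I"
  using free_mono[of "{v}" T] free_singleton by auto

lemma free_empty: "free {}"
  by (simp add: free_def)

text \<open>Single adjacent vertices suffice as tests: a larger connected obstacle-free set leaves
  \<open>T\<close> along an edge, and obstacle-freeness passes to subsets. Without a point in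
  \<open>T\<close> there would be no such edge.\<close>

lemma solI:
  assumes T: "T \<subseteq> {..<np}" "free T" "induces_connected E T" "T \<noteq> {}"
    and max: "\<And>w u. w < np \<Longrightarrow> w \<notin> T \<Longrightarrow> u \<in> T \<Longrightarrow> {u, w} \<in> E \<Longrightarrow> \<not> free (insert w T)"
  shows "sol T"
  unfolding sol_def
proof (intro conjI allI impI T)
  fix T' assume "T' \<subseteq> {..<np} \<and> free T' \<and> induces_connected E T' \<and> T \<subseteq> T'"
  then have T': "T' \<subseteq> {..<np}" "free T'" "induces_connected E T'" "T \<subseteq> T'" by auto
  show "T' = T"
  proof (rule ccontr)
    assume "T' \<noteq> T"
    then have "T \<subset> T'" using T' by blast
    then obtain u w where u: "u \<in> T" "w \<in> T' - T" "{u, w} \<in> E"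
      by (rule induces_connected_crossing[OF T'(3) _ T(4)])
    moreover have "free (insert w T)" by (rule free_mono[OF _ T'(2)]) (use u T' in auto)
    ultimately show False using max[of w u] T'(1) by auto
  qed
qed

lemma sol_empty: "(\<And>v. v < np \<Longrightarrow> P v \<in> X_of I) \<Longrightarrow> sol {}"
  unfolding sol_def using free_empty free_point by auto

lemma sol_nonempty: "sol S \<Longrightarrow> v < np \<Longrightarrow> P v \<notin> X_of I \<Longrightarrow> S \<noteq> {}"
  unfolding sol_def using free_singleton[of v] by auto

section \<open>Proximity\<close>

definition bad :: "nat set \<Rightarrow> nat \<Rightarrow> point set" where
  "bad S v = X_of I \<inter> convex hull (P ` insert v S)"

text \<open>The index \<open>y = nx\<close> stands for the wedge that is not followed by an obstacle.\<close>

definition mask :: "nat set \<Rightarrow> nat \<Rightarrow> nat \<Rightarrow> nat set" where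
  "mask S v y = {w \<in> S. P w \<in> wedge (P v) (bad S v) (if y < nx then Some (X y) else None)}"

definition prox :: "nat set \<Rightarrow> nat set \<Rightarrow> nat" where
  "prox S T = Max (card ` {C. C \<subseteq> S \<inter> T \<and> induces_connected E C})"

text \<open>Quantified over all \<open>C\<close> because the relevant one depends on the target
  solution, which the search does not know.\<close>

definition neighbor :: "nat set \<Rightarrow> nat \<Rightarrow> nat \<Rightarrow> nat set \<Rightarrow> bool" where
  "neighbor S v y S' \<longleftrightarrow> sol S' \<and> v \<in> S' \<and>
    (\<forall>C\<subseteq>mask S v y. induces_connected E (insert v C) \<longrightarrow> C \<subseteq> S')"

text \<open>By \<open>wedge_hull\<close>, an obstacle in this hull would have to coincide with
  \<open>P v\<close>.\<close>

lemma mask_free: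
  assumes "P v \<notin> X_of I" "M \<subseteq> mask S v y"
  shows "free (insert v M)"
  unfolding free_def
proof (rule equals0I)
  fix z assume z: "z \<in> convex hull (P ` insert v M) \<inter> X_of I"
  have "P ` insert v M \<subseteq> P ` insert v S" using assms(2) by (auto simp: mask_def)
  then have "z \<in> bad S v" using z hull_mono[of "P ` insert v M" "P ` insert v S"] by (auto simp: bad_def)
  moreover have "P ` M \<subseteq> wedge (P v) (bad S v) (if y < nx then Some (X y) else None)"
    using assms(2) by (auto simp: mask_def)
  ultimately have "z = P v" using wedge_hull z by auto
  with z assms(1) show False by simp
qed

lemma mask_exists:
  assumes S: "S \<subseteq> {..<np}" "free S" "P v \<notin> convex hull (P ` S)" and C: "C \<subseteq> S" "free (insert v C)"
  shows "\<exists>y\<le>nx. C \<subseteq> mask S v y"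
proof -
  have "finite S" using S(1) finite_subset by blast
  have "P ` C \<subseteq> wedge (P v) (bad S v) None \<or> (\<exists>y\<in>bad S v. P ` C \<subseteq> wedge (P v) (bad S v) (Some y))"
    by (rule wedge_exists[of "P ` S"])
      (use S C \<open>finite S\<close> in \<open>auto simp: bad_def free_def X_of_def\<close>)
  then show ?thesis
  proof
    assume "P ` C \<subseteq> wedge (P v) (bad S v) None"
    then show ?thesis using C by (intro exI[of _ nx]) (auto simp: mask_def)
  next
    assume "\<exists>y\<in>bad S v. P ` C \<subseteq> wedge (P v) (bad S v) (Some y)"
    then obtain y where "y < nx" "P ` C \<subseteq> wedge (P v) (bad S v) (Some (X y))"
      using X_of_iff by (auto simp: bad_def)
    then show ?thesis using C by (intro exI[of _ y]) (auto simp: mask_def)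
  qed
qed

lemma prox_ge:
  assumes "finite S" "C \<subseteq> S \<inter> T" "induces_connected E C"
  shows "card C \<le> prox S T"
  unfolding prox_def using assms
  by (intro Max_ge) (auto intro!: finite_imageI intro: finite_subset[of _ "Pow S"])

lemma prox_attained:
  assumes "finite S"
  obtains C where "C \<subseteq> S \<inter> T" "induces_connected E C" "card C = prox S T"
proof -
  let ?A = "card ` {C. C \<subseteq> S \<inter> T \<and> induces_connected E C}"
  have "{} \<in> {C. C \<subseteq> S \<inter> T \<and> induces_connected E C}" by simp
  then have "?A \<noteq> {}" by blast
  moreover have "finite ?A"
    using assms by (auto intro!: finite_imageI intro: finite_subset[of _ "Pow S"])
  ultimately have "prox S T \<in> ?A" unfolding prox_def by (rule Max_in[rotated])
  then show thesis using that by force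
qed

lemma free_insert_hull:
  assumes "free S" "P v \<in> convex hull (P ` S)"
  shows "free (insert v S)"
  using assms hull_redundant[of "P v" convex "P ` S"] by (simp add: free_def)

lemma proximity:
  assumes S: "sol S" and T: "sol T" and "S \<noteq> T"
  shows "\<exists>v<np. P v \<notin> X_of I \<and> (\<exists>y\<le>nx. \<forall>S'. neighbor S v y S' \<longrightarrow> prox S T < prox S' T)"
proof -
  obtain C where C: "C \<subseteq> S \<inter> T" "induces_connected E C" "card C = prox S T"
    using prox_attained[OF sol_finite[OF S]] .
  have "\<not> T \<subseteq> S" using S T \<open>S \<noteq> T\<close> unfolding sol_def by blast
  then have "C \<noteq> T" using C(1) by blast
  then have "C \<subset> T" using C(1) by blast
  have finC: "finite C" using C(1) sol_finite[OF S] finite_subset by blast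
  have "\<exists>v y. v \<in> T - C \<and> induces_connected E (insert v C) \<and> y \<le> nx \<and> C \<subseteq> mask S v y"
  proof (cases "C = {}")
    \<comment> \<open>Any point of \<open>T\<close> and any wedge will do, since a solution
      containing that point already has proximity at least 1.\<close>
    case True
    then show ?thesis using \<open>C \<subset> T\<close> by auto
  next
    case False
    have "induces_connected E T" using T by (simp add: sol_def)
    then obtain u v where u: "u \<in> C" and v: "v \<in> T - C" "{u, v} \<in> E"
      using \<open>C \<subset> T\<close> False by (rule induces_connected_crossing)
    have conn: "induces_connected E (insert v C)"
      using induces_connected_insert[OF C(2) u v(2)] .
    \<comment> \<open>Otherwise \<open>insert v C\<close> would be a larger connected subset of
      \<open>S \<inter> T\<close>.\<close>
    have "v \<notin> S"
    proof
      assume "v \<in> S"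
      then have "card (insert v C) \<le> prox S T"
        using C v conn by (intro prox_ge sol_finite[OF S]) auto
      then show False using v finC C(3) by simp
    qed
    have "P v \<notin> convex hull (P ` S)"
    proof
      assume "P v \<in> convex hull (P ` S)"
      then have "free (insert v S)" using S free_insert_hull by (simp add: sol_def)
      moreover have "induces_connected E (insert v S)"
        by (rule induces_connected_insert[of E S u v]) (use S C(1) u v(2) in \<open>auto simp: sol_def\<close>)
      moreover have "insert v S \<subseteq> {..<np}" using sol_subset[OF S] sol_subset[OF T] v by blast
      ultimately have "insert v S = S"
        using S unfolding sol_def by blast
      with \<open>v \<notin> S\<close> show False by blast
    qed
    moreover have "free (insert v C)"
      by (rule free_mono[of _ T]) (use T C(1) v in \<open>auto simp: sol_def\<close>)
    ultimately obtain y where "y \<le> nx" "C \<subseteq> mask S v y"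
      using mask_exists[of S v C] S C(1) by (auto simp: sol_def)
    with v conn show ?thesis by blast
  qed
  then obtain v y where v: "v \<in> T - C" "induces_connected E (insert v C)" and y: "y \<le> nx" "C \<subseteq> mask S v y"
    by blast
  have "prox S T < prox S' T" if "neighbor S v y S'" for S'
  proof -
    have "sol S'" "insert v C \<subseteq> S'" using that v y by (auto simp: neighbor_def)
    then have "card (insert v C) \<le> prox S' T"
      using v C(1) by (intro prox_ge sol_finite) auto
    then show ?thesis using v finC C(3) by simp
  qed
  moreover have "v < np" "P v \<notin> X_of I"
    using T v free_point by (auto simp: sol_def)
  ultimately show ?thesis using y by blast
qed

end

section \<open>Growing a connected obstacle-free set\<close>

text \<open>
  Use of the integer arrays, after the inputs in arrays 0 to 4:

  \<^item> 5, 6: adjacency lists; 7: powers of two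

  \<^item> 8: characteristic function of the current solution; 9, 10: its extreme points as seen from the obstacles

  \<^item> 11, 12: extreme points of the set under construction; 13, 14: its elements and their number

  \<^item> 15: search position in array 13; 16: nonzero for vertices that are decided or excluded

  \<^item> 17, 18, 19: current vertex, position in its adjacency list, candidate vertex; 20: outcome of a test

  \<^item> 21, 22, 23: current obstacle, start vertex and wedge; 29: some element of the current solution

  \<^item> 24: table of known codes; 25, 26, 27: queue of codes with its head and tail; 28: current code

  \<^item> 30, 31: loop counters
\<close>

definition pt :: "iexp \<Rightarrow> rexp \<times> rexp" where
  "pt e = (RRead 0 e, RRead 1 e)"

definition ob :: "iexp \<Rightarrow> rexp \<times> rexp" where
  "ob e = (RRead 2 e, RRead 3 e)"

definition val2 :: "rexp \<times> rexp \<Rightarrow> state \<Rightarrow> point" where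
  "val2 p s = (rval (fst p) s, rval (snd p) s)"

definition rorient :: "rexp \<times> rexp \<Rightarrow> rexp \<times> rexp \<Rightarrow> rexp \<times> rexp \<Rightarrow> rexp" where
  "rorient x a b = RSub (RMul (RSub (fst a) (fst x)) (RSub (snd b) (snd x)))
    (RMul (RSub (snd a) (snd x)) (RSub (fst b) (fst x)))"

definition rpinner :: "rexp \<times> rexp \<Rightarrow> rexp \<times> rexp \<Rightarrow> rexp \<times> rexp \<Rightarrow> rexp" where
  "rpinner x a b = RAdd (RMul (RSub (fst a) (fst x)) (RSub (fst b) (fst x)))
    (RMul (RSub (snd a) (snd x)) (RSub (snd b) (snd x)))"

definition pos :: "rexp \<Rightarrow> bexp" where
  "pos e = RLess (RNum 0) e"

definition neg :: "rexp \<Rightarrow> bexp" where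
  "neg e = RLess e (RNum 0)"

text \<open>\<open>fits\<close> with its disjunction resolved by De Morgan, as the machine has only
  negation and conjunction. The cone arrays are parameters because both the set under construction
  and the current solution are tested.\<close>

definition fits_e :: "nat \<Rightarrow> nat \<Rightarrow> iexp \<Rightarrow> iexp \<Rightarrow> bexp" where
  "fits_e cl cr x p = BNot (BAnd
    (BAnd (BNot (pos (rorient (ob x) (pt (IRead cl x)) (pt p))))
      (BNot (pos (rorient (ob x) (pt p) (pt (IRead cr x))))))
    (BNot (BAnd (BNot (pos (rorient (ob x) (pt (IRead cl x)) (pt (IRead cr x)))))
      (pos (rpinner (ob x) (pt (IRead cl x)) (pt p))))))"

lemma rval_rorient [simp]: "rval (rorient x a b) s = orient (val2 x s) (val2 a s) (val2 b s)"
  by (simp add: rorient_def orient_def val2_def)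

lemma rval_rpinner [simp]: "rval (rpinner x a b) s = pinner (val2 x s) (val2 a s) (val2 b s)"
  by (simp add: rpinner_def pinner_def val2_def)

lemma bval_pos [simp]: "bval (pos e) s \<longleftrightarrow> 0 < rval e s"
  and bval_neg [simp]: "bval (neg e) s \<longleftrightarrow> rval e s < 0"
  by (simp_all add: pos_def neg_def)

lemma bval_fits_e [simp]: "bval (fits_e cl cr x p) s \<longleftrightarrow>
    fits (val2 (ob x) s) (val2 (pt (IRead cl x)) s) (val2 (pt (IRead cr x)) s) (val2 (pt p) s)"
  by (auto simp: fits_e_def fits_def not_less)

definition cost2 :: "rexp \<times> rexp \<Rightarrow> nat" where
  "cost2 p = rcost (fst p) + rcost (snd p)"

lemma cost2_simps [simp]: "cost2 (pt e) = 2 + 2 * icost e" "cost2 (ob e) = 2 + 2 * icost e"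
  by (simp_all add: cost2_def pt_def ob_def)

lemma cost_simps [simp]:
  "rcost (rorient x a b) = 7 + 2 * cost2 x + cost2 a + cost2 b"
  "rcost (rpinner x a b) = 7 + 2 * cost2 x + cost2 a + cost2 b"
  "bcost (pos e) = 2 + rcost e"
  "bcost (neg e) = 2 + rcost e"
  by (simp_all add: rorient_def rpinner_def pos_def neg_def cost2_def)

lemma cost_fits_e [simp]: "bcost (fits_e cl cr x p) = 86 + 26 * icost x + 6 * icost p"
  by (simp add: fits_e_def)

abbreviation "J \<equiv> IRead 0 (INum 0)"
abbreviation "H \<equiv> IRead 0 (INum 1)"
abbreviation "M \<equiv> IRead 0 (INum 2)"

definition START :: com where
  "START = Seq (For 21 H (Seq (IWrite 11 (Var 21) (Var 22)) (IWrite 12 (Var 21) (Var 22))))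
    (Seq (IWrite 13 (INum 0) (Var 22)) (IWrite 14 (INum 0) (INum 1)))"

definition WIDEN :: "nat \<Rightarrow> nat \<Rightarrow> com" where
  "WIDEN cl cr = Seq
    (Cond (neg (rorient (ob (Var 21)) (pt (IRead cl (Var 21))) (pt (Var 19))))
      (IWrite cl (Var 21) (Var 19)) Skip)
    (Cond (neg (rorient (ob (Var 21)) (pt (Var 19)) (pt (IRead cr (Var 21)))))
      (IWrite cr (Var 21) (Var 19)) Skip)"

definition CHECK :: com where
  "CHECK = Seq (IWrite 20 (INum 0) (INum 1))
    (For 21 H (Cond (fits_e 11 12 (Var 21) (Var 19)) Skip (IWrite 20 (INum 0) (INum 0))))"

definition TRY :: com where
  "TRY = Seq CHECK (Cond (ILess (INum 0) (Var 20))
      (Seq (IWrite 13 (Var 14) (Var 19)) (Seq (IWrite 14 (INum 0) (IAdd (Var 14) (INum 1)))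
        (For 21 H (WIDEN 11 12)))) Skip)"

definition INNER :: com where
  "INNER = Seq (IWrite 19 (INum 0) (IRead 6 (Var 18)))
    (Seq (IWrite 18 (INum 0) (IAdd (Var 18) J))
    (Cond (ILess (IRead 16 (Var 19)) (INum 1)) (Seq (IWrite 16 (Var 19) (INum 1)) TRY) Skip))"

definition SCAN :: com where
  "SCAN = Seq (IWrite 17 (INum 0) (IRead 13 (Var 15)))
    (Seq (IWrite 15 (INum 0) (IAdd (Var 15) (INum 1)))
    (Seq (IWrite 18 (INum 0) (Var 17))
    (While (ILess (Var 18) (IRead 5 (Var 17))) INNER)))"

definition GROW :: com where
  "GROW = Seq (IWrite 15 (INum 0) (INum 0)) (While (ILess (Var 15) (Var 14)) SCAN)"

lemmas search_defs = START_def WIDEN_def CHECK_def TRY_def INNER_def SCAN_def GROW_def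

lemma writes_WIDEN [simp]: "writes (WIDEN cl cr) = {cl, cr}"
  and writes_CHECK [simp]: "writes CHECK = {20, 21}"
  and writes_START [simp]: "writes START = {11, 12, 13, 14, 21}"
  and writes_TRY [simp]: "writes TRY = {11, 12, 13, 14, 20, 21}"
  and writes_INNER [simp]: "writes INNER = {11, 12, 13, 14, 16, 18, 19, 20, 21}"
  and writes_SCAN [simp]: "writes SCAN = {11, 12, 13, 14, 15, 16, 17, 18, 19, 20, 21}"
  and writes_GROW [simp]: "writes GROW = {11, 12, 13, 14, 15, 16, 17, 18, 19, 20, 21}"
  by (auto simp: search_defs)

lemma real_free_search [simp]:
  "real_free (WIDEN cl cr)" "real_free CHECK" "real_free START" "real_free SCAN" "real_free GROW"
  by (auto simp: search_defs)

lemma quiet_search [simp]: "quiet (WIDEN cl cr)" "quiet START" "quiet GROW"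
  by (auto simp: search_defs)

context hull_inst
begin

definition inputs :: "state \<Rightarrow> bool" where
  "inputs s \<longleftrightarrow> rmem s = load (snd (inp hull_problem I)) \<and>
    imem s 0 0 = np \<and> imem s 0 (Suc 0) = nx \<and> imem s 0 2 = ne \<and>
    (\<forall>i<ne. imem s 1 i = fst (edges I ! i) \<and> imem s 2 i = snd (edges I ! i))"

text \<open>
  The neighbors of \<open>u\<close> are stored with stride \<open>np\<close> from index \<open>u\<close> on, and array 5 points behind the
  last one.  In this way the programs need no multiplication.
\<close>

definition graph :: "(nat \<Rightarrow> nat \<Rightarrow> nat) \<Rightarrow> (nat \<times> nat) list \<Rightarrow> bool" where
  "graph m es \<longleftrightarrow> (\<forall>u<np. m 5 u = u + np * length (nbrs_of es u) \<and>
    (\<forall>i<length (nbrs_of es u). m 6 (u + np * i) = nbrs_of es u ! i))"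

definition ready :: "state \<Rightarrow> bool" where
  "ready s \<longleftrightarrow> inputs s \<and> graph (imem s) (edges I) \<and> (\<forall>v<np. imem s 7 v = 2 ^ v)"

text \<open>As soon as there is an obstacle, this forces \<open>T\<close> to be nonempty. The empty
  solution has no cones, so the cones of the current solution are established only for
  \<open>S \<noteq> {}\<close>.\<close>

definition cones :: "nat \<Rightarrow> nat \<Rightarrow> (nat \<Rightarrow> nat \<Rightarrow> nat) \<Rightarrow> nat set \<Rightarrow> bool" where
  "cones cl cr m T \<longleftrightarrow> (\<forall>x<nx. m cl x < np \<and> m cr x < np \<and>
    cone_at (X x) (P ` T) (P (m cl x)) (P (m cr x)))"

definition queue :: "(nat \<Rightarrow> nat \<Rightarrow> nat) \<Rightarrow> nat list \<Rightarrow> bool" where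
  "queue m qs \<longleftrightarrow> m 14 0 = length qs \<and> (\<forall>i<length qs. m 13 i = qs ! i)"

lemma inputs_clock [simp]: "inputs (s\<lparr>clock := k\<rparr>) = inputs s"
  and ready_clock [simp]: "ready (s\<lparr>clock := k\<rparr>) = ready s"
  by (simp_all add: inputs_def ready_def)

lemma inputs_frame:
  assumes "frame c s s'" "inputs s" "real_free c" "{0, 1, 2} \<inter> writes c = {}"
  shows "inputs s'"
  using assms by (simp add: frame_def inputs_def)

lemma ready_frame:
  assumes "frame c s s'" "ready s" "real_free c" "{0, 1, 2, 5, 6, 7} \<inter> writes c = {}"
  shows "ready s'"
  using assms by (simp add: frame_def inputs_def ready_def graph_def)

lemma ready_inputs: "ready s \<Longrightarrow> inputs s"
  by (simp add: ready_def)

lemma inputs_np: "inputs s \<Longrightarrow> imem s 0 0 = np"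
  and inputs_nx: "inputs s \<Longrightarrow> imem s 0 (Suc 0) = nx"
  by (simp_all add: inputs_def)

lemma inputs_imem [simp]:
  "a \<notin> {0, 1, 2} \<Longrightarrow> inputs (s\<lparr>imem := upd m a i v\<rparr>) = inputs (s\<lparr>imem := m\<rparr>)"
  "inputs (s\<lparr>imem := imem s\<rparr>) = inputs s"
  by (simp_all add: inputs_def upd_apply)

lemma ready_imem [simp]:
  "a \<notin> {0, 1, 2, 5, 6, 7} \<Longrightarrow> ready (s\<lparr>imem := upd m a i v\<rparr>) = ready (s\<lparr>imem := m\<rparr>)"
  "ready (s\<lparr>imem := imem s\<rparr>) = ready s"
  by (simp_all add: ready_def graph_def upd_apply)

lemma val2_pt: "inputs s \<Longrightarrow> ival e s < np \<Longrightarrow> val2 (pt e) s = P (ival e s)"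
  by (simp add: val2_def pt_def inputs_def load_def hull_problem_def)

lemma val2_ob: "inputs s \<Longrightarrow> ival e s < nx \<Longrightarrow> val2 (ob e) s = X (ival e s)"
  by (simp add: val2_def ob_def inputs_def load_def hull_problem_def eval_nat_numeral)

lemma free_iff: "free T \<longleftrightarrow> (\<forall>x<nx. X x \<notin> convex hull (P ` T))"
  unfolding free_def disjoint_iff by (metis X_of_iff)

lemma wp_START:
  assumes "inputs s" and v: "imem s 22 0 = v" "v < np" "P v \<notin> X_of I"
  shows "wp START (\<lambda>s'. clock s' \<le> clock s + 50 * Suc nx \<and> queue (imem s') [v] \<and>
    cones 11 12 (imem s') {v}) s"
    (is "wp _ ?post _")
  unfolding START_def
proof (rule wp_SeqI)
  show "wp (For 21 H (Seq (IWrite 11 (Var 21) (Var 22)) (IWrite 12 (Var 21) (Var 22))))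
    (\<lambda>s'. clock s' \<le> clock s + (10 + 20) * Suc nx \<and> (\<forall>x<nx. imem s' 11 x = v \<and> imem s' 12 x = v)) s"
    by (rule wp_For'[where I = "\<lambda>k m. \<forall>x<k. m 11 x = v \<and> m 12 x = v" and N = nx])
      (use assms in \<open>auto simp: inputs_def frame_def upd_apply less_Suc_eq\<close>)
next
  fix s' assume *: "clock s' \<le> clock s + (10 + 20) * Suc nx \<and> (\<forall>x<nx. imem s' 11 x = v \<and> imem s' 12 x = v)"
    and "frame (For 21 H (Seq (IWrite 11 (Var 21) (Var 22)) (IWrite 12 (Var 21) (Var 22)))) s s'"
  then have "imem s' 22 0 = v" using v by (simp add: frame_def)
  moreover have "X x \<noteq> P v" if "x < nx" for x using v(3) that by (auto simp: X_of_iff)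
  ultimately show "wp (Seq (IWrite 13 (INum 0) (Var 22)) (IWrite 14 (INum 0) (INum 1)))
    ?post s'"
    using * v by (auto simp: upd_apply queue_def cones_def cone_at_singleton)
qed

lemma cones_T: "cones cl cr m T \<Longrightarrow> free T"
  by (auto simp: cones_def cone_at_def free_iff)

lemma wp_CHECK:
  assumes "inputs s" and T: "cones 11 12 (imem s) T" "finite T" "T \<subseteq> {..<np}"
    and w: "imem s 19 0 = w" "w < np"
  shows "wp CHECK (\<lambda>s'. clock s' \<le> clock s + 300 * Suc nx \<and> (0 < imem s' 20 0 \<longleftrightarrow> free (insert w T))) s"
proof -
  let ?I = "\<lambda>k m. 0 < m 20 0 \<longleftrightarrow> (\<forall>x<k. X x \<notin> convex hull (P ` insert w T))"
  have "wp (For 21 H (Cond (fits_e 11 12 (Var 21) (Var 19)) Skip (IWrite 20 (INum 0) (INum 0))))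
    (\<lambda>s'. clock s' \<le> clock s'' + (200 + 20) * Suc nx \<and> ?I nx (imem s')) s''"
    if s'': "inputs s''" "imem s'' 20 0 = Suc 0" "\<And>a. a \<noteq> 20 \<Longrightarrow> imem s'' a = imem s a" for s''
  proof (rule wp_For'[where I = ?I and N = nx])
    show "?I 0 (upd (imem s'') 21 0 0)" using s'' by (simp add: upd_apply)
  next
    fix k s' assume "?I k (imem s')" "frame (For 21 H (Cond (fits_e 11 12 (Var 21) (Var 19)) Skip (IWrite 20 (INum 0) (INum 0)))) s'' s'"
    then show "ival H s' = nx" using s'' by (simp add: frame_def inputs_def)
  next
    fix k s' assume k: "k < nx" and I: "?I k (imem s')" and x: "imem s' 21 0 = k"
      and fr: "frame (For 21 H (Cond (fits_e 11 12 (Var 21) (Var 19)) Skip (IWrite 20 (INum 0) (INum 0)))) s'' s'"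
    have i: "inputs s'" by (rule inputs_frame[OF fr s''(1)]) simp_all
    have eq: "imem s' 11 = imem s 11" "imem s' 12 = imem s 12" "imem s' 19 = imem s 19"
      using fr s''(3) by (simp_all add: frame_def)
    have c: "imem s 11 k < np" "imem s 12 k < np"
      "cone_at (X k) (P ` T) (P (imem s 11 k)) (P (imem s 12 k))"
      using T(1) k by (auto simp: cones_def)
    have "fits (X k) (P (imem s 11 k)) (P (imem s 12 k)) (P w) \<longleftrightarrow> X k \<notin> convex hull (P ` insert w T)"
      using fits_iff[OF _ c(3), of "P w"] T(2) by simp
    then show "wp (Cond (fits_e 11 12 (Var 21) (Var 19)) Skip (IWrite 20 (INum 0) (INum 0)))
      (\<lambda>s''. clock s'' \<le> clock s' + 200 \<and> ?I (Suc k) (upd (imem s'') 21 0 (Suc k))) s'"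
      using i k x c w I eq
      by (auto simp: val2_pt val2_ob upd_apply less_Suc_eq)
  qed simp_all
  note loop = this
  show ?thesis
    unfolding CHECK_def wp_Seq wp_IWrite
    by (rule wp_conseq[OF loop])
      (use assms(1) in \<open>auto simp: upd_apply free_iff\<close>)
qed

lemma wp_WIDEN:
  assumes s: "inputs s" and c: "cl \<noteq> cr" "{cl, cr} \<inter> {0, 1, 2, 19, 21} = {}"
    and x: "imem s 21 0 = x" "x < nx" and w: "imem s 19 0 = w" "w < np"
    and l: "imem s cl x < np" "imem s cr x < np"
    and T: "finite T" "cone_at (X x) (P ` T) (P (imem s cl x)) (P (imem s cr x))"
      "X x \<notin> convex hull (P ` insert w T)"
  shows "wp (WIDEN cl cr) (\<lambda>s'. clock s' \<le> clock s + 200 \<and>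
    (\<forall>y. y \<noteq> x \<longrightarrow> imem s' cl y = imem s cl y \<and> imem s' cr y = imem s cr y) \<and>
    imem s' cl x < np \<and> imem s' cr x < np \<and>
    cone_at (X x) (P ` insert w T) (P (imem s' cl x)) (P (imem s' cr x))) s"
proof -
  have "cone_at (X x) (P ` insert w T) (if orient (X x) (P (imem s cl x)) (P w) < 0 then P w else P (imem s cl x))
      (if orient (X x) (P w) (P (imem s cr x)) < 0 then P w else P (imem s cr x))"
    using cone_at_insert[OF _ T(2), of "P w"] T(1,3) by simp
  then show ?thesis
    unfolding WIDEN_def using s c x w l by (auto simp: val2_pt val2_ob upd_apply)
qed

lemma wp_TRY:
  assumes "inputs s" and T: "cones 11 12 (imem s) (set qs)" "set qs \<subseteq> {..<np}" "queue (imem s) qs"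
    and w: "imem s 19 0 = w" "w < np"
  shows "wp TRY (\<lambda>s'. clock s' \<le> clock s + 1000 * Suc nx \<and>
    (if free (insert w (set qs)) then queue (imem s') (qs @ [w]) \<and> cones 11 12 (imem s') (insert w (set qs))
     else queue (imem s') qs \<and> cones 11 12 (imem s') (set qs))) s"
  unfolding TRY_def
proof (rule wp_SeqI[OF wp_CHECK[OF assms(1) T(1) _ T(2) w]])
  show "finite (set qs)" by simp
  fix u assume u: "clock u \<le> clock s + 300 * Suc nx \<and> (0 < imem u 20 0 \<longleftrightarrow> free (insert w (set qs)))"
    and fr: "frame CHECK s u"
  have eq: "imem u a = imem s a" if "a \<notin> {20, 21}" for a
    using fr that by (simp add: frame_def)
  have inu: "inputs u" by (rule inputs_frame[OF fr assms(1)]) simp_all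
  let ?T = "set qs" and ?T' = "insert w (set qs)"
  let ?F = "For 21 H (WIDEN 11 12)"
  \<comment> \<open>Obstacles below \<open>k\<close> already carry the cone of the enlarged set, the
    others still that of the old one.\<close>
  let ?I = "\<lambda>k m. \<forall>x<nx. m 11 x < np \<and> m 12 x < np \<and>
    cone_at (X x) (P ` (if x < k then ?T' else ?T)) (P (m 11 x)) (P (m 12 x))"
  have loop: "wp ?F (\<lambda>s'. clock s' \<le> clock t + (200 + 20) * Suc nx \<and> ?I nx (imem s')) t"
    if free: "free ?T'" and t: "inputs t" "imem t 11 = imem s 11" "imem t 12 = imem s 12" "imem t 19 = imem s 19" for t
  proof (rule wp_For'[where I = ?I and N = nx])
    show "?I 0 (upd (imem t) 21 0 0)" using t T(1) by (simp add: upd_apply cones_def)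
  next
    fix k s' assume "?I k (imem s')" and fr: "frame ?F t s'"
    show "ival H s' = nx" using fr t by (simp add: frame_def inputs_def)
  next
    fix k s' assume k: "k < nx" and I: "?I k (imem s')" and x: "imem s' 21 0 = k" and fr: "frame ?F t s'"
    have i: "inputs s'" by (rule inputs_frame[OF fr t(1)]) simp_all
    have w': "imem s' 19 0 = w" using fr t(4) w(1) by (simp add: frame_def)
    have c: "imem s' 11 k < np" "imem s' 12 k < np" "cone_at (X k) (P ` ?T) (P (imem s' 11 k)) (P (imem s' 12 k))"
      using I k by auto
    have "X k \<notin> convex hull (P ` ?T')" using free k by (simp add: free_iff)
    then have "wp (WIDEN 11 12) (\<lambda>s''. clock s'' \<le> clock s' + 200 \<and>
        (\<forall>y. y \<noteq> k \<longrightarrow> imem s'' 11 y = imem s' 11 y \<and> imem s'' 12 y = imem s' 12 y) \<and>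
        imem s'' 11 k < np \<and> imem s'' 12 k < np \<and>
        cone_at (X k) (P ` ?T') (P (imem s'' 11 k)) (P (imem s'' 12 k))) s'"
      using i x k w' w(2) c by (intro wp_WIDEN) auto
    then show "wp (WIDEN 11 12)
        (\<lambda>s''. clock s'' \<le> clock s' + 200 \<and> ?I (Suc k) (upd (imem s'') 21 0 (Suc k))) s'"
    proof (rule wp_conseq, elim conjE, intro conjI allI impI)
      fix s'' x assume *: "imem s'' 11 k < np" "imem s'' 12 k < np"
          "cone_at (X k) (P ` ?T') (P (imem s'' 11 k)) (P (imem s'' 12 k))"
          "\<forall>y. y \<noteq> k \<longrightarrow> imem s'' 11 y = imem s' 11 y \<and> imem s'' 12 y = imem s' 12 y"
        and "x < nx"
      have "(x < Suc k) = (x < k)" if "x \<noteq> k" using that by auto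
      then show "upd (imem s'') 21 0 (Suc k) 11 x < np" "upd (imem s'') 21 0 (Suc k) 12 x < np"
        "cone_at (X x) (P ` (if x < Suc k then ?T' else ?T)) (P (upd (imem s'') 21 0 (Suc k) 11 x))
          (P (upd (imem s'') 21 0 (Suc k) 12 x))"
        using * I[rule_format, OF \<open>x < nx\<close>] by (cases "x = k"; simp add: upd_apply)+
    qed
  qed simp_all
  show "wp (Cond (ILess (INum 0) (Var 20))
      (Seq (IWrite 13 (Var 14) (Var 19)) (Seq (IWrite 14 (INum 0) (IAdd (Var 14) (INum 1))) ?F)) Skip)
    (\<lambda>s'. clock s' \<le> clock s + 1000 * Suc nx \<and>
      (if free ?T' then queue (imem s') (qs @ [w]) \<and> cones 11 12 (imem s') ?T'
       else queue (imem s') qs \<and> cones 11 12 (imem s') ?T)) u"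
  proof (cases "free ?T'")
    case False
    then show ?thesis using u T eq by (auto simp: queue_def cones_def)
  next
    case True
    let ?u = "\<lambda>c. u\<lparr>imem := upd (upd (imem u) 13 (length qs) w) 14 0 (Suc (length qs)), clock := c\<rparr>"
    have "wp ?F (\<lambda>s'. clock s' \<le> clock s + 1000 * Suc nx \<and> queue (imem s') (qs @ [w]) \<and>
        cones 11 12 (imem s') ?T') (?u c)" if c: "c \<le> clock u + 30" for c
    proof (rule wp_frame[OF loop[OF True]])
      show "inputs (?u c)" using inu by (simp add: inputs_def upd_apply)
      show "imem (?u c) 11 = imem s 11" "imem (?u c) 12 = imem s 12" "imem (?u c) 19 = imem s 19"
        by (simp_all add: upd_apply eq)
      fix s' assume *: "clock s' \<le> clock (?u c) + (200 + 20) * Suc nx \<and> ?I nx (imem s')"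
        and fr: "frame ?F (?u c) s'"
      have "imem s' 13 = (imem s 13)(length qs := w)" "imem s' 14 0 = Suc (length qs)"
        using fr eq by (simp_all add: frame_def upd_apply)
      then show "clock s' \<le> clock s + 1000 * Suc nx \<and> queue (imem s') (qs @ [w]) \<and> cones 11 12 (imem s') ?T'"
        using * u c T(3) by (auto simp: queue_def cones_def nth_append less_Suc_eq)
    qed
    moreover have "imem u 14 0 = length qs" "imem u 19 0 = w" using eq T(3) w by (simp_all add: queue_def)
    moreover have "0 < imem u 20 0" using u True by blast
    ultimately show ?thesis using True by (simp add: upd_apply)
  qed
qed


text \<open>
  \<open>A\<close> is the set of vertices that the search may add to the initial set \<open>B\<close>; array 16 marks the
  vertices that have been decided or are excluded.
\<close>

definition search :: "nat set \<Rightarrow> nat set \<Rightarrow> (nat \<Rightarrow> nat \<Rightarrow> nat) \<Rightarrow> nat list \<Rightarrow> bool" where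
  "search A B m qs \<longleftrightarrow> queue m qs \<and> cones 11 12 m (set qs) \<and> distinct qs \<and> set qs \<subseteq> {..<np} \<and>
    induces_connected E (set qs) \<and> B \<subseteq> set qs \<and> set qs \<subseteq> B \<union> A \<and>
    (\<forall>w\<in>A. m 16 w \<noteq> 0 \<longrightarrow> w \<in> set qs \<or> \<not> free (insert w (set qs))) \<and>
    (\<forall>w<np. m 16 w = 0 \<longrightarrow> w \<in> A \<and> w \<notin> set qs)"

definition undecided :: "(nat \<Rightarrow> nat \<Rightarrow> nat) \<Rightarrow> nat" where
  "undecided m = card {w. w < np \<and> m 16 w = 0}"

text \<open>Every vertex is decided at most once; the potential prepays its tests against all obstacles.\<close>

definition potential :: "state \<Rightarrow> nat" where
  "potential s = clock s + 1000 * Suc nx * undecided (imem s)"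

lemma potential_clock [simp]: "potential (s\<lparr>clock := k\<rparr>) = k + 1000 * Suc nx * undecided (imem s)"
  by (simp add: potential_def)

lemma nbrs_lt: "w \<in> set (nbrs u) \<Longrightarrow> w < np \<and> u < np"
  using E_bounds unfolding set_nbrs by blast

lemma search_cong:
  assumes "search A B m qs" "\<And>a. a \<in> {11, 12, 13, 14, 16} \<Longrightarrow> m' a = m a"
  shows "search A B m' qs"
  using assms by (simp add: search_def queue_def cones_def)

lemma undecided_cong: "m' 16 = m 16 \<Longrightarrow> undecided m' = undecided m"
  by (simp add: undecided_def)

lemma wp_INNER:
  assumes s: "ready s" "search A B (imem s) qs" and u: "imem s 17 0 = u" "u \<in> set qs"
    and i: "imem s 18 0 = u + np * i" "i < length (nbrs u)"
  shows "wp INNER (\<lambda>s'. \<exists>zs. search A B (imem s') (qs @ zs) \<and> imem s' 18 0 = u + np * Suc i \<and>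
    imem s' 16 (nbrs u ! i) \<noteq> 0 \<and> (\<forall>w. imem s 16 w \<noteq> 0 \<longrightarrow> imem s' 16 w \<noteq> 0) \<and>
    potential s' \<le> potential s + 50) s"
    (is "wp _ ?post _")
proof -
  let ?w = "nbrs u ! i"
  have w: "?w < np" "u < np" using nbrs_lt i(2) nth_mem by blast+
  have adj: "imem s 6 (u + np * i) = ?w"
    using s(1) w i(2) by (simp add: ready_def graph_def)
  have J: "imem s 0 0 = np" using s(1) by (simp add: ready_def inputs_def)
  have uw: "{u, ?w} \<in> E" using i(2) nth_mem set_nbrs by blast
  show ?thesis
  proof (cases "imem s 16 ?w = 0")
    case False
    have "search A B (upd (upd (imem s) 19 0 ?w) 18 0 (u + np * i + np)) qs"
      by (rule search_cong[OF s(2)]) (auto simp: upd_apply)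
    then show ?thesis
      using False adj i J
      by (auto simp: INNER_def upd_apply potential_def undecided_def add.commute intro!: exI[of _ "[]"])
  next
    case True
    define t where "t c = s\<lparr>imem := upd (upd (upd (imem s) 19 0 ?w) 18 0 (u + np * i + np)) 16 ?w 1,
      clock := c\<rparr>" for c
    have wA: "?w \<in> A" "?w \<notin> set qs" using s(2) True w by (auto simp: search_def)
    \<comment> \<open>Marking the vertex releases \<open>1000 * Suc nx\<close> units of potential,
      exactly the time bound of \<open>wp_TRY\<close>. So the potential grows by a constant only,
      whether or not a test takes place.\<close>
    have und: "undecided (imem s) = Suc (undecided (imem (t c)))" for c
    proof -
      have "{v. v < np \<and> imem s 16 v = 0} = insert ?w {v. v < np \<and> imem (t c) 16 v = 0}"
        using True w by (auto simp: t_def upd_apply)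
      moreover have "?w \<notin> {v. v < np \<and> imem (t c) 16 v = 0}" by (simp add: t_def upd_apply)
      ultimately show ?thesis by (simp add: undecided_def)
    qed
    have "wp TRY ?post (t c)" if c: "c \<le> clock s + 40" for c
    proof (rule wp_frame[OF wp_TRY])
      show "inputs (t c)" using ready_inputs[OF s(1)] by (simp add: t_def)
      show "cones 11 12 (imem (t c)) (set qs)" "set qs \<subseteq> {..<np}" "queue (imem (t c)) qs" "?w < np"
        "imem (t c) 19 0 = ?w"
        using s(2) w by (auto simp: t_def search_def cones_def queue_def upd_apply)
      fix s' assume *: "clock s' \<le> clock (t c) + 1000 * Suc nx \<and>
          (if free (insert ?w (set qs)) then queue (imem s') (qs @ [?w]) \<and> cones 11 12 (imem s') (insert ?w (set qs))
           else queue (imem s') qs \<and> cones 11 12 (imem s') (set qs))"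
        and fr: "frame TRY (t c) s'"
      have eq: "imem s' 16 = (imem s 16)(?w := 1)" "imem s' 18 0 = u + np * i + np"
        using fr by (simp_all add: frame_def t_def upd_apply)
      then have und': "undecided (imem s') = undecided (imem (t c))"
        by (intro undecided_cong) (simp add: t_def upd_apply)
      have ct: "clock (t c) \<le> clock s + 40" using c by (simp add: t_def)
      have pot: "potential s' \<le> potential s + 50"
        using * und[of c] und' ct by (simp add: potential_def algebra_simps)
      have "\<exists>zs. search A B (imem s') (qs @ zs)"
      proof (cases "free (insert ?w (set qs))")
        case True
        have "\<not> free (insert v (insert ?w (set qs)))" if "\<not> free (insert v (set qs))" for v
          using that free_mono[of "insert v (set qs)" "insert v (insert ?w (set qs))"] by blast
        moreover have "induces_connected E (insert ?w (set qs))"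
          using s(2) u(2) uw by (intro induces_connected_insert) (auto simp: search_def)
        ultimately have "search A B (imem s') (qs @ [?w])"
          using * s(2) wA w True unfolding search_def eq by (auto simp: eq)
        then show ?thesis by blast
      next
        case False
        then have "search A B (imem s') (qs @ [])"
          using * s(2) wA w unfolding search_def eq by (auto simp: eq)
        then show ?thesis by blast
      qed
      then show "?post s'" using eq pot by auto
    qed
    then show ?thesis
      using True adj i J by (simp add: INNER_def upd_apply t_def)
  qed
qed

lemma wp_SCAN:
  assumes s: "ready s" "search A B (imem s) qs" and hd: "imem s 15 0 = k" "k < length qs"
  shows "wp SCAN (\<lambda>s'. \<exists>zs. search A B (imem s') (qs @ zs) \<and> imem s' 15 0 = Suc k \<and>
    (\<forall>w\<in>set (nbrs (qs ! k)). imem s' 16 w \<noteq> 0) \<and> (\<forall>w. imem s 16 w \<noteq> 0 \<longrightarrow> imem s' 16 w \<noteq> 0) \<and>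
    potential s' \<le> potential s + 60 + 80 * length (nbrs (qs ! k))) s"
proof -
  define u where "u = qs ! k"
  have u: "u \<in> set qs" using hd by (simp add: u_def)
  then have u: "u \<in> set qs" "u < np" using s(2) by (auto simp: search_def)
  have Q: "imem s 13 k = u" using hd s(2) by (simp add: search_def queue_def u_def)
  let ?n = "length (nbrs u)"
  define t where "t = s\<lparr>imem := upd (upd (upd (imem s) 17 0 u) 15 0 (Suc k)) 18 0 u,
    clock := clock s + (1 + icost (INum 0) + icost (IRead 13 (Var 15)))
      + (1 + icost (INum 0) + icost (IAdd (Var 15) (INum 1))) + (1 + icost (INum 0) + icost (Var 17))\<rparr>"
  let ?I = "\<lambda>s'. frame SCAN t s' \<and> imem s' 17 0 = u \<and> imem s' 15 0 = Suc k \<and>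
    (\<exists>zs i. search A B (imem s') (qs @ zs) \<and> i \<le> ?n \<and> imem s' 18 0 = u + np * i \<and>
    (\<forall>l<i. imem s' 16 (nbrs u ! l) \<noteq> 0) \<and> (\<forall>w. imem s 16 w \<noteq> 0 \<longrightarrow> imem s' 16 w \<noteq> 0) \<and>
    potential s' \<le> potential s + 16 + 70 * i)"
  let ?Q = "\<lambda>s'. \<exists>zs. search A B (imem s') (qs @ zs) \<and> imem s' 15 0 = Suc k \<and>
    (\<forall>w\<in>set (nbrs u). imem s' 16 w \<noteq> 0) \<and> (\<forall>w. imem s 16 w \<noteq> 0 \<longrightarrow> imem s' 16 w \<noteq> 0) \<and>
    potential s' \<le> potential s + 60 + 80 * ?n"
  have rt: "ready t" using s(1) by (simp add: t_def)
  have rs: "ready s'" if "frame SCAN t s'" for s'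
    by (rule ready_frame[OF that rt]) simp_all
  have end_u: "imem s' 5 u = u + np * ?n" if "ready s'" for s'
    using that u(2) by (simp add: ready_def graph_def)
  have "wp (While (ILess (Var 18) (IRead 5 (Var 17))) INNER) ?Q t"
  \<comment> \<open>The position in array 6 advances with stride \<open>np\<close>, so its distance
    to the end of the list decreases; \<open>np\<close> is positive because \<open>u\<close>
    exists.\<close>
  proof (rule wp_While[where I = ?I and \<mu> = "\<lambda>s'. u + np * ?n - imem s' 18 0"])
    have "search A B (imem t) qs" by (rule search_cong[OF s(2)]) (auto simp: t_def upd_apply)
    then show "?I t"
      by (auto simp: frame_def t_def upd_apply potential_def undecided_def intro!: exI[of _ "[]"] exI[of _ 0])
  next
    fix s' assume I: "?I s'" and b: "bval (ILess (Var 18) (IRead 5 (Var 17))) s'"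
    from I obtain zs i where fr: "frame SCAN t s'" and m: "imem s' 17 0 = u" "imem s' 15 0 = Suc k"
      "search A B (imem s') (qs @ zs)" "i \<le> ?n" "imem s' 18 0 = u + np * i"
      "\<forall>l<i. imem s' 16 (nbrs u ! l) \<noteq> 0" "\<forall>w. imem s 16 w \<noteq> 0 \<longrightarrow> imem s' 16 w \<noteq> 0"
      "potential s' \<le> potential s + 16 + 70 * i" by blast
    have "i < ?n" using b m end_u[OF rs[OF fr]] u(2) by simp
    let ?v = "s'\<lparr>clock := clock s' + (1 + bcost (ILess (Var 18) (IRead 5 (Var 17))))\<rparr>"
    have "wp INNER (\<lambda>s''. \<exists>ys. search A B (imem s'') ((qs @ zs) @ ys) \<and> imem s'' 18 0 = u + np * Suc i \<and>
      imem s'' 16 (nbrs u ! i) \<noteq> 0 \<and> (\<forall>w. imem ?v 16 w \<noteq> 0 \<longrightarrow> imem s'' 16 w \<noteq> 0) \<and>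
      potential s'' \<le> potential ?v + 50) ?v"
      by (rule wp_INNER) (use rs[OF fr] m u \<open>i < ?n\<close> in auto)
    then show "wp INNER (\<lambda>s''. ?I s'' \<and> u + np * ?n - imem s'' 18 0 < u + np * ?n - imem s' 18 0) ?v"
    proof (rule wp_frame)
      fix s'' assume "\<exists>ys. search A B (imem s'') ((qs @ zs) @ ys) \<and> imem s'' 18 0 = u + np * Suc i \<and>
        imem s'' 16 (nbrs u ! i) \<noteq> 0 \<and> (\<forall>w. imem ?v 16 w \<noteq> 0 \<longrightarrow> imem s'' 16 w \<noteq> 0) \<and>
        potential s'' \<le> potential ?v + 50" and fr': "frame INNER ?v s''"
      then obtain ys where y: "search A B (imem s'') (qs @ zs @ ys)" "imem s'' 18 0 = u + np * Suc i"
        "imem s'' 16 (nbrs u ! i) \<noteq> 0" "\<forall>w. imem s' 16 w \<noteq> 0 \<longrightarrow> imem s'' 16 w \<noteq> 0"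
        "potential s'' \<le> potential s' + 9 + 50"
        by (auto simp: potential_def)
      have "frame SCAN t s''"
        using fr fr' by (auto simp: frame_def SCAN_def)
      moreover have "imem s'' 17 0 = u" "imem s'' 15 0 = Suc k"
        using fr' m by (simp_all add: frame_def)
      moreover have "\<forall>l<Suc i. imem s'' 16 (nbrs u ! l) \<noteq> 0"
        using m(6) y(3,4) by (auto simp: less_Suc_eq)
      moreover have "potential s'' \<le> potential s + 16 + 70 * Suc i" using y(5) m(8) by simp
      moreover have "\<forall>w. imem s 16 w \<noteq> 0 \<longrightarrow> imem s'' 16 w \<noteq> 0" using y(4) m(7) by blast
      moreover have "u + np * ?n - imem s'' 18 0 < u + np * ?n - imem s' 18 0"
      proof -
        have "np * Suc i \<le> np * ?n" using \<open>i < ?n\<close> by (intro mult_le_mono2) simp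
        moreover have "0 < np" using u(2) by linarith
        then have "np * i < np * Suc i" by simp
        ultimately show ?thesis unfolding m(5) y(2) by linarith
      qed
      ultimately show "?I s'' \<and> u + np * ?n - imem s'' 18 0 < u + np * ?n - imem s' 18 0"
        using y(1,2) \<open>i < ?n\<close> Suc_leI by blast
    qed
  next
    fix s' assume I: "?I s'" and b: "\<not> bval (ILess (Var 18) (IRead 5 (Var 17))) s'"
    from I obtain zs i where fr: "frame SCAN t s'" and m: "imem s' 17 0 = u" "imem s' 15 0 = Suc k"
      "search A B (imem s') (qs @ zs)" "i \<le> ?n" "imem s' 18 0 = u + np * i"
      "\<forall>l<i. imem s' 16 (nbrs u ! l) \<noteq> 0" "\<forall>w. imem s 16 w \<noteq> 0 \<longrightarrow> imem s' 16 w \<noteq> 0"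
      "potential s' \<le> potential s + 16 + 70 * i" by blast
    have "pts I \<noteq> []" using u(2) by auto
    then have "i = ?n" using b m end_u[OF rs[OF fr]] u(2) by simp
    then have "\<forall>w\<in>set (nbrs u). imem s' 16 w \<noteq> 0" using m(6) by (auto simp: in_set_conv_nth)
    then show "?Q (s'\<lparr>clock := clock s' + (1 + bcost (ILess (Var 18) (IRead 5 (Var 17))))\<rparr>)"
      using m \<open>i = ?n\<close> by (auto simp: potential_def)
  qed
  then show ?thesis
    using Q hd(1) by (simp add: SCAN_def upd_apply t_def u_def)
qed

text \<open>The scanned vertices are distinct, so each adjacency list is charged at most
  once.\<close>

lemma sum_nbrs_le:
  assumes "distinct qs" "set qs \<subseteq> {..<np}"
  shows "(\<Sum>i<length qs. a + b * length (nbrs (qs ! i))) \<le> a * np + b * (2 * ne)"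
proof -
  have "(\<Sum>i<length qs. a + b * length (nbrs (qs ! i))) = (\<Sum>u\<in>set qs. a + b * length (nbrs u))"
    using assms(1) by (intro sum.reindex_bij_betw bij_betw_nth) auto
  also have "\<dots> \<le> (\<Sum>u<np. a + b * length (nbrs u))"
    using assms(2) by (intro sum_mono2) auto
  also have "\<dots> = a * np + b * (2 * ne)"
    by (simp add: sum.distrib sum_distrib_left[symmetric] sum_nbrs)
  finally show ?thesis .
qed

text \<open>The initial potential pays for all tests and the adjacency lists pay for the scans,
  together \<open>O(m + j h)\<close>. When the search position reaches the end, every vertex
  adjacent to a member is marked, and a marked vertex of \<open>A\<close> outside the set is one
  whose addition is not obstacle-free.\<close>

lemma wp_GROW:
  assumes s: "ready s" "search A B (imem s) qs"
  shows "wp GROW (\<lambda>s'. clock s' \<le> clock s + 2000 * (ne + Suc np * Suc nx) \<and>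
    (\<exists>qs'. search A B (imem s') qs' \<and>
      (\<forall>w\<in>A - set qs'. \<forall>u\<in>set qs'. {u, w} \<in> E \<longrightarrow> \<not> free (insert w (set qs'))))) s"
    (is "wp _ ?post _")
proof -
  define t where "t = s\<lparr>imem := upd (imem s) 15 0 0,
    clock := clock s + (1 + icost (INum 0) + icost (INum 0))\<rparr>"
  have pt: "potential t = potential s + 3"
    by (simp add: potential_def t_def undecided_def upd_apply)
  let ?c = "\<lambda>qs i. 70 + 80 * length (nbrs (qs ! i))"
  let ?I = "\<lambda>s'. frame GROW t s' \<and> (\<exists>qs k. search A B (imem s') qs \<and> imem s' 15 0 = k \<and> k \<le> length qs \<and>
    (\<forall>i<k. \<forall>w\<in>set (nbrs (qs ! i)). imem s' 16 w \<noteq> 0) \<and>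
    potential s' \<le> potential t + (\<Sum>i<k. ?c qs i))"
  have rt: "ready t" using s(1) by (simp add: t_def)
  have rs: "ready s'" if "frame GROW t s'" for s'
    by (rule ready_frame[OF that rt]) simp_all
  have len: "length q \<le> np" if "search A B m q" for q m
    using that card_mono[of "{..<np}" "set q"] by (auto simp: search_def distinct_card)
  have "wp (While (ILess (Var 15) (Var 14)) SCAN) ?post t"
  proof (rule wp_While[where I = ?I and \<mu> = "\<lambda>s'. np - imem s' 15 0"])
    have "search A B (imem t) qs" by (rule search_cong[OF s(2)]) (auto simp: t_def upd_apply)
    then show "?I t"
      by (auto simp: frame_def t_def upd_apply intro!: exI[of _ qs])
  next
    fix s' assume I: "?I s'" and b: "bval (ILess (Var 15) (Var 14)) s'"
    from I obtain q k where fr: "frame GROW t s'" and m: "search A B (imem s') q" "imem s' 15 0 = k"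
      "k \<le> length q" "\<forall>i<k. \<forall>w\<in>set (nbrs (q ! i)). imem s' 16 w \<noteq> 0"
      "potential s' \<le> potential t + (\<Sum>i<k. ?c q i)" by blast
    have "k < length q" using b m by (simp add: search_def queue_def)
    let ?v = "s'\<lparr>clock := clock s' + (1 + bcost (ILess (Var 15) (Var 14)))\<rparr>"
    have "wp SCAN (\<lambda>s''. \<exists>zs. search A B (imem s'') (q @ zs) \<and> imem s'' 15 0 = Suc k \<and>
      (\<forall>w\<in>set (nbrs (q ! k)). imem s'' 16 w \<noteq> 0) \<and> (\<forall>w. imem ?v 16 w \<noteq> 0 \<longrightarrow> imem s'' 16 w \<noteq> 0) \<and>
      potential s'' \<le> potential ?v + 60 + 80 * length (nbrs (q ! k))) ?v"
      by (rule wp_SCAN) (use rs[OF fr] m \<open>k < length q\<close> in auto)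
    then show "wp SCAN (\<lambda>s''. ?I s'' \<and> np - imem s'' 15 0 < np - imem s' 15 0) ?v"
    proof (rule wp_frame)
      fix s'' assume "\<exists>zs. search A B (imem s'') (q @ zs) \<and> imem s'' 15 0 = Suc k \<and>
        (\<forall>w\<in>set (nbrs (q ! k)). imem s'' 16 w \<noteq> 0) \<and> (\<forall>w. imem ?v 16 w \<noteq> 0 \<longrightarrow> imem s'' 16 w \<noteq> 0) \<and>
        potential s'' \<le> potential ?v + 60 + 80 * length (nbrs (q ! k))" and fr': "frame SCAN ?v s''"
      then obtain zs where z: "search A B (imem s'') (q @ zs)" "imem s'' 15 0 = Suc k"
        "\<forall>w\<in>set (nbrs (q ! k)). imem s'' 16 w \<noteq> 0" "\<forall>w. imem s' 16 w \<noteq> 0 \<longrightarrow> imem s'' 16 w \<noteq> 0"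
        "potential s'' \<le> potential s' + 6 + 60 + 80 * length (nbrs (q ! k))"
        by (auto simp: potential_def)
      have "frame GROW t s''"
        using fr fr' by (auto simp: frame_def GROW_def)
      moreover have "Suc k \<le> length (q @ zs)" using \<open>k < length q\<close> by simp
      moreover have "\<forall>i<Suc k. \<forall>w\<in>set (nbrs ((q @ zs) ! i)). imem s'' 16 w \<noteq> 0"
        using m(4) z(3,4) \<open>k < length q\<close> by (auto simp: less_Suc_eq nth_append)
      moreover have "potential s'' \<le> potential t + (\<Sum>i<Suc k. ?c (q @ zs) i)"
      proof -
        have "(\<Sum>i<k. ?c (q @ zs) i) = (\<Sum>i<k. ?c q i)"
          using \<open>k < length q\<close> by (intro sum.cong) (auto simp: nth_append)
        then show ?thesis using m(5) z(5) \<open>k < length q\<close> by (simp add: nth_append)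
      qed
      moreover have "np - imem s'' 15 0 < np - imem s' 15 0"
        using z(2) m(2) len[OF m(1)] \<open>k < length q\<close> by simp
      ultimately show "?I s'' \<and> np - imem s'' 15 0 < np - imem s' 15 0"
        using z(1,2) by blast
    qed
  next
    fix s' assume I: "?I s'" and b: "\<not> bval (ILess (Var 15) (Var 14)) s'"
    from I obtain q k where fr: "frame GROW t s'" and m: "search A B (imem s') q" "imem s' 15 0 = k"
      "k \<le> length q" "\<forall>i<k. \<forall>w\<in>set (nbrs (q ! i)). imem s' 16 w \<noteq> 0"
      "potential s' \<le> potential t + (\<Sum>i<k. ?c q i)" by blast
    have k: "k = length q" using b m by (simp add: search_def queue_def)
    have "(\<Sum>i<k. ?c q i) \<le> 70 * np + 80 * (2 * ne)"
      unfolding k using m(1) by (intro sum_nbrs_le) (auto simp: search_def)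
    moreover have "undecided (imem s) \<le> np"
      unfolding undecided_def using card_mono[of "{..<np}" "{w. w < np \<and> imem s 16 w = 0}"] by auto
    then have "1000 * Suc nx * undecided (imem s) \<le> 1000 * Suc nx * np" by (rule mult_le_mono2)
    moreover have "clock s' \<le> potential s'" by (simp add: potential_def)
    moreover have "potential s = clock s + 1000 * Suc nx * undecided (imem s)" by (simp add: potential_def)
    ultimately have "clock s' + 6 \<le> clock s + 1000 * Suc nx * np + 9 + 70 * np + 160 * ne"
      using m(5) pt by linarith
    also have "\<dots> \<le> clock s + 2000 * (ne + Suc np * Suc nx)" by (simp add: algebra_simps)
    finally have "clock s' + 6 \<le> clock s + 2000 * (ne + Suc np * Suc nx)" .
    moreover have "\<not> free (insert w (set q))" if w: "w \<in> A - set q" "u \<in> set q" "{u, w} \<in> E" for u w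
    proof -
      obtain i where "i < k" "u = q ! i" using w(2) k by (auto simp: in_set_conv_nth)
      then have "imem s' 16 w \<noteq> 0" using m(4) w(3) set_nbrs by blast
      then show ?thesis using m(1) w(1) by (auto simp: search_def)
    qed
    ultimately show "?post (s'\<lparr>clock := clock s' + (1 + bcost (ILess (Var 15) (Var 14)))\<rparr>)"
      using m(1) by auto
  qed
  then show ?thesis by (simp add: GROW_def t_def)
qed

end

section \<open>The neighbor for a given vertex and wedge\<close>

definition RESET :: com where
  "RESET = For 19 J (IWrite 16 (Var 19) (INum 0))"

definition MARK :: com where
  "MARK = For 19 (Var 14) (IWrite 16 (IRead 13 (Var 19)) (INum 1))"

text \<open>The second growth forgets all marks except those of the members, so that vertices
  outside the wedge become candidates.\<close>

definition FINISH :: com where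
  "FINISH = Seq RESET (Seq MARK GROW)"

text \<open>\<open>above\<close> is the case distinction in \<open>wedge\<close>. The value
  \<open>H\<close> of array 23 means that no obstacle follows; the orientation test then reads
  outside the input, but its conjunction with the index test is false anyway.\<close>

definition conflict :: bexp where
  "conflict =
    (let above = BAnd (ILess (Var 23) H) (BNot (pos (rorient (pt (Var 22)) (ob (Var 21)) (ob (Var 23)))));
         right = pos (rorient (pt (Var 22)) (pt (Var 19)) (ob (Var 21)));
         left = pos (rorient (pt (Var 22)) (ob (Var 21)) (pt (Var 19)))
     in BAnd (BNot (fits_e 9 10 (Var 21) (Var 22)))
       (BAnd (BNot (BAnd above right)) (BNot (BAnd (BNot above) left))))"

text \<open>A zero entry will mark a candidate. The truncated difference from 1 excludes vertices
  outside the current solution, and each obstacle then excludes those it conflicts with.\<close>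

definition MASK :: com where
  "MASK = For 19 J (Seq (IWrite 16 (Var 19) (ISub (INum 1) (IRead 8 (Var 19))))
    (For 21 H (Cond conflict (IWrite 16 (Var 19) (INum 1)) Skip)))"

definition NEIGHBOR :: com where
  "NEIGHBOR = Seq MASK (Seq START (Seq (IWrite 16 (Var 22) (INum 1)) (Seq GROW FINISH)))"

text \<open>The only test on reals is strict comparison, so equality of a coordinate takes two
  negated comparisons.\<close>

definition VALID :: com where
  "VALID = Seq (IWrite 20 (INum 0) (INum 1))
    (For 21 H (Cond (BAnd
        (BAnd (BNot (RLess (RRead 0 (Var 22)) (RRead 2 (Var 21)))) (BNot (RLess (RRead 2 (Var 21)) (RRead 0 (Var 22)))))
        (BAnd (BNot (RLess (RRead 1 (Var 22)) (RRead 3 (Var 21)))) (BNot (RLess (RRead 3 (Var 21)) (RRead 1 (Var 22))))))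
      (IWrite 20 (INum 0) (INum 0)) Skip))"

definition PICK :: com where
  "PICK = For 19 J (Cond (ILess (INum 0) (IRead 8 (Var 19))) (IWrite 29 (INum 0) (Var 19)) Skip)"

text \<open>Every cone starts at one member of the current solution and is widened by all members;
  meeting the start again is harmless. This \<open>O(j h)\<close> step is done once per solution and
  serves all its neighbors.\<close>

definition CONES :: com where
  "CONES = Seq PICK (For 21 H (Seq (IWrite 9 (Var 21) (Var 29)) (Seq (IWrite 10 (Var 21) (Var 29))
    (For 19 J (Cond (ILess (INum 0) (IRead 8 (Var 19))) (WIDEN 9 10) Skip)))))"

lemmas step_defs = RESET_def MARK_def FINISH_def MASK_def NEIGHBOR_def VALID_def
  PICK_def CONES_def

lemma writes_MASK [simp]: "writes MASK = {16, 19, 21}"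
  and writes_RESET [simp]: "writes RESET = {16, 19}"
  and writes_MARK [simp]: "writes MARK = {16, 19}"
  and writes_FINISH [simp]: "writes FINISH = {11, 12, 13, 14, 15, 16, 17, 18, 19, 20, 21}"
  and writes_NEIGHBOR [simp]: "writes NEIGHBOR = {11, 12, 13, 14, 15, 16, 17, 18, 19, 20, 21}"
  and writes_VALID [simp]: "writes VALID = {20, 21}"
  and writes_PICK [simp]: "writes PICK = {19, 29}"
  and writes_CONES [simp]: "writes CONES = {9, 10, 19, 21, 29}"
  by (auto simp: step_defs)

lemma real_free_step [simp]:
  "real_free MASK" "real_free RESET" "real_free MARK" "real_free FINISH" "real_free NEIGHBOR"
  "real_free VALID" "real_free PICK" "real_free CONES"
  by (auto simp: step_defs)

lemma quiet_step [simp]: "quiet FINISH" "quiet NEIGHBOR" "quiet VALID" "quiet CONES"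
  by (auto simp: step_defs)

context hull_inst
begin

definition chars :: "(nat \<Rightarrow> nat \<Rightarrow> nat) \<Rightarrow> nat set \<Rightarrow> bool" where
  "chars m S \<longleftrightarrow> (\<forall>w<np. m 8 w = (if w \<in> S then 1 else 0))"

lemma wp_RESET:
  assumes "ready s"
  shows "wp RESET (\<lambda>s'. clock s' \<le> clock s + (4 + 20) * Suc np \<and> (\<forall>w<np. imem s' 16 w = 0)) s"
  unfolding RESET_def
  by (rule wp_For'[where I = "\<lambda>k m. \<forall>w<k. m 16 w = 0" and N = np])
    (use ready_inputs[OF assms] in \<open>auto simp: frame_def inputs_def upd_apply less_Suc_eq\<close>)

lemma wp_MARK:
  assumes q: "queue (imem s) qs" and 0: "\<forall>w<np. imem s 16 w = 0"
  shows "wp MARK (\<lambda>s'. clock s' \<le> clock s + (6 + 20) * Suc (length qs) \<and>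
    (\<forall>w<np. imem s' 16 w = (if w \<in> set qs then 1 else 0))) s"
  unfolding MARK_def
proof (rule wp_conseq[OF wp_For'[where
      I = "\<lambda>k m. \<forall>w<np. m 16 w = (if w \<in> set (take k qs) then 1 else 0)" and N = "length qs" and t = 6]])
  fix k s' assume k: "k < length qs" "\<forall>w<np. imem s' 16 w = (if w \<in> set (take k qs) then 1 else 0)"
    "imem s' 19 0 = k" "frame (For 19 (Var 14) (IWrite 16 (IRead 13 (Var 19)) (INum 1))) s s'"
  then have "imem s' 13 k = qs ! k" using q by (simp add: frame_def queue_def)
  then show "wp (IWrite 16 (IRead 13 (Var 19)) (INum 1)) (\<lambda>s''. clock s'' \<le> clock s' + 6 \<and>
      (\<forall>w<np. upd (imem s'') 19 0 (Suc k) 16 w = (if w \<in> set (take (Suc k) qs) then 1 else 0))) s'"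
    using k by (auto simp: upd_apply take_Suc_conv_app_nth)
qed (use q 0 in \<open>auto simp: frame_def queue_def upd_apply\<close>)

lemma wp_FINISH:
  assumes s: "ready s" and q: "queue (imem s) qs" "cones 11 12 (imem s) (set qs)" "distinct qs"
    "set qs \<subseteq> {..<np}" "qs \<noteq> []" "induces_connected E (set qs)"
  shows "wp FINISH (\<lambda>s'. clock s' \<le> clock s + 2100 * (ne + Suc np * Suc nx) \<and>
    (\<exists>qs'. queue (imem s') qs' \<and> distinct qs' \<and> sol (set qs') \<and> set qs \<subseteq> set qs')) s"
    (is "wp _ ?post _")
  unfolding FINISH_def
proof (rule wp_SeqI[OF wp_RESET[OF s]])
  fix t assume t: "clock t \<le> clock s + (4 + 20) * Suc np \<and> (\<forall>w<np. imem t 16 w = 0)"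
    and fr: "frame RESET s t"
  have rt: "ready t" by (rule ready_frame[OF fr s]) simp_all
  have qt: "queue (imem t) qs" using q(1) fr by (simp add: frame_def queue_def)
  show "wp (Seq MARK GROW) ?post t"
  proof (rule wp_SeqI[OF wp_MARK[OF qt]])
    show "\<forall>w<np. imem t 16 w = 0" using t by blast
    fix u assume u: "clock u \<le> clock t + (6 + 20) * Suc (length qs) \<and>
        (\<forall>w<np. imem u 16 w = (if w \<in> set qs then 1 else 0))" and fru: "frame MARK t u"
    have ru: "ready u" by (rule ready_frame[OF fru rt]) simp_all
    let ?A = "{..<np} - set qs"
    have sr: "search ?A (set qs) (imem u) qs"
      using q fr fru u
      by (auto simp: search_def frame_def queue_def cones_def)
    have len: "length qs \<le> np"
      using q(3,4) card_mono[of "{..<np}" "set qs"] by (simp add: distinct_card)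
    show "wp GROW ?post u"
    proof (rule wp_conseq[OF wp_GROW[OF ru sr]], elim conjE exE, intro conjI)
      fix s' qs' assume c: "clock s' \<le> clock u + 2000 * (ne + Suc np * Suc nx)"
        and sr': "search ?A (set qs) (imem s') qs'"
        and max: "\<forall>w\<in>?A - set qs'. \<forall>v\<in>set qs'. {v, w} \<in> E \<longrightarrow> \<not> free (insert w (set qs'))"
      show "clock s' \<le> clock s + 2100 * (ne + Suc np * Suc nx)"
        using c u t len by (simp add: algebra_simps)
      have sub: "set qs \<subseteq> set qs'" using sr' by (simp add: search_def)
      have "sol (set qs')"
        by (rule solI) (use sr' max sub q(5) cones_T in \<open>auto simp: search_def\<close>)
      then show "\<exists>qs'. queue (imem s') qs' \<and> distinct qs' \<and> sol (set qs') \<and> set qs \<subseteq> set qs'"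
        using sr' sub by (auto simp: search_def)
    qed
  qed
qed

text \<open>The stored cone of \<open>S\<close> decides in constant time whether adding
  \<open>v\<close> would cover the obstacle.\<close>

lemma bad_iff:
  assumes "x < nx" "cones 9 10 m S" "finite S"
  shows "X x \<in> bad S v \<longleftrightarrow> \<not> fits (X x) (P (m 9 x)) (P (m 10 x)) (P v)"
proof -
  have c: "cone_at (X x) (P ` S) (P (m 9 x)) (P (m 10 x))" using assms by (simp add: cones_def)
  have "X x \<in> X_of I" using assms(1) by (simp add: X_of_def)
  then show ?thesis using fits_iff[OF _ c, of "P v"] assms(3) by (simp add: bad_def)
qed

definition passes :: "nat set \<Rightarrow> nat \<Rightarrow> nat \<Rightarrow> nat \<Rightarrow> nat \<Rightarrow> bool" where
  "passes S v y w x \<longleftrightarrow> (X x \<in> bad S v \<longrightarrow>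
    (if y < nx \<and> orient (P v) (X x) (X y) \<le> 0 then 0 < orient (P v) (P w) (X x)
     else 0 < orient (P v) (X x) (P w)))"

lemma mask_iff: "w \<in> mask S v y \<longleftrightarrow> w \<in> S \<and> (\<forall>x<nx. passes S v y w x)"
proof -
  have "\<exists>x<nx. z = X x" if "z \<in> bad S v" for z
    using that X_of_iff[of z] by (simp add: bad_def)
  then have "(\<forall>z\<in>bad S v. G z) \<longleftrightarrow> (\<forall>x<nx. X x \<in> bad S v \<longrightarrow> G (X x))" for G by metis
  then have "P w \<in> wedge (P v) (bad S v) y' \<longleftrightarrow> (\<forall>x<nx. X x \<in> bad S v \<longrightarrow>
      (if (case y' of None \<Rightarrow> False | Some z \<Rightarrow> orient (P v) (X x) z \<le> 0)
       then 0 < orient (P v) (P w) (X x) else 0 < orient (P v) (X x) (P w)))" for y'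
    unfolding wedge_def mem_Collect_eq .
  then show ?thesis by (auto simp: mask_def passes_def)
qed

lemma bval_conflict:
  assumes s: "inputs s" and x: "imem s 21 0 < nx" and w: "imem s 19 0 < np" and v: "imem s 22 0 < np"
    and S: "cones 9 10 (imem s) S" "finite S"
  shows "bval conflict s \<longleftrightarrow> \<not> passes S (imem s 22 0) (imem s 23 0) (imem s 19 0) (imem s 21 0)"
proof -
  let ?x = "imem s 21 0"
  have l: "imem s 9 ?x < np" "imem s 10 ?x < np" using S(1) x by (auto simp: cones_def)
  show ?thesis
    using assms l bad_iff[OF x S, of "imem s 22 0"]
    by (cases "imem s 23 0 < nx") (auto simp: conflict_def Let_def val2_pt val2_ob passes_def inputs_nx not_less)
qed

lemma cost_conflict: "bcost conflict \<le> 500"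
  by (simp add: conflict_def Let_def)

lemma wp_MASK:
  assumes s: "ready s" and S: "chars (imem s) S" "cones 9 10 (imem s) S" "S \<subseteq> {..<np}"
    and v: "imem s 22 0 = v" "v < np" and y: "imem s 23 0 = y"
  shows "wp MASK (\<lambda>s'. clock s' \<le> clock s + 700 * (Suc np * Suc nx) \<and>
    (\<forall>w<np. imem s' 16 w = 0 \<longleftrightarrow> w \<in> mask S v y)) s"
proof -
  let ?L = "For 21 H (Cond conflict (IWrite 16 (Var 19) (INum 1)) Skip)"
  let ?B = "Seq (IWrite 16 (Var 19) (ISub (INum 1) (IRead 8 (Var 19)))) ?L"
  have inner: "wp ?L (\<lambda>s''. clock s'' \<le> clock t + (510 + 20) * Suc nx \<and>
      ((imem s'' 16 w = 0 \<longleftrightarrow> w \<in> mask S v y) \<and> (\<forall>i. i \<noteq> w \<longrightarrow> imem s'' 16 i = imem t 16 i))) t"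
    if t: "inputs t" "imem t 19 0 = w" "w < np" "imem t 22 0 = v" "imem t 23 0 = y"
      "cones 9 10 (imem t) S" "imem t 16 w = 0 \<longleftrightarrow> w \<in> S" for t w
    unfolding mask_iff
  proof (rule wp_conseq[OF wp_For'[where I = "\<lambda>k m. (m 16 w = 0 \<longleftrightarrow> w \<in> S \<and> (\<forall>x<k. passes S v y w x)) \<and>
        (\<forall>i. i \<noteq> w \<longrightarrow> m 16 i = imem t 16 i)" and N = nx and t = 510]])
    fix k s' assume k: "k < nx" and I: "(imem s' 16 w = 0 \<longleftrightarrow> w \<in> S \<and> (\<forall>x<k. passes S v y w x)) \<and>
        (\<forall>i. i \<noteq> w \<longrightarrow> imem s' 16 i = imem t 16 i)" and x: "imem s' 21 0 = k" and fr: "frame ?L t s'"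
    have i: "inputs s'" by (rule inputs_frame[OF fr t(1)]) auto
    have eq: "imem s' 19 0 = w" "imem s' 22 0 = v" "imem s' 23 0 = y" "cones 9 10 (imem s') S"
      using fr t by (simp_all add: frame_def cones_def)
    have "finite S" using S(3) finite_subset by blast
    then have b: "bval conflict s' \<longleftrightarrow> \<not> passes S v y w k"
      using bval_conflict[OF i] k x t(3) v(2) eq by simp
    show "wp (Cond conflict (IWrite 16 (Var 19) (INum 1)) Skip) (\<lambda>s''. clock s'' \<le> clock s' + 510 \<and>
      (upd (imem s'') 21 0 (Suc k) 16 w = 0 \<longleftrightarrow> w \<in> S \<and> (\<forall>x<Suc k. passes S v y w x)) \<and>
        (\<forall>i. i \<noteq> w \<longrightarrow> upd (imem s'') 21 0 (Suc k) 16 i = imem t 16 i)) s'"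
      using I b cost_conflict eq(1) by (auto simp: upd_apply less_Suc_eq)
  qed (use t in \<open>auto simp: frame_def upd_apply inputs_def\<close>)
  have "wp MASK (\<lambda>s'. clock s' \<le> clock s + ((530 * Suc nx + 20) + 20) * Suc np \<and>
      (\<forall>w<np. imem s' 16 w = 0 \<longleftrightarrow> w \<in> mask S v y)) s"
    unfolding MASK_def
  proof (rule wp_For'[where I = "\<lambda>k m. \<forall>w<k. m 16 w = 0 \<longleftrightarrow> w \<in> mask S v y" and N = np])
    fix k s' assume k: "k < np" and I: "\<forall>w<k. imem s' 16 w = 0 \<longleftrightarrow> w \<in> mask S v y" and w: "imem s' 19 0 = k"
      and fr: "frame (For 19 J ?B) s s'"
    have i: "inputs s'" by (rule inputs_frame[OF fr ready_inputs[OF s]]) auto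
    have eq: "imem s' 22 0 = v" "imem s' 23 0 = y" "cones 9 10 (imem s') S" "imem s' 8 k = (if k \<in> S then 1 else 0)"
      using fr v y S k by (simp_all add: frame_def cones_def chars_def)
    let ?u = "\<lambda>c. s'\<lparr>imem := upd (imem s') 16 k (1 - imem s' 8 k), clock := c\<rparr>"
    have "wp ?L (\<lambda>s''. clock s'' \<le> clock s' + (530 * Suc nx + 20) \<and>
        (\<forall>w<Suc k. upd (imem s'') 19 0 (Suc k) 16 w = 0 \<longleftrightarrow> w \<in> mask S v y)) (?u c)" if c: "c \<le> clock s' + 20" for c
    proof (rule wp_conseq[OF inner])
      show "inputs (?u c)" using i by simp
      show "imem (?u c) 19 0 = k" using w by (simp add: upd_apply)
      fix s'' assume "clock s'' \<le> clock (?u c) + (510 + 20) * Suc nx \<and>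
        ((imem s'' 16 k = 0 \<longleftrightarrow> k \<in> mask S v y) \<and> (\<forall>i. i \<noteq> k \<longrightarrow> imem s'' 16 i = imem (?u c) 16 i))"
      then show "clock s'' \<le> clock s' + (530 * Suc nx + 20) \<and>
        (\<forall>w<Suc k. upd (imem s'') 19 0 (Suc k) 16 w = 0 \<longleftrightarrow> w \<in> mask S v y)"
        using c I by (auto simp: upd_apply less_Suc_eq)
    qed (use k eq in \<open>auto simp: upd_apply cones_def\<close>)
    then show "wp ?B (\<lambda>s''. clock s'' \<le> clock s' + (530 * Suc nx + 20) \<and>
        (\<forall>w<Suc k. upd (imem s'') 19 0 (Suc k) 16 w = 0 \<longleftrightarrow> w \<in> mask S v y)) s'"
      using w by simp
  qed (use ready_inputs[OF s] in \<open>auto simp: frame_def inputs_def\<close>)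
  then show ?thesis by (rule wp_conseq) (auto simp: algebra_simps)
qed

lemma wp_NEIGHBOR:
  assumes s: "ready s" and S: "chars (imem s) S" "cones 9 10 (imem s) S" "S \<subseteq> {..<np}"
    and v: "imem s 22 0 = v" "v < np" "P v \<notin> X_of I" and y: "imem s 23 0 = y"
  shows "wp NEIGHBOR (\<lambda>s'. clock s' \<le> clock s + 6000 * (ne + Suc np * Suc nx) \<and>
    (\<exists>qs. queue (imem s') qs \<and> distinct qs \<and> neighbor S v y (set qs))) s"
    (is "wp _ ?Q s")
  unfolding NEIGHBOR_def
proof (rule wp_SeqI[OF wp_MASK[OF s S v(1,2) y]])
  let ?U = "ne + Suc np * Suc nx"
  fix t assume t: "clock t \<le> clock s + 700 * (Suc np * Suc nx) \<and>
    (\<forall>w<np. imem t 16 w = 0 \<longleftrightarrow> w \<in> mask S v y)" and fr: "frame MASK s t"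
  have rt: "ready t" by (rule ready_frame[OF fr s]) simp_all
  have vt: "imem t 22 0 = v" using fr v by (simp add: frame_def)
  show "wp (Seq START (Seq (IWrite 16 (Var 22) (INum 1)) (Seq GROW FINISH))) ?Q t"
  proof (rule wp_SeqI[OF wp_START[OF ready_inputs[OF rt] vt v(2,3)]])
    fix u assume u: "clock u \<le> clock t + 50 * Suc nx \<and> queue (imem u) [v] \<and> cones 11 12 (imem u) {v}"
      and fru: "frame START t u"
    have ru: "ready u" by (rule ready_frame[OF fru rt]) simp_all
    have vu: "imem u 22 0 = v" "imem u 16 = imem t 16" using fru vt by (simp_all add: frame_def)
    let ?r = "\<lambda>c. u\<lparr>imem := upd (imem u) 16 v 1, clock := c\<rparr>"
    \<comment> \<open>\<open>v\<close> is the initial element and already marked, hence not among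
      the vertices that may still be added.\<close>
    let ?A = "mask S v y - {v}"
    have "mask S v y \<subseteq> S" by (auto simp: mask_def)
    then have mask_np: "w < np" if "w \<in> mask S v y" for w using that S(3) by blast
    have "wp (Seq GROW FINISH) ?Q (?r c)" if c: "c \<le> clock u + 10" for c
    proof -
      have rr: "ready (?r c)" using ru by simp
      have sr: "search ?A {v} (imem (?r c)) [v]"
        using u t v vu mask_np by (auto simp: search_def upd_apply queue_def cones_def)
      show ?thesis
      proof (rule wp_SeqI[OF wp_GROW[OF rr sr]], elim conjE exE)
        fix p qs assume cp: "clock p \<le> clock (?r c) + 2000 * ?U" and frp: "frame GROW (?r c) p"
          and q: "search ?A {v} (imem p) qs"
          and max: "\<forall>w\<in>?A - set qs. \<forall>u\<in>set qs. {u, w} \<in> E \<longrightarrow> \<not> free (insert w (set qs))"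
        have rp: "ready p" by (rule ready_frame[OF frp rr]) simp_all
        have vq: "v \<in> set qs" "set qs \<subseteq> insert v (mask S v y)" using q by (auto simp: search_def)
        \<comment> \<open>If the first growth missed a point of \<open>C\<close>, connectivity would
          yield an edge from the grown set to a missed point \<open>w\<close> of the mask. By
          \<open>mask_free\<close> the point \<open>w\<close> could be added, against the outcome of
          the growth.\<close>
        have closed: "C \<subseteq> set qs" if C: "C \<subseteq> mask S v y" "induces_connected E (insert v C)" for C
        proof (rule ccontr)
          assume "\<not> C \<subseteq> set qs"
          then have "insert v C \<inter> set qs \<subset> insert v C" by blast
          then obtain a w where a: "a \<in> insert v C \<inter> set qs" "w \<in> insert v C - (insert v C \<inter> set qs)" "{a, w} \<in> E"
            by (rule induces_connected_crossing[OF C(2)]) (use vq(1) in auto)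
          have "insert w (set qs) = insert v (insert w (set qs) - {v})" using vq(1) by blast
          moreover have "insert w (set qs) - {v} \<subseteq> mask S v y" using a(2) C(1) vq by blast
          ultimately have "free (insert w (set qs))" using mask_free[OF v(3)] by metis
          then show False using max a vq(1) C(1) by blast
        qed
        have "wp FINISH (\<lambda>s'. clock s' \<le> clock p + 2100 * ?U \<and>
          (\<exists>qs'. queue (imem s') qs' \<and> distinct qs' \<and> sol (set qs') \<and> set qs \<subseteq> set qs')) p"
          by (rule wp_FINISH[OF rp]) (use q vq(1) in \<open>auto simp: search_def\<close>)
        then show "wp FINISH ?Q p"
        proof (rule wp_conseq, elim conjE exE, intro conjI)
          fix s' qs' assume c': "clock s' \<le> clock p + 2100 * ?U" and q': "queue (imem s') qs'" "distinct qs'"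
            "sol (set qs')" "set qs \<subseteq> set qs'"
          show "clock s' \<le> clock s + 6000 * ?U"
            using c' cp c u t by (simp add: algebra_simps)
          have "neighbor S v y (set qs')" unfolding neighbor_def using closed q' vq(1) by blast
          then show "\<exists>qs. queue (imem s') qs \<and> distinct qs \<and> neighbor S v y (set qs)" using q' by blast
        qed
      qed
    qed
    then show "wp (Seq (IWrite 16 (Var 22) (INum 1)) (Seq GROW FINISH)) ?Q u"
      using vu(1) by simp
  qed
qed

lemma wp_VALID:
  assumes s: "inputs s" and v: "imem s 22 0 = v" "v < np"
  shows "wp VALID (\<lambda>s'. clock s' \<le> clock s + 100 * Suc nx \<and> (0 < imem s' 20 0 \<longleftrightarrow> P v \<notin> X_of I)) s"
proof -
  let ?I = "\<lambda>k m. 0 < m 20 0 \<longleftrightarrow> (\<forall>x<k. P v \<noteq> X x)"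
  let ?b = "BAnd
        (BAnd (BNot (RLess (RRead 0 (Var 22)) (RRead 2 (Var 21)))) (BNot (RLess (RRead 2 (Var 21)) (RRead 0 (Var 22)))))
        (BAnd (BNot (RLess (RRead 1 (Var 22)) (RRead 3 (Var 21)))) (BNot (RLess (RRead 3 (Var 21)) (RRead 1 (Var 22)))))"
  let ?F = "For 21 H (Cond ?b (IWrite 20 (INum 0) (INum 0)) Skip)"
  have loop: "wp ?F (\<lambda>s'. clock s' \<le> clock t + (50 + 20) * Suc nx \<and> ?I nx (imem s')) t"
    if t: "inputs t" "imem t 20 0 = Suc 0" "imem t 22 0 = v" for t
  proof (rule wp_For'[where I = ?I and N = nx])
    fix k s' assume k: "k < nx" and I: "?I k (imem s')" and x: "imem s' 21 0 = k" and fr: "frame ?F t s'"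
    have i: "inputs s'" by (rule inputs_frame[OF fr t(1)]) auto
    have v': "imem s' 22 0 = v" using fr t by (simp add: frame_def)
    have r: "rmem s' 0 v = fst (P v)" "rmem s' 1 v = snd (P v)" "rmem s' 2 k = fst (X k)" "rmem s' 3 k = snd (X k)"
      using val2_pt[OF i, of "INum v"] val2_ob[OF i, of "INum k"] v(2) k
      by (simp_all add: val2_def pt_def ob_def prod_eq_iff)
    have "bval ?b s' \<longleftrightarrow> P v = X k"
      using v' x r by (auto simp: prod_eq_iff)
    then show "wp (Cond ?b (IWrite 20 (INum 0) (INum 0)) Skip) (\<lambda>s''. clock s'' \<le> clock s' + 50 \<and>
        ?I (Suc k) (upd (imem s'') 21 0 (Suc k))) s'"
      using I by (auto simp: upd_apply less_Suc_eq)
  qed (use t in \<open>auto simp: upd_apply frame_def inputs_def\<close>)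
  show ?thesis
    unfolding VALID_def wp_Seq wp_IWrite
    by (rule wp_conseq[OF loop]) (use s v in \<open>auto simp: upd_apply X_of_iff\<close>)
qed

end

section \<open>Setup and enumeration of all neighbors\<close>

definition ENDS :: com where
  "ENDS = For 30 J (IWrite 5 (Var 30) (Var 30))"

text \<open>Array 5 holds the next free index for each vertex; advancing it by \<open>J\<close>
  keeps the stride.\<close>

definition ARC :: "nat \<Rightarrow> nat \<Rightarrow> com" where
  "ARC a b = Seq (IWrite 6 (IRead 5 (IRead a (Var 30))) (IRead b (Var 30)))
    (IWrite 5 (IRead a (Var 30)) (IAdd (IRead 5 (IRead a (Var 30))) J))"

text \<open>Doubling by addition, as there is no multiplication on integers.\<close>

definition POWERS :: com where
  "POWERS = Seq (IWrite 7 (INum 0) (INum 1))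
    (For 30 J (IWrite 7 (IAdd (Var 30) (INum 1)) (IAdd (IRead 7 (Var 30)) (IRead 7 (Var 30)))))"

definition SETUP :: com where
  "SETUP = Seq ENDS (Seq (For 30 M (Seq (ARC 1 2) (ARC 2 1))) POWERS)"

text \<open>Only the first vertex off all obstacles is grown, because afterwards array 14 is
  positive. If there is no such vertex, the set stays empty, and the empty set is the
  solution.\<close>

definition FINDONE :: com where
  "FINDONE = Seq (IWrite 14 (INum 0) (INum 0)) (For 22 J (Seq VALID
    (Cond (BAnd (ILess (INum 0) (Var 20)) (ILess (Var 14) (INum 1))) (Seq START FINISH) Skip)))"

definition EMITQ :: com where
  "EMITQ = Seq (For 19 (Var 14) (Emit (IRead 13 (Var 19)))) Flush"

text \<open>The bound \<open>H + 1\<close> includes index \<open>H\<close>, the wedge without a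
  following obstacle. \<open>c\<close> consumes a neighbor: the listing enqueues it, the neighbor
  program outputs it.\<close>

definition ALLNB :: "com \<Rightarrow> com" where
  "ALLNB c = For 22 J (Seq VALID (Cond (ILess (INum 0) (Var 20))
    (For 23 (IAdd H (INum 1)) (Seq NEIGHBOR c)) Skip))"

lemma writes_SETUP [simp]: "writes SETUP = {5, 6, 7, 30}"
  and writes_ENDS [simp]: "writes ENDS = {5, 30}"
  and writes_ARC [simp]: "writes (ARC a b) = {5, 6}"
  and writes_FINDONE [simp]: "writes FINDONE = {11, 12, 13, 14, 15, 16, 17, 18, 19, 20, 21, 22}"
  and writes_EMITQ [simp]: "writes EMITQ = {19}"
  and writes_ALLNB [simp]:
    "writes (ALLNB c) = {11, 12, 13, 14, 15, 16, 17, 18, 19, 20, 21, 22, 23} \<union> writes c"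
  by (auto simp: SETUP_def ENDS_def ARC_def POWERS_def FINDONE_def EMITQ_def ALLNB_def)

lemma real_free_phase [simp]:
  "real_free SETUP" "real_free ENDS" "real_free (ARC a b)" "real_free FINDONE" "real_free EMITQ"
  "real_free (ALLNB c) = real_free c"
  by (auto simp: SETUP_def ENDS_def ARC_def POWERS_def FINDONE_def EMITQ_def ALLNB_def)

lemma quiet_phase [simp]: "quiet SETUP" "quiet FINDONE" "quiet (ALLNB c) = quiet c"
  by (auto simp: SETUP_def ENDS_def ARC_def POWERS_def FINDONE_def ALLNB_def)

context hull_inst
begin

lemma wp_PICK:
  assumes s: "inputs s" and S: "chars (imem s) S" "S \<subseteq> {..<np}"
  shows "wp PICK (\<lambda>s'. clock s' \<le> clock s + (20 + 20) * Suc np \<and>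
    (S \<inter> {..<np} \<noteq> {} \<longrightarrow> imem s' 29 0 \<in> S)) s"
  unfolding PICK_def
  by (rule wp_For'[where I = "\<lambda>k m. S \<inter> {..<k} \<noteq> {} \<longrightarrow> m 29 0 \<in> S" and N = np])
    (use assms in \<open>auto simp: frame_def inputs_def chars_def upd_apply less_Suc_eq lessThan_Suc split: if_splits\<close>)

lemma wp_CONES:
  assumes s: "ready s" and S: "chars (imem s) S" "S \<subseteq> {..<np}" "free S"
  shows "wp CONES (\<lambda>s'. clock s' \<le> clock s + 400 * (Suc np * Suc nx) \<and>
    (S \<noteq> {} \<longrightarrow> cones 9 10 (imem s') S)) s"
    (is "wp _ ?post _")
  unfolding CONES_def
proof (rule wp_SeqI[OF wp_PICK[OF ready_inputs[OF s] S(1,2)]])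
  let ?W = "Cond (ILess (INum 0) (IRead 8 (Var 19))) (WIDEN 9 10) Skip"
  let ?L = "For 19 J ?W"
  let ?B = "Seq (IWrite 9 (Var 21) (Var 29)) (Seq (IWrite 10 (Var 21) (Var 29)) ?L)"
  fix t assume t: "clock t \<le> clock s + (20 + 20) * Suc np \<and> (S \<inter> {..<np} \<noteq> {} \<longrightarrow> imem t 29 0 \<in> S)"
    and fr: "frame PICK s t"
  have it: "inputs t"
    by (rule inputs_frame[OF fr ready_inputs[OF s]]) simp_all
  have St: "chars (imem t) S" using S(1) fr by (simp add: frame_def chars_def)
  have finS: "finite S" using S(2) finite_subset by blast
  define p where "p = imem t 29 0"
  have p: "p \<in> S" if "S \<noteq> {}" using t that S(2) by (auto simp: p_def)
  let ?g = "\<lambda>m x. m 9 x < np \<and> m 10 x < np \<and> cone_at (X x) (P ` S) (P (m 9 x)) (P (m 10 x))"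
  have hull: "X x \<notin> convex hull (P ` T)" if "x < nx" "T \<subseteq> S" for x T
    using free_mono[OF that(2) S(3)] that(1) by (simp add: free_iff)
  have inner: "wp ?L (\<lambda>u. clock u \<le> clock v + (210 + 20) * Suc np \<and>
      ((\<forall>y. y \<noteq> x \<longrightarrow> imem u 9 y = imem v 9 y \<and> imem u 10 y = imem v 10 y) \<and> (S \<noteq> {} \<longrightarrow> ?g (imem u) x))) v"
    if v: "inputs v" "imem v 8 = imem t 8" "imem v 21 0 = x" "x < nx" "imem v 9 x = p" "imem v 10 x = p" for v x
  proof (rule wp_conseq[OF wp_For'[where I = "\<lambda>k m. (\<forall>y. y \<noteq> x \<longrightarrow> m 9 y = imem v 9 y \<and> m 10 y = imem v 10 y) \<and>
      (S \<noteq> {} \<longrightarrow> m 9 x < np \<and> m 10 x < np \<and>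
        cone_at (X x) (P ` insert p (S \<inter> {..<k})) (P (m 9 x)) (P (m 10 x)))" and N = np and t = 210]])
    show "(\<forall>y. y \<noteq> x \<longrightarrow> upd (imem v) 19 0 0 9 y = imem v 9 y \<and> upd (imem v) 19 0 0 10 y = imem v 10 y) \<and>
      (S \<noteq> {} \<longrightarrow> upd (imem v) 19 0 0 9 x < np \<and> upd (imem v) 19 0 0 10 x < np \<and>
        cone_at (X x) (P ` insert p (S \<inter> {..<0})) (P (upd (imem v) 19 0 0 9 x)) (P (upd (imem v) 19 0 0 10 x)))"
      using v p S(2) hull[OF v(4), of "{p}"] by (auto simp: upd_apply cone_at_singleton)
  next
    fix k u assume k: "k < np" and w: "imem u 19 0 = k" and fr: "frame ?L v u"
      and I: "(\<forall>y. y \<noteq> x \<longrightarrow> imem u 9 y = imem v 9 y \<and> imem u 10 y = imem v 10 y) \<and>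
      (S \<noteq> {} \<longrightarrow> imem u 9 x < np \<and> imem u 10 x < np \<and>
        cone_at (X x) (P ` insert p (S \<inter> {..<k})) (P (imem u 9 x)) (P (imem u 10 x)))"
    have iu: "inputs u" by (rule inputs_frame[OF fr v(1)]) simp_all
    have eq: "imem u 8 k = (if k \<in> S then 1 else 0)" "imem u 21 0 = x"
      using fr v k St by (simp_all add: frame_def chars_def)
    let ?Q = "\<lambda>u'. clock u' \<le> clock u + 210 \<and>
      (\<forall>y. y \<noteq> x \<longrightarrow> upd (imem u') 19 0 (Suc k) 9 y = imem v 9 y \<and> upd (imem u') 19 0 (Suc k) 10 y = imem v 10 y) \<and>
      (S \<noteq> {} \<longrightarrow> upd (imem u') 19 0 (Suc k) 9 x < np \<and> upd (imem u') 19 0 (Suc k) 10 x < np \<and>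
        cone_at (X x) (P ` insert p (S \<inter> {..<Suc k}))
          (P (upd (imem u') 19 0 (Suc k) 9 x)) (P (upd (imem u') 19 0 (Suc k) 10 x)))"
    show "wp ?W ?Q u"
    proof (cases "k \<in> S")
      case False
      then show ?thesis using eq I w by (simp add: upd_apply lessThan_Suc)
    next
      case True
      then have ne: "S \<noteq> {}" by blast
      have eqS: "insert k (insert p (S \<inter> {..<k})) = insert p (S \<inter> {..<Suc k})"
        using True by (auto simp: lessThan_Suc)
      have "wp (WIDEN 9 10) ?Q (u\<lparr>clock := c\<rparr>)" if c: "c \<le> clock u + 10" for c
      proof (rule wp_conseq[OF wp_WIDEN])
        show "inputs (u\<lparr>clock := c\<rparr>)" using iu by simp
        show "cone_at (X x) (P ` insert p (S \<inter> {..<k})) (P (imem (u\<lparr>clock := c\<rparr>) 9 x)) (P (imem (u\<lparr>clock := c\<rparr>) 10 x))"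
          using I ne by simp
        show "X x \<notin> convex hull (P ` insert k (insert p (S \<inter> {..<k})))"
          by (rule hull[OF v(4)]) (use True p[OF ne] in auto)
      qed (use I ne eq w k v(4) c finS in \<open>auto simp: upd_apply eqS\<close>)
      then show ?thesis using eq(1) True w by simp
    qed
  next
    fix u assume *: "clock u \<le> clock v + (210 + 20) * Suc np \<and>
      (\<forall>y. y \<noteq> x \<longrightarrow> imem u 9 y = imem v 9 y \<and> imem u 10 y = imem v 10 y) \<and>
      (S \<noteq> {} \<longrightarrow> imem u 9 x < np \<and> imem u 10 x < np \<and>
        cone_at (X x) (P ` insert p (S \<inter> {..<np})) (P (imem u 9 x)) (P (imem u 10 x)))"
    have "insert p (S \<inter> {..<np}) = S" if "S \<noteq> {}" using p[OF that] S(2) by blast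
    with * show "clock u \<le> clock v + (210 + 20) * Suc np \<and>
      ((\<forall>y. y \<noteq> x \<longrightarrow> imem u 9 y = imem v 9 y \<and> imem u 10 y = imem v 10 y) \<and> (S \<noteq> {} \<longrightarrow> ?g (imem u) x))"
      by auto
  qed (use v in \<open>auto simp: frame_def inputs_def\<close>)
  have "wp (For 21 H ?B) (\<lambda>s'. clock s' \<le> clock t + ((230 * Suc np + 20) + 20) * Suc nx \<and>
      (S \<noteq> {} \<longrightarrow> (\<forall>x<nx. ?g (imem s') x))) t"
  proof (rule wp_For'[where I = "\<lambda>k m. S \<noteq> {} \<longrightarrow> (\<forall>x<k. ?g m x)" and N = nx])
    fix k u assume k: "k < nx" and I: "S \<noteq> {} \<longrightarrow> (\<forall>x<k. ?g (imem u) x)" and x: "imem u 21 0 = k"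
      and fr: "frame (For 21 H ?B) t u"
    have iu: "inputs u" by (rule inputs_frame[OF fr it]) simp_all
    have eq: "imem u 29 0 = p" "imem u 8 = imem t 8" using fr by (simp_all add: frame_def p_def)
    let ?v = "\<lambda>c. u\<lparr>imem := upd (upd (imem u) 9 k p) 10 k p, clock := c\<rparr>"
    let ?Q = "\<lambda>u'. clock u' \<le> clock u + (230 * Suc np + 20) \<and>
      (S \<noteq> {} \<longrightarrow> (\<forall>x<Suc k. ?g (upd (imem u') 21 0 (Suc k)) x))"
    have "wp ?L ?Q (?v c)" if c: "c \<le> clock u + 20" for c
    proof (rule wp_conseq[OF inner])
      show "inputs (?v c)" using iu by simp
      fix u' assume "clock u' \<le> clock (?v c) + (210 + 20) * Suc np \<and>
        ((\<forall>y. y \<noteq> k \<longrightarrow> imem u' 9 y = imem (?v c) 9 y \<and> imem u' 10 y = imem (?v c) 10 y) \<and> (S \<noteq> {} \<longrightarrow> ?g (imem u') k))"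
      then show "?Q u'" using c I by (auto simp: upd_apply less_Suc_eq)
    qed (use x k eq in \<open>simp_all add: upd_apply\<close>)
    then show "wp ?B ?Q u" using x eq(1) by (simp add: upd_apply)
  qed (use it in \<open>auto simp: frame_def inputs_def\<close>)
  then show "wp (For 21 H ?B) ?post t"
    by (rule wp_conseq) (use t in \<open>auto simp: cones_def algebra_simps\<close>)
qed

lemma wp_ARC:
  assumes s: "inputs s" and ab: "{a, b} \<subseteq> {1, 2}" and k: "imem s 30 0 = k"
    and u: "imem s a k = u" "imem s b k = v" "u < np"
    and f: "\<And>w. w < np \<Longrightarrow> imem s 5 w = w + np * length (f w) \<and> (\<forall>i<length (f w). imem s 6 (w + np * i) = f w ! i)"
  shows "wp (ARC a b) (\<lambda>s'. clock s' \<le> clock s + 30 \<and> (\<forall>w<np. imem s' 5 w = w + np * length ((f(u := f u @ [v])) w) \<and>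
    (\<forall>i<length ((f(u := f u @ [v])) w). imem s' 6 (w + np * i) = (f(u := f u @ [v])) w ! i))) s"
proof -
  \<comment> \<open>The slots of different vertices never collide: since \<open>w < np\<close>, the
    residue modulo \<open>np\<close> recovers the vertex.\<close>
  have inj: "w + np * i = u + np * i' \<longleftrightarrow> w = u \<and> i = i'" if "w < np" for w i i'
  proof
    assume *: "w + np * i = u + np * i'"
    then have "(w + np * i) mod np = (u + np * i') mod np" by simp
    then have "w = u" using that u(3) by simp
    moreover have "pts I \<noteq> []" using u(3) by auto
    ultimately show "w = u \<and> i = i'" using * by simp
  qed simp
  show ?thesis
    using ab k u f inputs_np[OF s]
    by (auto simp: ARC_def upd_apply inj nth_append less_Suc_eq)
qed

lemma wp_SETUP:
  assumes s: "inputs s"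
  shows "wp SETUP (\<lambda>s'. clock s' \<le> clock s + 300 * (ne + Suc np) \<and> ready s') s"
    (is "wp _ ?post _")
proof -
  let ?E = "For 30 M (Seq (ARC 1 2) (ARC 2 1))"
  let ?F = "For 30 J (IWrite 7 (IAdd (Var 30) (INum 1)) (IAdd (IRead 7 (Var 30)) (IRead 7 (Var 30))))"
  have 1: "wp ENDS (\<lambda>t. clock t \<le> clock s + (5 + 20) * Suc np \<and> (\<forall>u<np. imem t 5 u = u)) s"
    unfolding ENDS_def
    by (rule wp_For'[where I = "\<lambda>k m. \<forall>u<k. m 5 u = u" and N = np])
      (use s in \<open>auto simp: frame_def inputs_def upd_apply less_Suc_eq\<close>)
  have 2: "wp ?E (\<lambda>u. clock u \<le> clock t + (60 + 20) * Suc ne \<and> graph (imem u) (take ne (edges I))) t"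
    if t: "inputs t" "\<forall>u<np. imem t 5 u = u" for t
  proof (rule wp_For'[where I = "\<lambda>k m. graph m (take k (edges I))" and N = ne])
    show "graph (upd (imem t) 30 0 0) (take 0 (edges I))"
      using t(2) by (simp add: graph_def nbrs_of_def upd_apply)
  next
    fix k u assume k: "k < ne" and g: "graph (imem u) (take k (edges I))" and i: "imem u 30 0 = k"
      and fr: "frame ?E t u"
    have iu: "inputs u" by (rule inputs_frame[OF fr t(1)]) simp_all
    obtain a b where ab: "edges I ! k = (a, b)" by fastforce
    have ab': "a < np" "b < np" "a \<noteq> b" using edge_bounds[of a b] k ab nth_mem by metis+
    have m: "imem u 1 k = a" "imem u 2 k = b" using iu k ab by (simp_all add: inputs_def)
    let ?f = "nbrs_of (take k (edges I))"
    let ?f1 = "?f(a := ?f a @ [b])"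
    have f2: "nbrs_of (take (Suc k) (edges I)) = ?f1(b := ?f1 b @ [a])"
      using ab ab'(3) k by (auto simp: take_Suc_conv_app_nth nbrs_of_append nbrs_of_def)
    have "wp (ARC 1 2) (\<lambda>s'. clock s' \<le> clock u + 30 \<and> (\<forall>w<np. imem s' 5 w = w + np * length (?f1 w) \<and>
      (\<forall>i<length (?f1 w). imem s' 6 (w + np * i) = ?f1 w ! i))) u"
      by (rule wp_ARC[OF iu _ i]) (use m ab' g in \<open>auto simp: graph_def\<close>)
    then show "wp (Seq (ARC 1 2) (ARC 2 1)) (\<lambda>s''. clock s'' \<le> clock u + 60 \<and>
        graph (upd (imem s'') 30 0 (Suc k)) (take (Suc k) (edges I))) u"
    proof (rule wp_SeqI)
      fix v assume v: "clock v \<le> clock u + 30 \<and> (\<forall>w<np. imem v 5 w = w + np * length (?f1 w) \<and>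
        (\<forall>i<length (?f1 w). imem v 6 (w + np * i) = ?f1 w ! i))" and frv: "frame (ARC 1 2) u v"
      have iv: "inputs v" by (rule inputs_frame[OF frv iu]) simp_all
      have "wp (ARC 2 1) (\<lambda>s'. clock s' \<le> clock v + 30 \<and>
        (\<forall>w<np. imem s' 5 w = w + np * length ((?f1(b := ?f1 b @ [a])) w) \<and>
        (\<forall>i<length ((?f1(b := ?f1 b @ [a])) w). imem s' 6 (w + np * i) = (?f1(b := ?f1 b @ [a])) w ! i))) v"
        by (rule wp_ARC[OF iv, where k = k]) (use m ab' v i frv in \<open>auto simp: frame_def\<close>)
      then show "wp (ARC 2 1) (\<lambda>s''. clock s'' \<le> clock u + 60 \<and>
        graph (upd (imem s'') 30 0 (Suc k)) (take (Suc k) (edges I))) v"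
        by (rule wp_conseq) (use v in \<open>auto simp: graph_def f2 upd_apply\<close>)
    qed
  qed (use t in \<open>auto simp: frame_def inputs_def\<close>)
  have 3: "wp ?F (\<lambda>u. clock u \<le> clock t + (20 + 20) * Suc np \<and> (\<forall>v\<le>np. imem u 7 v = 2 ^ v)) t"
    if t: "inputs t" "imem t 7 0 = 1" for t
    by (rule wp_For'[where I = "\<lambda>k m. \<forall>v\<le>k. m 7 v = 2 ^ v" and N = np])
      (use t in \<open>auto simp: frame_def inputs_def upd_apply le_Suc_eq\<close>)
  show ?thesis
    unfolding SETUP_def
  proof (rule wp_SeqI[OF 1])
    fix t assume t: "clock t \<le> clock s + (5 + 20) * Suc np \<and> (\<forall>u<np. imem t 5 u = u)" and "frame ENDS s t"
    then have it: "inputs t" using inputs_frame[OF _ s, of ENDS t] by simp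
    show "wp (Seq ?E POWERS) ?post t"
    proof (rule wp_SeqI[OF 2[OF it]])
      show "\<forall>u<np. imem t 5 u = u" using t by blast
      fix u assume u: "clock u \<le> clock t + (60 + 20) * Suc ne \<and> graph (imem u) (take ne (edges I))" and "frame ?E t u"
      then have iu: "inputs u" using inputs_frame[OF _ it, of ?E u] by simp
      have "wp ?F ?post
        (u\<lparr>imem := upd (imem u) 7 0 1, clock := c\<rparr>)" if c: "c \<le> clock u + 10" for c
      proof (rule wp_frame[OF 3])
        let ?v = "u\<lparr>imem := upd (imem u) 7 0 1, clock := c\<rparr>"
        show iv: "inputs ?v" using iu by (simp add: inputs_def upd_apply)
        show "imem ?v 7 0 = 1" by (simp add: upd_apply)
        fix s' assume *: "clock s' \<le> clock ?v + (20 + 20) * Suc np \<and> (\<forall>v\<le>np. imem s' 7 v = 2 ^ v)" and fr: "frame ?F ?v s'"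
        have "inputs s'" using inputs_frame[OF fr iv] by simp
        moreover have "graph (imem s') (edges I)" using fr u by (simp add: frame_def graph_def upd_apply)
        ultimately show "clock s' \<le> clock s + 300 * (ne + Suc np) \<and> ready s'"
          using * c u t by (simp add: ready_def)
      qed
      then show "wp POWERS ?post u"
        by (simp add: POWERS_def)
    qed
  qed
qed

lemma wp_FINDONE:
  assumes s: "ready s"
  shows "wp FINDONE (\<lambda>s'. clock s' \<le> clock s + 3000 * (Suc np * (ne + Suc np * Suc nx)) \<and>
    (\<exists>qs. queue (imem s') qs \<and> distinct qs \<and> sol (set qs))) s"
proof -
  let ?U = "ne + Suc np * Suc nx"
  let ?C = "Cond (BAnd (ILess (INum 0) (Var 20)) (ILess (Var 14) (INum 1))) (Seq START FINISH) Skip"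
  let ?F = "For 22 J (Seq VALID ?C)"
  \<comment> \<open>An empty set stands for the case that all vertices examined so far lie on
    obstacles.\<close>
  let ?I = "\<lambda>k m. \<exists>qs. queue m qs \<and> distinct qs \<and> (if qs = [] then \<forall>v<k. P v \<in> X_of I else sol (set qs))"
  have "wp ?F (\<lambda>u. clock u \<le> clock t + (2400 * ?U + 20) * Suc np \<and> ?I np (imem u)) t"
    if t: "ready t" "imem t 14 0 = 0" for t
  proof (rule wp_For'[where I = ?I and N = np])
    show "?I 0 (upd (imem t) 22 0 0)" using t by (intro exI[of _ "[]"]) (simp add: queue_def upd_apply)
  next
    fix k u assume k: "k < np" and "?I k (imem u)" and x: "imem u 22 0 = k" and fr: "frame ?F t u"
    then obtain qs where q: "queue (imem u) qs" "distinct qs" "if qs = [] then \<forall>v<k. P v \<in> X_of I else sol (set qs)"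
      by blast
    have ru: "ready u"
      by (rule ready_frame[OF fr t(1)]) simp_all
    let ?Q = "\<lambda>u'. clock u' \<le> clock u + 2400 * ?U \<and> ?I (Suc k) (upd (imem u') 22 0 (Suc k))"
    have upd: "queue (upd m 22 0 i) p = queue m p" for m i p by (simp add: queue_def upd_apply)
    show "wp (Seq VALID ?C) ?Q u"
    proof (rule wp_SeqI[OF wp_VALID[OF ready_inputs[OF ru] x k]])
      fix v assume v: "clock v \<le> clock u + 100 * Suc nx \<and> (0 < imem v 20 0 \<longleftrightarrow> P k \<notin> X_of I)" and frv: "frame VALID u v"
      have rv: "ready v" by (rule ready_frame[OF frv ru]) simp_all
      have qv: "queue (imem v) qs" "imem v 22 0 = k" using q(1) x frv by (simp_all add: frame_def queue_def)
      show "wp ?C ?Q v"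
      proof (cases "P k \<notin> X_of I \<and> qs = []")
        case False
        have "?I (Suc k) (imem v)" using qv q False by (intro exI[of _ qs]) (auto simp: less_Suc_eq)
        moreover have "\<not> bval (BAnd (ILess (INum 0) (Var 20)) (ILess (Var 14) (INum 1))) v"
          using False v qv by (auto simp: queue_def)
        ultimately show ?thesis using v by (simp only: wp_Cond if_False wp_Skip) (simp add: upd algebra_simps)
      next
        case True
        have "wp (Seq START FINISH) ?Q (v\<lparr>clock := c\<rparr>)" if c: "c \<le> clock v + 10" for c
        proof (rule wp_SeqI[OF wp_START])
          show "inputs (v\<lparr>clock := c\<rparr>)" "imem (v\<lparr>clock := c\<rparr>) 22 0 = k" "k < np" "P k \<notin> X_of I"
            using rv qv k True by (auto simp: ready_inputs)
          fix w assume w: "clock w \<le> clock (v\<lparr>clock := c\<rparr>) + 50 * Suc nx \<and> queue (imem w) [k] \<and> cones 11 12 (imem w) {k}"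
            and frw: "frame START (v\<lparr>clock := c\<rparr>) w"
          have "ready (v\<lparr>clock := c\<rparr>)" using rv by simp
          then have rw: "ready w" by (rule ready_frame[OF frw]) simp_all
          have "wp FINISH (\<lambda>s'. clock s' \<le> clock w + 2100 * ?U \<and>
            (\<exists>qs'. queue (imem s') qs' \<and> distinct qs' \<and> sol (set qs') \<and> set [k] \<subseteq> set qs')) w"
            by (rule wp_FINISH[OF rw]) (use w k in auto)
          then show "wp FINISH ?Q w"
          proof (rule wp_conseq, elim conjE exE)
            fix s' p assume c': "clock s' \<le> clock w + 2100 * ?U" and p: "queue (imem s') p" "distinct p" "sol (set p)" "set [k] \<subseteq> set p"
            have "p \<noteq> []" using p(4) by auto
            then have "?I (Suc k) (upd (imem s') 22 0 (Suc k))" using p by (intro exI[of _ p]) (simp add: upd)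
            moreover have "clock s' \<le> clock u + 2400 * ?U" using c' w c v by (simp add: algebra_simps)
            ultimately show "?Q s'" by blast
          qed
        qed
        then show ?thesis using True v qv by (simp add: queue_def)
      qed
    qed
  qed (use t in \<open>auto simp: frame_def ready_def inputs_def\<close>)
  note loop = this
  have "wp ?F (\<lambda>s'. clock s' \<le> clock s + 3000 * (Suc np * ?U) \<and>
    (\<exists>qs. queue (imem s') qs \<and> distinct qs \<and> sol (set qs))) (s\<lparr>imem := upd (imem s) 14 0 0, clock := c\<rparr>)"
    if c: "c \<le> clock s + 10" for c
  proof (rule wp_conseq[OF loop], simp_all only: ready_clock)
    show "ready (s\<lparr>imem := upd (imem s) 14 0 0\<rparr>)" using s by simp
    show "imem (s\<lparr>imem := upd (imem s) 14 0 0, clock := c\<rparr>) 14 0 = 0" by (simp add: upd_apply)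
    fix s' assume *: "clock s' \<le> clock (s\<lparr>imem := upd (imem s) 14 0 0, clock := c\<rparr>) + (2400 * ?U + 20) * Suc np \<and> ?I np (imem s')"
    then obtain qs where "queue (imem s') qs" "distinct qs" "if qs = [] then \<forall>v<np. P v \<in> X_of I else sol (set qs)" by blast
    then have "\<exists>qs. queue (imem s') qs \<and> distinct qs \<and> sol (set qs)"
      using sol_empty by (intro exI[of _ qs]) (auto split: if_splits)
    moreover have "clock s' \<le> clock s + 3000 * (Suc np * ?U)"
      using * c by (simp add: algebra_simps)
    ultimately show "clock s' \<le> clock s + 3000 * (Suc np * ?U) \<and> (\<exists>qs. queue (imem s') qs \<and> distinct qs \<and> sol (set qs))"
      by blast
  qed
  then show ?thesis by (simp add: FINDONE_def)
qed


lemma wp_EMITQ: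
  assumes q: "queue (imem s) qs"
  shows "wp EMITQ (\<lambda>s'. clock s' \<le> clock s + 40 * Suc (length qs) \<and> buffer s' = [] \<and>
    map snd (outputs s') = map snd (outputs s) @ [buffer s @ qs]) s"
  unfolding EMITQ_def wp_Seq
proof (rule wp_For[where I = "\<lambda>k m b os. queue m qs \<and> b = buffer s @ take k qs \<and> os = outputs s"
      and N = "length qs" and t = 10])
  fix k and s' :: state assume "k < length qs" "queue (imem s') qs \<and> buffer s' = buffer s @ take k qs \<and> outputs s' = outputs s"
    "imem s' 19 0 = k"
  then show "wp (Emit (IRead 13 (Var 19))) (\<lambda>s''. clock s'' \<le> clock s' + 10 \<and>
      queue (upd (imem s'') 19 0 (Suc k)) qs \<and> buffer s'' = buffer s @ take (Suc k) qs \<and> outputs s'' = outputs s) s'"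
    by (simp add: queue_def upd_apply take_Suc_conv_app_nth)
qed (use q in \<open>auto simp: queue_def upd_apply\<close>)

text \<open>Generic in the consumer \<open>c\<close>, whose record of solutions \<open>Ts\<close> is
  described by \<open>R\<close>. A call of \<open>c\<close> may leave the record unchanged if the
  set is already in it. \<open>R_cong\<close> confines \<open>R\<close> to the arrays from 24 on and
  the output, which the construction of neighbors leaves alone.\<close>

lemma wp_ALLNB:
  fixes R :: "nat set list \<Rightarrow> (nat \<Rightarrow> nat \<Rightarrow> nat) \<Rightarrow> nat list \<Rightarrow> (nat \<times> nat list) list \<Rightarrow> bool"
  assumes s: "ready s" and S: "sol S" "chars (imem s) S" "S \<noteq> {} \<longrightarrow> cones 9 10 (imem s) S"
    and R: "R Ts (imem s) (buffer s) (outputs s)"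
    and c: "\<And>Ts t qs. ready t \<Longrightarrow> R Ts (imem t) (buffer t) (outputs t) \<Longrightarrow> queue (imem t) qs \<Longrightarrow>
      distinct qs \<Longrightarrow> sol (set qs) \<Longrightarrow>
      wp c (\<lambda>t'. clock t' \<le> clock t + 500 * Suc np \<and>
        (\<exists>zs. R (Ts @ zs) (imem t') (buffer t') (outputs t') \<and> set qs \<in> set (Ts @ zs) \<and> set zs \<subseteq> {set qs})) t"
    and R_cong: "\<And>Ts m m' b os. R Ts m b os \<Longrightarrow> (\<And>a. 24 \<le> a \<Longrightarrow> m' a = m a) \<Longrightarrow> R Ts m' b os"
    and w: "writes c \<inter> {0, 1, 2, 5, 6, 7, 8, 9, 10, 22, 23} = {}" "real_free c"
  shows "wp (ALLNB c) (\<lambda>s'. clock s' \<le> clock s + 30000 * (Suc np * Suc nx * (ne + Suc np * Suc nx)) \<and>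
    (\<exists>zs. R (Ts @ zs) (imem s') (buffer s') (outputs s') \<and> Ball (set zs) sol \<and>
      (\<forall>v<np. P v \<notin> X_of I \<longrightarrow> (\<forall>y\<le>nx. \<exists>S'\<in>set (Ts @ zs). neighbor S v y S')))) s"
proof -
  let ?U = "ne + Suc np * Suc nx"
  let ?L = "For 23 (IAdd H (INum 1)) (Seq NEIGHBOR c)"
  let ?C = "Cond (ILess (INum 0) (Var 20)) ?L Skip"
  let ?F = "For 22 J (Seq VALID ?C)"
  let ?nb = "\<lambda>zs v y. \<exists>S'\<in>set (Ts @ zs). neighbor S v y S'"
  let ?inner = "\<lambda>v zs0 k m b os. \<exists>zs. R (Ts @ zs0 @ zs) m b os \<and> Ball (set zs) sol \<and>
    (\<forall>y<k. ?nb (zs0 @ zs) v y)"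
  let ?outer = "\<lambda>k m b os. \<exists>zs. R (Ts @ zs) m b os \<and> Ball (set zs) sol \<and>
    (\<forall>v<k. P v \<notin> X_of I \<longrightarrow> (\<forall>y\<le>nx. ?nb zs v y))"
  have w': "a \<notin> writes c" if "a \<in> {0, 1, 2, 5, 6, 7, 8, 9, 10, 22, 23}" for a
    using w(1) that by (meson disjoint_iff)
  have SnP: "S \<subseteq> {..<np}" using sol_subset[OF S(1)] .
  have frF: "ready u \<and> chars (imem u) S \<and> (S \<noteq> {} \<longrightarrow> cones 9 10 (imem u) S)" if "frame ?F s u" for u
  proof
    show "ready u" by (rule ready_frame[OF that s])
      (use w' w(2) in auto)
    have "imem u a = imem s a" if a: "a \<in> {8, 9, 10}" for a
    proof (rule frame_imem[OF \<open>frame ?F s u\<close>])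
      have "a \<notin> writes c" using w'[of a] a by blast
      then show "a \<notin> writes ?F" using a by auto
    qed
    then show "chars (imem u) S \<and> (S \<noteq> {} \<longrightarrow> cones 9 10 (imem u) S)"
      using S by (simp add: chars_def cones_def)
  qed
  have inner: "wp ?L (\<lambda>t'. clock t' \<le> clock t + (6500 * ?U + 20) * Suc (Suc nx) \<and>
      (?inner v zs0 (Suc nx) (imem t') (buffer t') (outputs t'))) t"
    if t: "ready t" "chars (imem t) S" "cones 9 10 (imem t) S" "imem t 22 0 = v" "v < np" "P v \<notin> X_of I"
      "R (Ts @ zs0) (imem t) (buffer t) (outputs t)" for t v zs0
  proof (rule wp_For[where N = "Suc nx" and t = "6500 * ?U" and
        I = "?inner v zs0"])
    have "R (Ts @ zs0) (upd (imem t) 23 0 0) (buffer t) (outputs t)"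
      by (rule R_cong[OF t(7)]) (simp add: upd_apply)
    then show "?inner v zs0 0 (upd (imem t) 23 0 0) (buffer t) (outputs t)"
      by (intro exI[of _ "[]"]) simp
  next
    fix k u assume k: "k < Suc nx" and y: "imem u 23 0 = k" and fr: "frame ?L t u"
      and "?inner v zs0 k (imem u) (buffer u) (outputs u)"
    then obtain zs where zs: "R (Ts @ zs0 @ zs) (imem u) (buffer u) (outputs u)" "Ball (set zs) sol"
      "\<forall>y<k. ?nb (zs0 @ zs) v y" by blast
    have ru: "ready u" by (rule ready_frame[OF fr t(1)])
      (use w' w(2) in auto)
    have eq: "imem u a = imem t a" if a: "a \<in> {8, 9, 10, 22}" for a
    proof (rule frame_imem[OF fr])
      have "a \<notin> writes c" using w'[of a] a by blast
      then show "a \<notin> writes ?L" using a by auto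
    qed
    have Su: "chars (imem u) S" "cones 9 10 (imem u) S" "imem u 22 0 = v"
      using t eq by (simp_all add: chars_def cones_def)
    show "wp (Seq NEIGHBOR c) (\<lambda>u'. clock u' \<le> clock u + 6500 * ?U \<and>
      (?inner v zs0 (Suc k) (upd (imem u') 23 0 (Suc k)) (buffer u') (outputs u'))) u"
    proof (rule wp_SeqI[OF wp_NEIGHBOR[OF ru Su(1,2) SnP Su(3) t(5,6) y]], elim conjE exE)
      fix p qs assume p: "clock p \<le> clock u + 6000 * ?U" and q: "queue (imem p) qs" "distinct qs" "neighbor S v k (set qs)"
        and frp: "frame NEIGHBOR u p"
      have rp: "ready p" by (rule ready_frame[OF frp ru]) simp_all
      have "imem p a = imem u a" if "24 \<le> a" for a
        using frp that by (auto simp: frame_def)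
      then have "R (Ts @ zs0 @ zs) (imem p) (buffer u) (outputs u)" by (rule R_cong[OF zs(1)])
      then have Rp: "R (Ts @ zs0 @ zs) (imem p) (buffer p) (outputs p)"
        using frame_buffer[OF frp] frame_outputs[OF frp] by simp
      have solq: "sol (set qs)" using q(3) by (simp add: neighbor_def)
      show "wp c (\<lambda>u'. clock u' \<le> clock u + 6500 * ?U \<and>
        (?inner v zs0 (Suc k) (upd (imem u') 23 0 (Suc k)) (buffer u') (outputs u'))) p"
      proof (rule wp_conseq[OF c[OF rp Rp q(1,2) solq]], elim conjE exE)
        fix u' ys assume u': "clock u' \<le> clock p + 500 * Suc np"
          and ys: "R ((Ts @ zs0 @ zs) @ ys) (imem u') (buffer u') (outputs u')"
            "set qs \<in> set ((Ts @ zs0 @ zs) @ ys)" "set ys \<subseteq> {set qs}"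
        have "R ((Ts @ zs0 @ zs) @ ys) (upd (imem u') 23 0 (Suc k)) (buffer u') (outputs u')"
          by (rule R_cong[OF ys(1)]) (simp add: upd_apply)
        then have "R (Ts @ zs0 @ (zs @ ys)) (upd (imem u') 23 0 (Suc k)) (buffer u') (outputs u')" by simp
        moreover have "Ball (set (zs @ ys)) sol" using zs(2) ys(3) solq by auto
        moreover have "?nb (zs0 @ (zs @ ys)) v y" if "y < Suc k" for y
          using that zs(3) ys(2) q(3) by (cases "y = k") (auto simp: less_Suc_eq)
        moreover have "clock u' \<le> clock u + 6500 * ?U" using u' p by (simp add: algebra_simps)
        ultimately show "clock u' \<le> clock u + 6500 * ?U \<and>
          (?inner v zs0 (Suc k) (upd (imem u') 23 0 (Suc k)) (buffer u') (outputs u'))" by blast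
      qed
    qed
  qed (use t w' in \<open>auto simp: frame_def ready_def inputs_def\<close>)
  show ?thesis
    unfolding ALLNB_def
  proof (rule wp_For[where N = np and t = "(6500 * ?U + 20) * Suc (Suc nx) + 100 * Suc nx + 20" and
        I = ?outer])
    have "R Ts (upd (imem s) 22 0 0) (buffer s) (outputs s)"
      by (rule R_cong[OF R]) (simp add: upd_apply)
    then show "?outer 0 (upd (imem s) 22 0 0) (buffer s) (outputs s)"
      by (intro exI[of _ "[]"]) simp
  next
    fix k u assume k: "k < np" and x: "imem u 22 0 = k" and fr: "frame ?F s u"
      and "?outer k (imem u) (buffer u) (outputs u)"
    then obtain zs where zs: "R (Ts @ zs) (imem u) (buffer u) (outputs u)" "Ball (set zs) sol"
      "\<forall>v<k. P v \<notin> X_of I \<longrightarrow> (\<forall>y\<le>nx. ?nb zs v y)" by blast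
    have ru: "ready u" and Su: "chars (imem u) S" "S \<noteq> {} \<longrightarrow> cones 9 10 (imem u) S" using frF[OF fr] by auto
    let ?Q = "\<lambda>u'. clock u' \<le> clock u + ((6500 * ?U + 20) * Suc (Suc nx) + 100 * Suc nx + 20) \<and>
      (?outer (Suc k) (upd (imem u') 22 0 (Suc k)) (buffer u') (outputs u'))"
    show "wp (Seq VALID ?C) ?Q u"
    proof (rule wp_SeqI[OF wp_VALID[OF ready_inputs[OF ru] x k]])
      fix v assume v: "clock v \<le> clock u + 100 * Suc nx \<and> (0 < imem v 20 0 \<longleftrightarrow> P k \<notin> X_of I)" and frv: "frame VALID u v"
      have rv: "ready v" by (rule ready_frame[OF frv ru]) simp_all
      have "imem v a = imem u a" if "24 \<le> a" for a
        using frv that by (auto simp: frame_def)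
      then have "R (Ts @ zs) (imem v) (buffer u) (outputs u)" by (rule R_cong[OF zs(1)])
      then have Rv: "R (Ts @ zs) (imem v) (buffer v) (outputs v)"
        using frame_buffer[OF frv] frame_outputs[OF frv] by simp
      have Sv: "chars (imem v) S" "S \<noteq> {} \<longrightarrow> cones 9 10 (imem v) S" "imem v 22 0 = k"
        using Su x frv by (simp_all add: chars_def cones_def frame_def)
      show "wp ?C ?Q v"
      proof (cases "P k \<notin> X_of I")
        case False
        have "R (Ts @ zs) (upd (imem v) 22 0 (Suc k)) (buffer v) (outputs v)"
          by (rule R_cong[OF Rv]) (simp add: upd_apply)
        moreover have "\<forall>v<Suc k. P v \<notin> X_of I \<longrightarrow> (\<forall>y\<le>nx. ?nb zs v y)"
          using zs(3) False by (auto simp: less_Suc_eq)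
        moreover have "clock v + 10 \<le> clock u + ((6500 * ?U + 20) * Suc (Suc nx) + 100 * Suc nx + 20)"
          using v by linarith
        ultimately have "?Q (v\<lparr>clock := clock v + 5\<rparr>)" "?Q (v\<lparr>clock := clock v + 4\<rparr>)" using zs(2) by auto
        moreover have "\<not> bval (ILess (INum 0) (Var 20)) v" using False v by simp
        ultimately show ?thesis by (simp only: wp_Cond if_False wp_Skip) simp
      next
        case True
        \<comment> \<open>A vertex off all obstacles exists, so the maximal set \<open>S\<close> is
          nonempty and its cones are available.\<close>
        have "S \<noteq> {}" using sol_nonempty[OF S(1) k True] .
        have "wp ?L ?Q (v\<lparr>clock := c\<rparr>)" if c: "c \<le> clock v + 10" for c
        proof (rule wp_conseq[OF inner])
          show "ready (v\<lparr>clock := c\<rparr>)" using rv by simp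
          show "chars (imem (v\<lparr>clock := c\<rparr>)) S" "cones 9 10 (imem (v\<lparr>clock := c\<rparr>)) S"
            "imem (v\<lparr>clock := c\<rparr>) 22 0 = k" "k < np" "P k \<notin> X_of I"
            "R (Ts @ zs) (imem (v\<lparr>clock := c\<rparr>)) (buffer (v\<lparr>clock := c\<rparr>)) (outputs (v\<lparr>clock := c\<rparr>))"
            using Sv \<open>S \<noteq> {}\<close> k True Rv by auto
          fix u' assume "clock u' \<le> clock (v\<lparr>clock := c\<rparr>) + (6500 * ?U + 20) * Suc (Suc nx) \<and>
            (\<exists>ys. R (Ts @ zs @ ys) (imem u') (buffer u') (outputs u') \<and> Ball (set ys) sol \<and> (\<forall>y<Suc nx. ?nb (zs @ ys) k y))"
          then obtain ys where u': "clock u' \<le> c + (6500 * ?U + 20) * Suc (Suc nx)"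
            and ys: "R (Ts @ zs @ ys) (imem u') (buffer u') (outputs u')" "Ball (set ys) sol" "\<forall>y<Suc nx. ?nb (zs @ ys) k y"
            by auto
          have "R (Ts @ zs @ ys) (upd (imem u') 22 0 (Suc k)) (buffer u') (outputs u')"
            by (rule R_cong[OF ys(1)]) (simp add: upd_apply)
          moreover have "Ball (set (zs @ ys)) sol" using zs(2) ys(2) by auto
          moreover have "?nb (zs @ ys) v y" if "v < Suc k" "P v \<notin> X_of I" "y \<le> nx" for v y
          proof (cases "v = k")
            case True
            then show ?thesis using ys(3) that(3) le_imp_less_Suc by blast
          next
            case False
            then have "?nb zs v y" using zs(3) that by (simp add: less_Suc_eq)
            then show ?thesis by auto
          qed
          moreover have "clock u' \<le> clock u + ((6500 * ?U + 20) * Suc (Suc nx) + 100 * Suc nx + 20)"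
            using u' v c by linarith
          ultimately show "?Q u'" by blast
        qed
        moreover have "bval (ILess (INum 0) (Var 20)) v" using True v by simp
        ultimately show ?thesis by (simp only: wp_Cond if_True) simp
      qed
    qed
  next
    fix u assume fr: "frame ?F s u" and cl: "clock u \<le> clock s +
        ((6500 * ?U + 20) * Suc (Suc nx) + 100 * Suc nx + 20 + 20) * Suc np"
      and zs: "?outer np (imem u) (buffer u) (outputs u)"
    have "1 * 1 \<le> Suc np * Suc nx" by (rule mult_le_mono) simp_all
    then have U: "1 \<le> ?U" by simp
    have "(6500 * ?U + 20) * Suc (Suc nx) \<le> (6520 * ?U) * (2 * Suc nx)"
      by (rule mult_le_mono) (use U in simp_all)
    moreover have "1 * Suc nx \<le> ?U * Suc nx" by (rule mult_le_mono1[OF U])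
    moreover have "1 * 1 \<le> ?U * Suc nx" by (rule mult_le_mono[OF U]) simp
    ultimately have "(6500 * ?U + 20) * Suc (Suc nx) + 100 * Suc nx + 20 + 20 \<le> 14000 * (?U * Suc nx)"
      by linarith
    then have "((6500 * ?U + 20) * Suc (Suc nx) + 100 * Suc nx + 20 + 20) * Suc np \<le> 14000 * (?U * Suc nx) * Suc np"
      by (rule mult_le_mono1)
    also have "14000 * (?U * Suc nx) * Suc np = 14000 * (Suc np * Suc nx * ?U)" by (simp only: mult_ac)
    finally have "clock u \<le> clock s + 30000 * (Suc np * Suc nx * ?U)"
      using cl by linarith
    then show "clock u \<le> clock s + 30000 * (Suc np * Suc nx * ?U) \<and>
      (?outer np (imem u) (buffer u) (outputs u))"
      using zs by blast
  qed (use s w' in \<open>auto simp: frame_def ready_def inputs_def\<close>)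
qed

end

section \<open>Listing all solutions\<close>

definition CODE :: com where
  "CODE = Seq (IWrite 28 (INum 0) (INum 0))
    (For 19 (Var 14) (IWrite 28 (INum 0) (IAdd (Var 28) (IRead 7 (IRead 13 (Var 19))))))"

definition ADDNEW :: com where
  "ADDNEW = Seq CODE (Cond (ILess (IRead 24 (Var 28)) (INum 1))
    (Seq (IWrite 24 (Var 28) (INum 1)) (Seq (IWrite 25 (Var 27) (Var 28))
      (IWrite 27 (INum 0) (IAdd (Var 27) (INum 1))))) Skip)"

text \<open>The binary digits are read from the highest down, by comparison and subtraction in place
  of division. Elements are emitted on the way, so the output item is complete when decoding
  ends.\<close>

definition DECODE :: com where
  "DECODE = Seq (IWrite 28 (INum 0) (IRead 25 (Var 26)))
    (For 30 J (Seq (IWrite 19 (INum 0) (ISub (ISub J (INum 1)) (Var 30)))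
      (Cond (ILess (Var 28) (IRead 7 (Var 19))) (IWrite 8 (Var 19) (INum 0))
        (Seq (IWrite 8 (Var 19) (INum 1))
        (Seq (IWrite 28 (INum 0) (ISub (Var 28) (IRead 7 (Var 19)))) (Emit (Var 19)))))))"

text \<open>Output precedes the neighbors, so two consecutive outputs are separated by one
  enumeration of neighbors and one decoding.\<close>

definition VISIT :: com where
  "VISIT = Seq DECODE (Seq Flush (Seq CONES (Seq (ALLNB ADDNEW)
    (IWrite 26 (INum 0) (IAdd (Var 26) (INum 1))))))"

definition LISTING :: com where
  "LISTING = Seq SETUP (Seq FINDONE (Seq ADDNEW (While (ILess (Var 26) (Var 27)) VISIT)))"

lemma writes_ADDNEW [simp]: "writes ADDNEW = {19, 24, 25, 27, 28}"
  and writes_CODE [simp]: "writes CODE = {19, 28}"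
  and writes_DECODE [simp]: "writes DECODE = {8, 19, 28, 30}"
  by (auto simp: CODE_def ADDNEW_def DECODE_def)

lemma ADDNEW_frame [simp]: "real_free ADDNEW" "quiet ADDNEW" "real_free DECODE"
  by (auto simp: CODE_def ADDNEW_def DECODE_def)

lemma set_encode_lt: "A \<subseteq> {..<n} \<Longrightarrow> set_encode A < 2 ^ n"
proof -
  assume "A \<subseteq> {..<n}"
  then have "set_encode A \<le> sum ((^) 2) {..<n}"
    unfolding set_encode_def by (intro sum_mono2) auto
  also have "\<dots> = 2 ^ n - 1" by (simp add: lessThan_atLeast0 sum_power2)
  finally show ?thesis using one_le_power[of "2::nat" n] by linarith
qed

lemma nth_notin_take: "distinct xs \<Longrightarrow> k < length xs \<Longrightarrow> xs ! k \<notin> set (take k xs)"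
  by (auto simp: in_set_conv_nth nth_eq_iff_index_eq)

lemma delay_le:
  assumes "successively (\<lambda>a b. b \<le> a + B) (0 # map fst (outputs s) @ [clock s])"
  shows "delay s \<le> B"
proof -
  let ?ts = "0 # map fst (outputs s) @ [clock s]"
  have "\<forall>i. Suc i < length ?ts \<longrightarrow> ?ts ! Suc i \<le> ?ts ! i + B"
    using assms unfolding successively_conv_nth .
  then have "d \<le> B" if "d \<in> {?ts ! Suc i - ?ts ! i |i. Suc i < length ?ts}" for d
    using that le_diff_conv by (auto simp: add.commute)
  moreover have "finite {?ts ! Suc i - ?ts ! i |i. Suc i < length ?ts}"
    by (rule finite_subset[of _ "(\<lambda>i. ?ts ! Suc i - ?ts ! i) ` {..<length ?ts}"]) auto
  moreover have "?ts ! Suc 0 - ?ts ! 0 \<in> {?ts ! Suc i - ?ts ! i |i. Suc i < length ?ts}"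
    by (intro CollectI exI[of _ 0] conjI refl) simp
  then have "{?ts ! Suc i - ?ts ! i |i. Suc i < length ?ts} \<noteq> {}" by blast
  ultimately show ?thesis unfolding delay_def Let_def by (subst Max_le_iff) auto
qed

context hull_inst
begin

text \<open>Up to a constant, the time to enumerate all neighbors of one solution. The successors
  keep it positive in degenerate instances.\<close>

definition work :: nat where
  "work = Suc np * Suc nx * (ne + Suc np * Suc nx)"

lemma work_ge: "ne + Suc np * Suc nx \<le> work" "Suc np * Suc nx \<le> work" "Suc np \<le> work"
  "Suc np * (ne + Suc np * Suc nx) \<le> work" "1 \<le> work" "300 * (ne + Suc np) \<le> 600 * work"
proof -
  have a: "1 * 1 \<le> Suc np * Suc nx" by (rule mult_le_mono) simp_all
  then have "1 * (ne + Suc np * Suc nx) \<le> work" unfolding work_def by (intro mult_le_mono1) simp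
  then show 1: "ne + Suc np * Suc nx \<le> work" by simp
  then show 2: "Suc np * Suc nx \<le> work" by simp
  have "Suc np * 1 \<le> Suc np * Suc nx" by (rule mult_le_mono2) simp
  then show 3: "Suc np \<le> work" using 2 by simp
  have "Suc np * 1 * (ne + Suc np * Suc nx) \<le> work"
    unfolding work_def by (intro mult_le_mono mult_le_mono2) simp_all
  then show "Suc np * (ne + Suc np * Suc nx) \<le> work" by simp
  show "1 \<le> work" using a 2 by simp
  have "ne + Suc np \<le> 2 * work" using 1 3 by simp
  then show "300 * (ne + Suc np) \<le> 600 * work" using mult_le_mono2[of "ne + Suc np" "2 * work" 300] by simp
qed

lemma length_le_np: "distinct qs \<Longrightarrow> set qs \<subseteq> {..<np} \<Longrightarrow> length qs \<le> np"
  using card_mono[of "{..<np}" "set qs"] by (simp add: distinct_card)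

lemma wp_CODE:
  assumes s: "ready s" and q: "queue (imem s) qs" "distinct qs" "set qs \<subseteq> {..<np}"
  shows "wp CODE (\<lambda>s'. clock s' \<le> clock s + 40 * Suc np \<and> imem s' 28 0 = set_encode (set qs)) s"
proof -
  let ?F = "For 19 (Var 14) (IWrite 28 (INum 0) (IAdd (Var 28) (IRead 7 (IRead 13 (Var 19)))))"
  have "wp ?F (\<lambda>s'. clock s' \<le> clock t + (12 + 20) * Suc (length qs) \<and>
      imem s' 28 0 = set_encode (set (take (length qs) qs))) t"
    if t: "ready t" "queue (imem t) qs" "imem t 28 0 = 0" for t
  proof (rule wp_For'[where I = "\<lambda>k m. m 28 0 = set_encode (set (take k qs))" and N = "length qs"])
    fix k u assume k: "k < length qs" and I: "imem u 28 0 = set_encode (set (take k qs))" and i: "imem u 19 0 = k"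
      and fr: "frame ?F t u"
    have "ready u" by (rule ready_frame[OF fr t(1)]) simp_all
    moreover have "qs ! k < np" using k q(3) nth_mem by blast
    ultimately have "imem u 7 (qs ! k) = 2 ^ (qs ! k)" by (simp add: ready_def)
    moreover have "imem u 13 k = qs ! k" using t(2) k fr by (simp add: frame_def queue_def)
    moreover have "set (take (Suc k) qs) = insert (qs ! k) (set (take k qs))"
      using k by (simp add: take_Suc_conv_app_nth)
    ultimately show "wp (IWrite 28 (INum 0) (IAdd (Var 28) (IRead 7 (IRead 13 (Var 19)))))
      (\<lambda>u'. clock u' \<le> clock u + 12 \<and> upd (imem u') 19 0 (Suc k) 28 0 = set_encode (set (take (Suc k) qs))) u"
      using nth_notin_take[OF q(2) k] i I by (simp add: upd_apply)
  qed (use t in \<open>auto simp: frame_def queue_def upd_apply\<close>)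
  note loop = this
  show ?thesis
    unfolding CODE_def wp_Seq wp_IWrite
    by (rule wp_conseq[OF loop]) (use s q length_le_np[OF q(2,3)] in \<open>auto simp: upd_apply queue_def\<close>)
qed

text \<open>\<open>Ts\<close> contains all solutions ever enqueued, including those already visited:
  array 25 is never shortened and its head is kept separately.\<close>

definition found :: "nat set list \<Rightarrow> (nat \<Rightarrow> nat \<Rightarrow> nat) \<Rightarrow> bool" where
  "found Ts m \<longleftrightarrow> m 27 0 = length Ts \<and> (\<forall>i<length Ts. m 25 i = set_encode (Ts ! i)) \<and>
    (\<forall>n. m 24 n \<noteq> 0 \<longleftrightarrow> (\<exists>T\<in>set Ts. n = set_encode T)) \<and> distinct Ts \<and> Ball (set Ts) sol"

lemma found_cong: "found Ts m \<Longrightarrow> (\<And>a. 24 \<le> a \<Longrightarrow> m' a = m a) \<Longrightarrow> found Ts m'"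
  by (simp add: found_def)

lemma wp_ADDNEW:
  assumes s: "ready s" and f: "found Ts (imem s)"
    and q: "queue (imem s) qs" "distinct qs" "sol (set qs)"
  shows "wp ADDNEW (\<lambda>s'. clock s' \<le> clock s + 500 * Suc np \<and>
    (\<exists>zs. found (Ts @ zs) (imem s') \<and> set qs \<in> set (Ts @ zs) \<and> set zs \<subseteq> {set qs})) s"
    (is "wp _ ?post _")
  unfolding ADDNEW_def
proof (rule wp_SeqI[OF wp_CODE[OF s q(1,2) sol_subset[OF q(3)]]])
  let ?c = "set_encode (set qs)"
  fix t assume t: "clock t \<le> clock s + 40 * Suc np \<and> imem t 28 0 = ?c" and fr: "frame CODE s t"
  have f': "found Ts (imem t)" using f fr by (simp add: found_def frame_def)
  \<comment> \<open>Codes are injective on finite sets, so the entry at \<open>?c\<close> cannot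
    stem from another solution.\<close>
  have mem: "imem t 24 ?c \<noteq> 0 \<longleftrightarrow> set qs \<in> set Ts"
  proof
    assume "imem t 24 ?c \<noteq> 0"
    then obtain T where "T \<in> set Ts" "?c = set_encode T" using f' unfolding found_def by blast
    moreover have "sol T" using calculation(1) f' by (simp add: found_def)
    ultimately show "set qs \<in> set Ts" using set_encode_eq[of "set qs" T] sol_finite[of T] by simp
  next
    assume "set qs \<in> set Ts"
    then show "imem t 24 ?c \<noteq> 0" using f' unfolding found_def by blast
  qed
  show "wp (Cond (ILess (IRead 24 (Var 28)) (INum 1))
    (Seq (IWrite 24 (Var 28) (INum 1)) (Seq (IWrite 25 (Var 27) (Var 28))
      (IWrite 27 (INum 0) (IAdd (Var 27) (INum 1))))) Skip)
    ?post t"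
  proof (cases "set qs \<in> set Ts")
    case True
    then show ?thesis using mem t f' by (auto intro!: exI[of _ "[]"])
  next
    case False
    have "found (Ts @ [set qs]) (upd (upd (upd (imem t) 24 ?c 1) 25 (length Ts) ?c) 27 0 (Suc (length Ts)))"
      using f' False q(3) by (auto simp: found_def upd_apply nth_append less_Suc_eq)
    moreover have "imem t 27 0 = length Ts" using f' by (simp add: found_def)
    ultimately show ?thesis
      using False mem t by (auto simp: upd_apply intro!: exI[of _ "[set qs]"])
  qed
qed

lemma wp_DECODE:
  assumes s: "ready s" and k: "imem s 26 0 = k" "imem s 25 k = set_encode S" and S: "S \<subseteq> {..<np}"
    and b: "buffer s = []"
  shows "wp DECODE (\<lambda>s'. clock s' \<le> clock s + 100 * Suc np \<and> chars (imem s') S \<and>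
    distinct (buffer s') \<and> set (buffer s') = S \<and> outputs s' = outputs s) s"
    (is "wp _ ?post _")
proof -
  let ?C = "Seq (IWrite 19 (INum 0) (ISub (ISub J (INum 1)) (Var 30)))
      (Cond (ILess (Var 28) (IRead 7 (Var 19))) (IWrite 8 (Var 19) (INum 0))
        (Seq (IWrite 8 (Var 19) (INum 1))
        (Seq (IWrite 28 (INum 0) (ISub (Var 28) (IRead 7 (Var 19)))) (Emit (Var 19)))))"
  \<comment> \<open>After \<open>k\<close> rounds the vertices from \<open>np - k\<close> on are
    decoded and array 28 holds the code of the rest.\<close>
  let ?I = "\<lambda>k m b os. m 28 0 = set_encode (S \<inter> {..<np - k}) \<and> os = outputs s \<and>
    (\<forall>w<np. np - k \<le> w \<longrightarrow> m 8 w = (if w \<in> S then 1 else 0)) \<and> distinct b \<and> set b = S \<inter> {np - k..<np}"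
  have "wp (For 30 J ?C) ?post t"
    if t: "ready t" "imem t 28 0 = set_encode S" "buffer t = []" "outputs t = outputs s" "clock t \<le> clock s + 20" for t
  proof (rule wp_For[where I = ?I and N = np and t = 50])
    have "S \<inter> {..<np} = S" using S by blast
    then show "?I 0 (upd (imem t) 30 0 0) (buffer t) (outputs t)" using t by (simp add: upd_apply)
  next
    fix i u assume i: "i < np" "imem u 30 0 = i" and I: "?I i (imem u) (buffer u) (outputs u)" and fr: "frame (For 30 J ?C) t u"
    have ru: "ready u" by (rule ready_frame[OF fr t(1)]) simp_all
    define w where "w = np - 1 - i"
    have w: "w < np" "np - i = Suc w" "np - Suc i = w" using i by (auto simp: w_def)
    have p: "imem u 7 w = 2 ^ w" using ru w by (simp add: ready_def)
    have J: "imem u 0 0 = np" using inputs_np[OF ready_inputs[OF ru]] .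
    have fin: "finite (S \<inter> {..<w})" by simp
    \<comment> \<open>The lower digits together stay below \<open>2 ^ w\<close>, so one comparison
      with \<open>2 ^ w\<close> decides whether \<open>w\<close> belongs to the set.\<close>
    have lt: "set_encode (S \<inter> {..<w}) < 2 ^ w" by (rule set_encode_lt) simp
    have "imem u 28 0 = set_encode (S \<inter> {..<Suc w})" using I w by simp
    then have c: "imem u 28 0 = (if w \<in> S then 2 ^ w else 0) + set_encode (S \<inter> {..<w})"
      using fin by (simp add: lessThan_Suc)
    have set: "S \<inter> {w..<np} = (if w \<in> S then insert w (S \<inter> {Suc w..<np}) else S \<inter> {Suc w..<np})"
      using w(1) by (auto simp: Suc_le_eq le_less)
    have "wp ?C (\<lambda>u'. clock u' \<le> clock u + 50 \<and>
      (imem u' 28 0 = set_encode (S \<inter> {..<w}) \<and> outputs u' = outputs s \<and>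
        (\<forall>v<np. w \<le> v \<longrightarrow> imem u' 8 v = (if v \<in> S then 1 else 0)) \<and> distinct (buffer u') \<and>
        set (buffer u') = S \<inter> {w..<np})) u"
    proof -
      have I': "outputs u = outputs s" "distinct (buffer u)" "set (buffer u) = S \<inter> {Suc w..<np}"
        "\<And>v. v < np \<Longrightarrow> Suc w \<le> v \<Longrightarrow> imem u 8 v = (if v \<in> S then 1 else 0)"
        using I w(2) by auto
      have le: "w \<le> v \<longleftrightarrow> v = w \<or> Suc w \<le> v" for v by auto
      have pos: "np - Suc 0 - i = w" by (simp add: w_def)
      show ?thesis
      proof (cases "w \<in> S")
        case True
        then show ?thesis
          using i(2) J p c I' pos set by (simp add: upd_apply le)
      next
        case False
        then show ?thesis
          using i(2) J p c lt I' pos set by (simp add: upd_apply le)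
      qed
    qed
    then show "wp ?C (\<lambda>u'. clock u' \<le> clock u + 50 \<and>
      ?I (Suc i) (upd (imem u') 30 0 (Suc i)) (buffer u') (outputs u')) u"
      by (rule wp_conseq) (simp add: upd_apply w(3))
  next
    fix u :: state assume I: "?I np (imem u) (buffer u) (outputs u)" and c: "clock u \<le> clock t + (50 + 20) * Suc np"
    have "S \<inter> {0..<np} = S" using S by auto
    then show "?post u" using I c t(5) by (simp add: chars_def)
  qed (use t in \<open>auto simp: frame_def ready_def inputs_def\<close>)
  note loop = this
  show ?thesis
    unfolding DECODE_def wp_Seq wp_IWrite
    by (rule loop) (use s k b in \<open>auto simp: upd_apply\<close>)
qed

text \<open>Time is split at the output: its time \<open>c\<close> is bounded from the start of the
  visit, and the end of the visit from \<open>c\<close>. Thus the enumeration of neighbors is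
  charged to the gap after the output.\<close>

lemma wp_VISIT:
  assumes s: "ready s" and f: "found Ts (imem s)" and k: "imem s 26 0 = k" "k < length Ts" and b: "buffer s = []"
  shows "wp VISIT (\<lambda>s'. \<exists>zs c ns. ready s' \<and> found (Ts @ zs) (imem s') \<and> imem s' 26 0 = Suc k \<and> buffer s' = [] \<and>
    outputs s' = outputs s @ [(c, ns)] \<and> c \<le> clock s + 110 * Suc np \<and> distinct ns \<and> set ns = Ts ! k \<and>
    (\<forall>T. sol T \<and> T \<noteq> Ts ! k \<longrightarrow> (\<exists>S'\<in>set (Ts @ zs). prox (Ts ! k) T < prox S' T)) \<and>
    clock s' \<le> c + 31000 * work) s" (is "wp _ ?Q s")
proof -
  let ?S = "Ts ! k"
  have S: "sol ?S" using f k(2) by (simp add: found_def)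
  have cod: "imem s 25 k = set_encode ?S" using f k(2) by (simp add: found_def)
  show ?thesis
    unfolding VISIT_def
  proof (rule wp_SeqI[OF wp_DECODE[OF s k(1) cod sol_subset[OF S] b]])
    fix t assume t: "clock t \<le> clock s + 100 * Suc np \<and> chars (imem t) ?S \<and>
      distinct (buffer t) \<and> set (buffer t) = ?S \<and> outputs t = outputs s" and frt: "frame DECODE s t"
    have rt: "ready t" by (rule ready_frame[OF frt s]) simp_all
    have ft: "found Ts (imem t)" "imem t 26 0 = k" using f k frt by (simp_all add: found_def frame_def)
    define u where "u = t\<lparr>buffer := [], outputs := outputs t @ [(clock t + 1, buffer t)], clock := clock t + 1\<rparr>"
    have iu: "imem u = imem t" "clock u = clock t + 1" "buffer u = []" "outputs u = outputs t @ [(clock t + 1, buffer t)]"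
      by (simp_all add: u_def)
    have ru: "ready u" using rt by (simp add: u_def ready_def inputs_def)
    have "wp (Seq CONES (Seq (ALLNB ADDNEW) (IWrite 26 (INum 0) (IAdd (Var 26) (INum 1))))) ?Q u"
    proof (rule wp_SeqI[OF wp_CONES])
      show "ready u" "chars (imem u) ?S" "?S \<subseteq> {..<np}" "free ?S"
        using ru t S by (simp_all add: iu sol_def)
      fix v assume v: "clock v \<le> clock u + 400 * (Suc np * Suc nx) \<and> (?S \<noteq> {} \<longrightarrow> cones 9 10 (imem v) ?S)"
        and frv: "frame CONES u v"
      have rv: "ready v" by (rule ready_frame[OF frv ru]) simp_all
      have fv: "found Ts (imem v)" "imem v 26 0 = k" "chars (imem v) ?S"
        using ft t frv by (simp_all add: found_def frame_def iu chars_def)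
      have bv: "buffer v = buffer u" "outputs v = outputs u"
        using frv by (simp_all add: frame_def)
      have "wp (ALLNB ADDNEW) (\<lambda>s'. clock s' \<le> clock v + 30000 * (Suc np * Suc nx * (ne + Suc np * Suc nx)) \<and>
        (\<exists>zs. found (Ts @ zs) (imem s') \<and> Ball (set zs) sol \<and>
          (\<forall>v<np. P v \<notin> X_of I \<longrightarrow> (\<forall>y\<le>nx. \<exists>S'\<in>set (Ts @ zs). neighbor ?S v y S')))) v"
        by (rule wp_ALLNB[where R = "\<lambda>Ts m b os. found Ts m"])
          (use rv S fv v wp_ADDNEW found_cong in auto)
      then show "wp (Seq (ALLNB ADDNEW) (IWrite 26 (INum 0) (IAdd (Var 26) (INum 1)))) ?Q v"
      proof (rule wp_SeqI, elim conjE exE)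
        fix p zs assume p: "clock p \<le> clock v + 30000 * (Suc np * Suc nx * (ne + Suc np * Suc nx))"
          and z: "found (Ts @ zs) (imem p)"
            "\<forall>v<np. P v \<notin> X_of I \<longrightarrow> (\<forall>y\<le>nx. \<exists>S'\<in>set (Ts @ zs). neighbor ?S v y S')"
          and frp: "frame (ALLNB ADDNEW) v p"
        have rp: "ready p"
          by (rule ready_frame[OF frp rv]) simp_all
        have kp: "imem p 26 0 = k" "buffer p = buffer v" "outputs p = outputs v"
          using frp fv(2) by (simp_all add: frame_def)
        have "\<exists>S'\<in>set (Ts @ zs). prox ?S T < prox S' T" if "sol T" "T \<noteq> ?S" for T
          using proximity[OF S that(1)] that(2) z(2) by blast
        moreover have "found (Ts @ zs) (upd (imem p) 26 0 (Suc k))" using z(1) by (simp add: found_def upd_apply)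
        moreover have "clock p + 10 \<le> (clock t + 1) + 31000 * work"
          using p v iu(2) work_ge(2,5) unfolding work_def[symmetric] by linarith
        moreover have "clock t + 1 \<le> clock s + 110 * Suc np" using t by simp
        ultimately show "wp (IWrite 26 (INum 0) (IAdd (Var 26) (INum 1))) ?Q p"
          using rp kp bv iu t
          by (auto simp: upd_apply intro!: exI[of _ zs] exI[of _ "clock t + 1"] exI[of _ "buffer t"])
      qed
    qed
    then show "wp (Seq Flush (Seq CONES (Seq (ALLNB ADDNEW) (IWrite 26 (INum 0) (IAdd (Var 26) (INum 1)))))) ?Q t"
      by (simp only: wp_Seq wp_Flush u_def)
  qed
qed

text \<open>If \<open>T\<close> were missing, a member of \<open>Ts\<close> with largest proximity
  to \<open>T\<close> would contradict closure. No bound on the distance between solutions is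
  involved.\<close>

lemma all_found:
  assumes Ts: "Ts \<noteq> []" "Ball (set Ts) sol"
    and closed: "\<And>S T. S \<in> set Ts \<Longrightarrow> sol T \<Longrightarrow> T \<noteq> S \<Longrightarrow> \<exists>S'\<in>set Ts. prox S T < prox S' T"
  shows "set Ts = {T. sol T}"
proof -
  have "T \<in> set Ts" if T: "sol T" for T
  proof (rule ccontr)
    assume "T \<notin> set Ts"
    have "Max ((\<lambda>S. prox S T) ` set Ts) \<in> (\<lambda>S. prox S T) ` set Ts"
      using Ts(1) by (intro Max_in) auto
    then obtain S where S: "S \<in> set Ts" "prox S T = Max ((\<lambda>S. prox S T) ` set Ts)" by fastforce
    moreover have "T \<noteq> S" using S(1) \<open>T \<notin> set Ts\<close> by blast
    ultimately obtain S' where "S' \<in> set Ts" "prox S T < prox S' T" using closed[OF S(1) T] by blast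
    moreover have "prox S' T \<le> Max ((\<lambda>S. prox S T) ` set Ts)"
      using calculation(1) by (intro Max_ge) auto
    ultimately show False using S(2) by simp
  qed
  then show ?thesis using Ts(2) by blast
qed

lemma represents_iff: "represents hull_problem I ns S \<longleftrightarrow> distinct ns \<and> set ns \<subseteq> {..<np} \<and> S = P ` set ns"
  by (auto simp: represents_def hull_problem_def)

lemma outputs_setsI:
  assumes "list_all2 (\<lambda>ns T. distinct ns \<and> set ns = T) (map snd (outputs s)) Ts" "Ball (set Ts) sol"
  shows "outputs_sets hull_problem I s (map ((`) P) Ts)"
  using assms sol_subset unfolding outputs_sets_def list_all2_conv_all_nth represents_iff by auto

lemma init_inputs: "inputs (init_state (inp hull_problem I))"
  "inputs (init_state (inp_with hull_problem I ns))"
  by (auto simp: inputs_def init_state_def load_def hull_problem_def inp_with_def eval_nat_numeral)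

lemma init_zero: "3 \<le> a \<Longrightarrow> imem (init_state (inp hull_problem I)) a = (\<lambda>i. 0)"
  by (auto simp: init_state_def load_def hull_problem_def)

lemma listing_run:
  "\<exists>s. exec LISTING (init_state (inp hull_problem I)) s \<and> lists_solutions hull_problem I s \<and> delay s \<le> 50000 * work"
proof -
  let ?s0 = "init_state (inp hull_problem I)"
  \<comment> \<open>Covers up to \<open>40000 * work\<close> since the last output, one evaluation
    of the loop guard, and the decoding of the next item.\<close>
  let ?B = "50000 * work"
  let ?times = "\<lambda>s. 0 # map fst (outputs s)"
  let ?Q = "\<lambda>s. lists_solutions hull_problem I s \<and> delay s \<le> ?B"
  let ?closed = "\<lambda>Ts k. \<forall>i<k. \<forall>T. sol T \<and> T \<noteq> Ts ! i \<longrightarrow>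
    (\<exists>S'\<in>set Ts. prox (Ts ! i) T < prox S' T)"
  let ?listed = "\<lambda>s Ts k. list_all2 (\<lambda>ns T. distinct ns \<and> set ns = T) (map snd (outputs s)) (take k Ts)"
  let ?I = "\<lambda>s. ready s \<and> buffer s = [] \<and> (\<exists>Ts k. found Ts (imem s) \<and> Ts \<noteq> [] \<and> imem s 26 0 = k \<and> k \<le> length Ts \<and>
    ?listed s Ts k \<and>
    ?closed Ts k) \<and>
    successively (\<lambda>a b. b \<le> a + ?B) (?times s) \<and> clock s \<le> last (?times s) + 40000 * work"
  \<comment> \<open>The enqueued solutions are distinct, so the head of the queue is bounded by the
    number of solutions; this gives termination.\<close>
  have card: "length Ts \<le> card {T. sol T}" if "found Ts m" for Ts m
  proof -
    have "card (set Ts) \<le> card {T. sol T}" using that by (intro card_mono finite_sols) (auto simp: found_def)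
    then show ?thesis using that by (simp add: found_def distinct_card)
  qed
  have loop: "wp (While (ILess (Var 26) (Var 27)) VISIT) ?Q s" if "?I s" for s
  proof (rule wp_While[where I = ?I and \<mu> = "\<lambda>s. card {T. sol T} - imem s 26 0", OF that])
    fix s assume I: "?I s" and b: "bval (ILess (Var 26) (Var 27)) s"
    from I obtain Ts k where r: "ready s" "buffer s = []" and f: "found Ts (imem s)" "Ts \<noteq> []" "imem s 26 0 = k" "k \<le> length Ts"
      and o: "?listed s Ts k"
      and cl: "?closed Ts k"
      and gap: "successively (\<lambda>a b. b \<le> a + ?B) (?times s)" and c: "clock s \<le> last (?times s) + 40000 * work"
      by blast
    have k: "k < length Ts" using b f by (simp add: found_def)
    let ?t = "s\<lparr>clock := clock s + (1 + bcost (ILess (Var 26) (Var 27)))\<rparr>"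
    show "wp VISIT (\<lambda>s'. ?I s' \<and> card {T. sol T} - imem s' 26 0 < card {T. sol T} - imem s 26 0) ?t"
    proof (rule wp_conseq[OF wp_VISIT[of ?t Ts k]], goal_cases)
      case (6 s')
      then obtain zs d ns where s': "ready s'" "found (Ts @ zs) (imem s')" "imem s' 26 0 = Suc k" "buffer s' = []"
        and o': "outputs s' = outputs s @ [(d, ns)]" and d: "d \<le> clock s + 6 + 110 * Suc np" "distinct ns" "set ns = Ts ! k"
        and p: "\<forall>T. sol T \<and> T \<noteq> Ts ! k \<longrightarrow> (\<exists>S'\<in>set (Ts @ zs). prox (Ts ! k) T < prox S' T)"
        and c': "clock s' \<le> d + 31000 * work" by auto
      have "?listed s' (Ts @ zs) (Suc k)"
        using o d k by (simp add: o' take_Suc_conv_app_nth list_all2_appendI)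
      moreover have "?closed (Ts @ zs) (Suc k)"
      proof (intro allI impI)
        fix i T assume i: "i < Suc k" and T: "sol T \<and> T \<noteq> (Ts @ zs) ! i"
        have eq: "(Ts @ zs) ! i = Ts ! i" using i k by (simp add: nth_append)
        show "\<exists>S'\<in>set (Ts @ zs). prox ((Ts @ zs) ! i) T < prox S' T"
        proof (cases "i = k")
          case True
          then show ?thesis using p T unfolding eq by blast
        next
          case False
          then have "i < k" using i by simp
          then obtain S' where "S' \<in> set Ts" "prox (Ts ! i) T < prox S' T" using cl T unfolding eq by blast
          then show ?thesis unfolding eq by auto
        qed
      qed
      moreover have "successively (\<lambda>a b. b \<le> a + ?B) (?times s')"
      proof -
        have "110 * Suc np \<le> 110 * work" using work_ge(3) by (rule mult_le_mono2)
        then have "d \<le> clock s + 6 + 110 * work" using d(1) by simp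
        also have "\<dots> \<le> (last (?times s) + 40000 * work) + 6 + 110 * work"
          using c by (intro add_right_mono)
        also have "\<dots> \<le> last (?times s) + ?B" using work_ge(5) by simp
        finally have "d \<le> last (?times s) + ?B" .
        then show ?thesis
          using gap by (simp only: o' map_append append_Cons[symmetric] successively_append_iff) simp
      qed
      moreover have "clock s' \<le> last (?times s') + 40000 * work" using c' by (simp add: o')
      moreover have "card {T. sol T} - imem s' 26 0 < card {T. sol T} - imem s 26 0"
        using card[OF s'(2)] k s'(3) f(3) by simp
      ultimately show ?case using s' f(2) k by (intro conjI exI[of _ "Ts @ zs"] exI[of _ "Suc k"]) auto
    qed (use r f k in auto)
  next
    fix s assume I: "?I s" and b: "\<not> bval (ILess (Var 26) (Var 27)) s"
    from I obtain Ts k where f: "found Ts (imem s)" "Ts \<noteq> []" "imem s 26 0 = k" "k \<le> length Ts"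
      and o: "?listed s Ts k"
      and cl: "?closed Ts k"
      and gap: "successively (\<lambda>a b. b \<le> a + ?B) (?times s)" and c: "clock s \<le> last (?times s) + 40000 * work"
      by blast
    let ?t = "s\<lparr>clock := clock s + (1 + bcost (ILess (Var 26) (Var 27)))\<rparr>"
    have k: "k = length Ts" using b f by (simp add: found_def)
    have Ts: "Ball (set Ts) sol" "distinct Ts" using f(1) by (simp_all add: found_def)
    have all: "set Ts = {T. sol T}"
      by (rule all_found[OF f(2) Ts(1)]) (use cl k in \<open>auto simp: in_set_conv_nth\<close>)
    have "outputs_sets hull_problem I ?t (map ((`) P) Ts)"
      by (rule outputs_setsI) (use o k Ts in auto)
    moreover have "inj_on ((`) P) (set Ts)"
    proof (rule inj_onI)
      fix A B assume "A \<in> set Ts" "B \<in> set Ts" "P ` A = P ` B"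
      then show "A = B" using inj_on_image_eq_iff[OF inj_P, of A B] Ts(1) sol_subset by blast
    qed
    then have "distinct (map ((`) P) Ts)" using Ts(2) by (simp add: distinct_map)
    moreover have "set (map ((`) P) Ts) = solutions hull_problem I" by (simp add: all solutions_eq)
    ultimately have "lists_solutions hull_problem I ?t" unfolding lists_solutions_def by blast
    moreover have "clock ?t \<le> last (?times s) + ?B" using c work_ge(5) by simp
    then have "successively (\<lambda>a b. b \<le> a + ?B) (0 # map fst (outputs ?t) @ [clock ?t])"
      using gap by (simp only: append_Cons[symmetric] successively_append_iff) simp
    then have "delay ?t \<le> ?B" by (rule delay_le)
    ultimately show "?Q ?t" by blast
  qed
  have "wp LISTING ?Q ?s0"
    unfolding LISTING_def
  proof (rule wp_SeqI[OF wp_SETUP[OF init_inputs(1)]])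
    fix t assume t: "clock t \<le> clock ?s0 + 300 * (ne + Suc np) \<and> ready t" and frt: "frame SETUP ?s0 t"
    have zt: "imem t a = (\<lambda>i. 0)" if "24 \<le> a \<and> a < 30" for a
      using that init_zero[of a] frame_imem[OF frt, of a] by simp
    have bt: "buffer t = []" "outputs t = []"
      using frame_buffer[OF frt] frame_outputs[OF frt] by (simp_all add: init_state_def)
    have rt: "ready t" using t by simp
    show "wp (Seq FINDONE (Seq ADDNEW (While (ILess (Var 26) (Var 27)) VISIT))) ?Q t"
    proof (rule wp_SeqI[OF wp_FINDONE[OF rt]], elim conjE exE)
      fix u qs assume u: "clock u \<le> clock t + 3000 * (Suc np * (ne + Suc np * Suc nx))"
        and q: "queue (imem u) qs" "distinct qs" "sol (set qs)" and fru: "frame FINDONE t u"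
      have ru: "ready u" by (rule ready_frame[OF fru rt]) simp_all
      have zu: "imem u a = (\<lambda>i. 0)" if "24 \<le> a \<and> a < 30" for a
        using that zt[of a] frame_imem[OF fru, of a] by simp
      have bu: "buffer u = []" "outputs u = []"
        using frame_buffer[OF fru] frame_outputs[OF fru] bt by simp_all
      have "found [] (imem u)" using zu by (simp add: found_def)
      then show "wp (Seq ADDNEW (While (ILess (Var 26) (Var 27)) VISIT)) ?Q u"
      proof (rule wp_SeqI[OF wp_ADDNEW[OF ru _ q]], elim conjE exE)
        fix v zs assume v: "clock v \<le> clock u + 500 * Suc np" and z: "found ([] @ zs) (imem v)" "set qs \<in> set ([] @ zs)"
          and frv: "frame ADDNEW u v"
        have rv: "ready v" by (rule ready_frame[OF frv ru]) simp_all
        have bv: "buffer v = []" "outputs v = []" "imem v 26 0 = 0"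
          using frv bu zu by (simp_all add: frame_def)
        have "clock ?s0 = 0" by (simp add: init_state_def)
        then have "clock v \<le> 40000 * work"
          using v u conjunct1[OF t] mult_le_mono2[OF work_ge(3), of 500] mult_le_mono2[OF work_ge(4), of 3000] work_ge(6)
          by linarith
        then have "?I v" using rv bv z by (intro conjI exI[of _ zs] exI[of _ 0]) auto
        then show "wp (While (ILess (Var 26) (Var 27)) VISIT) ?Q v" by (rule loop)
      qed
    qed
  qed
  then show ?thesis unfolding wp_def by blast
qed

end

section \<open>Proximity searchability\<close>

definition FINDING :: com where
  "FINDING = Seq SETUP (Seq FINDONE EMITQ)"

text \<open>\<open>inp_with\<close> puts the length and the elements of the given list behind the
  three integer arrays of the instance, that is, into arrays 3 and 4.\<close>

definition LOADS :: com where
  "LOADS = For 31 (IRead 3 (INum 0)) (IWrite 8 (IRead 4 (Var 31)) (INum 1))"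

definition NEIGHBORS :: com where
  "NEIGHBORS = Seq SETUP (Seq CONES (ALLNB EMITQ))"

lemma reads_NEIGHBORS: "reads NEIGHBORS \<subseteq> - {3, 4, 31}"
  by (simp add: NEIGHBORS_def SETUP_def ENDS_def ARC_def POWERS_def ALLNB_def EMITQ_def search_defs step_defs
      conflict_def Let_def fits_e_def pos_def neg_def rorient_def rpinner_def pt_def ob_def)

text \<open>The function is defined by the program itself, as the union of its outputs over all
  presentations of \<open>S\<close>. Order independence will show that a single run already produces
  the whole union.\<close>

definition nb_sets :: "hull_instance \<Rightarrow> point set \<Rightarrow> point set set" where
  "nb_sets I S = {S'. \<exists>ns s Ss. represents hull_problem I ns S \<and>
    exec (Seq LOADS NEIGHBORS) (init_state (inp_with hull_problem I ns)) s \<and>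
    outputs_sets hull_problem I s Ss \<and> S' \<in> set Ss}"

context hull_inst
begin

definition index_set :: "point set \<Rightarrow> nat set" where
  "index_set S = {k. k < np \<and> P k \<in> S}"

text \<open>Any largest connected common subset would do, since proximity searchability compares
  cardinalities only.\<close>

definition common :: "point set \<Rightarrow> point set \<Rightarrow> point set" where
  "common S T = P ` (SOME C. C \<subseteq> index_set S \<inter> index_set T \<and> induces_connected E C \<and>
    card C = prox (index_set S) (index_set T))"

lemma index_set_image: "T \<subseteq> {..<np} \<Longrightarrow> index_set (P ` T) = T"
  using inj_P by (auto simp: index_set_def inj_on_def)

lemma common:
  shows "common S T \<subseteq> universe hull_problem I"
    and "card (common S T) = prox (index_set S) (index_set T)"
proof -
  define C where "C = (SOME C. C \<subseteq> index_set S \<inter> index_set T \<and> induces_connected E C \<and>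
    card C = prox (index_set S) (index_set T))"
  have fin: "finite (index_set S)" by (simp add: index_set_def)
  have "C \<subseteq> index_set S \<inter> index_set T \<and> induces_connected E C \<and> card C = prox (index_set S) (index_set T)"
    unfolding C_def by (rule someI_ex) (use prox_attained[OF fin] in metis)
  then have C: "C \<subseteq> {..<np}" "card C = prox (index_set S) (index_set T)" by (auto simp: index_set_def)
  have eq: "common S T = P ` C" by (simp add: common_def C_def)
  show "common S T \<subseteq> universe hull_problem I"
    unfolding eq universe_def using C(1) by (auto simp: hull_problem_def)
  show "card (common S T) = prox (index_set S) (index_set T)"
    unfolding eq using C card_image inj_on_subset[OF inj_P] by metis
qed

lemma finding_run:
  "\<exists>s S. exec FINDING (init_state (inp hull_problem I)) s \<and> outputs_sets hull_problem I s [S] \<and>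
    S \<in> solutions hull_problem I \<and> clock s \<le> 4000 * work"
proof -
  let ?s0 = "init_state (inp hull_problem I)"
  let ?Q = "\<lambda>s. (\<exists>S. outputs_sets hull_problem I s [S] \<and> S \<in> solutions hull_problem I) \<and> clock s \<le> 4000 * work"
  have "wp FINDING ?Q ?s0"
    unfolding FINDING_def
  proof (rule wp_SeqI[OF wp_SETUP[OF init_inputs(1)]], elim conjE)
    fix t assume t: "clock t \<le> clock ?s0 + 300 * (ne + Suc np)" and rt: "ready t" and frt: "frame SETUP ?s0 t"
    have bt: "buffer t = []" "outputs t = []"
      using frame_buffer[OF frt] frame_outputs[OF frt] by (simp_all add: init_state_def)
    show "wp (Seq FINDONE EMITQ) ?Q t"
    proof (rule wp_SeqI[OF wp_FINDONE[OF rt]], elim conjE exE)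
      fix u qs assume u: "clock u \<le> clock t + 3000 * (Suc np * (ne + Suc np * Suc nx))"
        and q: "queue (imem u) qs" "distinct qs" "sol (set qs)" and fru: "frame FINDONE t u"
      have bu: "buffer u = []" "outputs u = []"
        using frame_buffer[OF fru] frame_outputs[OF fru] bt by simp_all
      show "wp EMITQ ?Q u"
      proof (rule wp_conseq[OF wp_EMITQ[OF q(1)]], elim conjE)
        fix s :: state assume s: "clock s \<le> clock u + 40 * Suc (length qs)"
          and o: "map snd (outputs s) = map snd (outputs u) @ [buffer u @ qs]"
        have "outputs_sets hull_problem I s (map ((`) P) [set qs])"
          by (rule outputs_setsI) (use o bu q in auto)
        then have "outputs_sets hull_problem I s [P ` set qs]" by simp
        moreover have "P ` set qs \<in> solutions hull_problem I" using q(3) by (simp add: solutions_eq)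
        moreover have "clock ?s0 = 0" by (simp add: init_state_def)
        then have "clock s \<le> 4000 * work"
          using s u t mult_le_mono2[OF Suc_le_mono[THEN iffD2, OF length_le_np[OF q(2) sol_subset[OF q(3)]]], of 40]
            mult_le_mono2[OF work_ge(3), of 40] mult_le_mono2[OF work_ge(4), of 3000] work_ge(6)
          by linarith
        ultimately show "?Q s" by blast
      qed
    qed
  qed
  then show ?thesis unfolding wp_def by blast
qed

lemma load_append: "a < length xss \<Longrightarrow> load (xss @ yss) a = load xss a"
  by (rule ext) (simp add: load_def nth_append)

lemma init_with:
  shows "imem (init_state (inp_with hull_problem I ns)) 3 0 = length ns"
    and "i < length ns \<Longrightarrow> imem (init_state (inp_with hull_problem I ns)) 4 i = ns ! i"
    and "5 \<le> a \<Longrightarrow> imem (init_state (inp_with hull_problem I ns)) a = (\<lambda>i. 0)"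
    and "a < 3 \<Longrightarrow> imem (init_state (inp_with hull_problem I ns)) a = imem (init_state (inp hull_problem I)) a"
proof -
  let ?xss = "fst (inp hull_problem I)"
  have len: "length ?xss = 3" by (simp add: hull_problem_def)
  have eq: "imem (init_state (inp_with hull_problem I ns)) = load (?xss @ [[length ns], ns])"
    by (simp add: init_state_def inp_with_def)
  show "imem (init_state (inp_with hull_problem I ns)) 3 0 = length ns"
    "i < length ns \<Longrightarrow> imem (init_state (inp_with hull_problem I ns)) 4 i = ns ! i"
    "5 \<le> a \<Longrightarrow> imem (init_state (inp_with hull_problem I ns)) a = (\<lambda>i. 0)"
    unfolding eq by (auto simp: load_def len nth_append)
  show "a < 3 \<Longrightarrow> imem (init_state (inp_with hull_problem I ns)) a = imem (init_state (inp hull_problem I)) a"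
    unfolding eq by (simp add: init_state_def load_append len)
qed

lemma wp_LOADS:
  assumes s: "imem s 3 0 = length ns" "\<And>i. i < length ns \<Longrightarrow> imem s 4 i = ns ! i" "imem s 8 = (\<lambda>i. 0)"
  shows "wp LOADS (\<lambda>s'. clock s' \<le> clock s + (10 + 20) * Suc (length ns) \<and>
    imem s' 8 = (\<lambda>w. if w \<in> set ns then 1 else 0)) s"
  unfolding LOADS_def
proof (rule wp_conseq[OF wp_For'[where I = "\<lambda>k m. m 8 = (\<lambda>w. if w \<in> set (take k ns) then 1 else 0)"
      and N = "length ns" and t = 10]])
  fix k and s' :: state
  assume k: "k < length ns" and I: "imem s' 8 = (\<lambda>w. if w \<in> set (take k ns) then 1 else 0)" and x: "imem s' 31 0 = k"
    and fr: "frame (For 31 (IRead 3 (INum 0)) (IWrite 8 (IRead 4 (Var 31)) (INum 1))) s s'"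
  have "imem s' 4 k = ns ! k" using fr s k by (simp add: frame_def)
  then show "wp (IWrite 8 (IRead 4 (Var 31)) (INum 1)) (\<lambda>s''. clock s'' \<le> clock s' + 10 \<and>
    upd (imem s'') 31 0 (Suc k) 8 = (\<lambda>w. if w \<in> set (take (Suc k) ns) then 1 else 0)) s'"
    using k x I by (auto simp: upd_apply take_Suc_conv_app_nth)
qed (use s in \<open>auto simp: frame_def upd_apply\<close>)

lemma neighbors_run:
  assumes "represents hull_problem I ns (P ` S)" "sol S"
  shows "\<exists>s Ts. exec (Seq LOADS NEIGHBORS) (init_state (inp_with hull_problem I ns)) s \<and>
    outputs_sets hull_problem I s (map ((`) P) Ts) \<and> Ball (set Ts) sol \<and>
    (\<forall>v<np. P v \<notin> X_of I \<longrightarrow> (\<forall>y\<le>nx. \<exists>S'\<in>set Ts. neighbor S v y S')) \<and> clock s \<le> 40000 * work"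
proof -
  let ?s0 = "init_state (inp_with hull_problem I ns)"
  let ?Q = "\<lambda>s. \<exists>Ts. outputs_sets hull_problem I s (map ((`) P) Ts) \<and> Ball (set Ts) sol \<and>
    (\<forall>v<np. P v \<notin> X_of I \<longrightarrow> (\<forall>y\<le>nx. \<exists>S'\<in>set Ts. neighbor S v y S')) \<and> clock s \<le> 40000 * work"
  have ns: "distinct ns" "set ns \<subseteq> {..<np}" "P ` set ns = P ` S"
    using assms(1) by (auto simp: represents_iff)
  then have S: "set ns = S"
    using inj_on_image_eq_iff[OF inj_P ns(2) sol_subset[OF assms(2)]] by simp
  have "wp (Seq LOADS NEIGHBORS) ?Q ?s0"
  proof (rule wp_SeqI[OF wp_LOADS])
    show "imem ?s0 3 0 = length ns" "\<And>i. i < length ns \<Longrightarrow> imem ?s0 4 i = ns ! i" "imem ?s0 8 = (\<lambda>i. 0)"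
      by (simp_all add: init_with)
    fix r assume "clock r \<le> clock ?s0 + (10 + 20) * Suc (length ns) \<and>
      imem r 8 = (\<lambda>w. if w \<in> set ns then 1 else 0)" and frr: "frame LOADS ?s0 r"
    then have r: "clock r \<le> clock ?s0 + 30 * Suc (length ns)"
      "imem r 8 = (\<lambda>w. if w \<in> set ns then 1 else 0)" by auto
    have ir: "inputs r" by (rule inputs_frame[OF frr init_inputs(2)]) (simp_all add: LOADS_def)
    have br: "buffer r = []" "outputs r = []"
      using frr by (simp_all add: frame_def LOADS_def init_state_def)
    show "wp NEIGHBORS ?Q r"
      unfolding NEIGHBORS_def
    proof (rule wp_SeqI[OF wp_SETUP[OF ir]], elim conjE)
      fix t assume t: "clock t \<le> clock r + 300 * (ne + Suc np)" and rt: "ready t" and frt: "frame SETUP r t"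
      have bt: "buffer t = []" "outputs t = []"
        using frame_buffer[OF frt] frame_outputs[OF frt] br by simp_all
      have ct: "chars (imem t) S" using frt r(2) S by (simp add: chars_def frame_def)
      show "wp (Seq CONES (ALLNB EMITQ)) ?Q t"
      proof (rule wp_SeqI[OF wp_CONES[OF rt ct sol_subset[OF assms(2)]]])
        show "free S" using assms(2) by (simp add: sol_def)
        fix u assume "clock u \<le> clock t + 400 * (Suc np * Suc nx) \<and> (S \<noteq> {} \<longrightarrow> cones 9 10 (imem u) S)"
          and fru: "frame CONES t u"
        then have u: "clock u \<le> clock t + 400 * (Suc np * Suc nx)" "S \<noteq> {} \<longrightarrow> cones 9 10 (imem u) S" by auto
        have ru: "ready u" by (rule ready_frame[OF fru rt]) simp_all
        have bu: "buffer u = []" "outputs u = []"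
          using frame_buffer[OF fru] frame_outputs[OF fru] bt by simp_all
        have cu: "chars (imem u) S" using fru ct by (simp add: chars_def frame_def)
        \<comment> \<open>Every neighbor is output at once, repetitions included, so the record of
          the consumer is the output itself.\<close>
        let ?R = "\<lambda>Ts m b os. b = [] \<and> list_all2 (\<lambda>ns T. distinct ns \<and> set ns = T) (map snd (os :: (nat \<times> nat list) list)) Ts"
        have "wp (ALLNB EMITQ) (\<lambda>s'. clock s' \<le> clock u + 30000 * (Suc np * Suc nx * (ne + Suc np * Suc nx)) \<and>
          (\<exists>zs. ?R ([] @ zs) (imem s') (buffer s') (outputs s') \<and> Ball (set zs) sol \<and>
            (\<forall>v<np. P v \<notin> X_of I \<longrightarrow> (\<forall>y\<le>nx. \<exists>S'\<in>set ([] @ zs). neighbor S v y S')))) u"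
        proof (rule wp_ALLNB[OF ru assms(2) cu u(2), where R = ?R])
          show "?R [] (imem u) (buffer u) (outputs u)" using bu by simp
          fix Ts and p :: state and qs assume p: "?R Ts (imem p) (buffer p) (outputs p)"
            and q: "queue (imem p) qs" "distinct qs" "sol (set qs)"
          show "wp EMITQ (\<lambda>t'. clock t' \<le> clock p + 500 * Suc np \<and>
            (\<exists>zs. ?R (Ts @ zs) (imem t') (buffer t') (outputs t') \<and> set qs \<in> set (Ts @ zs) \<and> set zs \<subseteq> {set qs})) p"
            by (rule wp_conseq[OF wp_EMITQ[OF q(1)]])
              (use p q length_le_np[OF q(2) sol_subset[OF q(3)]] in
                \<open>auto intro!: exI[of _ "[set qs]"] list_all2_appendI\<close>)
        qed simp_all
        then show "wp (ALLNB EMITQ) ?Q u"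
        proof (rule wp_conseq, elim conjE exE)
          fix s :: state and Ts assume s: "clock s \<le> clock u + 30000 * (Suc np * Suc nx * (ne + Suc np * Suc nx))"
            and Ts: "list_all2 (\<lambda>ns T. distinct ns \<and> set ns = T) (map snd (outputs s)) ([] @ Ts)" "Ball (set Ts) sol"
              "\<forall>v<np. P v \<notin> X_of I \<longrightarrow> (\<forall>y\<le>nx. \<exists>S'\<in>set ([] @ Ts). neighbor S v y S')"
          have "clock ?s0 = 0" by (simp add: init_state_def)
          then have "clock s \<le> 40000 * work"
            using s u(1) t r(1) mult_le_mono2[OF Suc_le_mono[THEN iffD2, OF length_le_np[OF ns(1,2)]], of 30]
              mult_le_mono2[OF work_ge(2), of 400] mult_le_mono2[OF work_ge(3), of 30] work_ge(6)
            unfolding work_def[symmetric] by linarith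
          then show "?Q s" using Ts outputs_setsI[of s Ts] by auto
        qed
      qed
    qed
  qed
  then show ?thesis unfolding wp_def by blast
qed

text \<open>
  For two presentations of the same set, the states after \<open>LOADS\<close> differ at most in arrays 3, 4 and 31,
  which the rest of the program does not read.
\<close>

lemma neighbors_order_independent:
  assumes "represents hull_problem I ns S" "represents hull_problem I ns' S"
    and e: "exec (Seq LOADS NEIGHBORS) (init_state (inp_with hull_problem I ns)) s"
      "exec (Seq LOADS NEIGHBORS) (init_state (inp_with hull_problem I ns')) s'"
  shows "map snd (outputs s) = map snd (outputs s')"
proof -
  let ?i = "\<lambda>ns. init_state (inp_with hull_problem I ns)"
  have set: "set ns = set ns'"
    using assms(1,2) inj_on_image_eq_iff[OF inj_P, of "set ns" "set ns'"] by (simp add: represents_iff)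
  obtain r r' where r: "exec LOADS (?i ns) r" "exec NEIGHBORS r s" and r': "exec LOADS (?i ns') r'" "exec NEIGHBORS r' s'"
    using e by (elim SeqE) blast
  have chars: "imem t 8 = (\<lambda>w. if w \<in> set l then 1 else 0)" if "exec LOADS (?i l) t" for l t
  proof -
    have "wp LOADS (\<lambda>s'. clock s' \<le> clock (?i l) + (10 + 20) * Suc (length l) \<and>
      imem s' 8 = (\<lambda>w. if w \<in> set l then 1 else 0)) (?i l)"
      by (rule wp_LOADS) (simp_all add: init_with)
    then show ?thesis using exec_deterministic[OF that] unfolding wp_def by blast
  qed
  have "agree (- {3, 4, 31}) r r'"
    unfolding agree_def
  proof (intro conjI ballI)
    have fr: "frame LOADS (?i ns) r" "frame LOADS (?i ns') r'" using r(1) r'(1) by (simp_all add: exec_frame)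
    fix a :: nat assume a: "a \<in> - {3, 4, 31}"
    show "imem r a = imem r' a"
    proof (cases "a = 8")
      case True
      then show ?thesis using chars[OF r(1)] chars[OF r'(1)] set by simp
    next
      case False
      then have "imem r a = imem (?i ns) a" "imem r' a = imem (?i ns') a"
        using fr a by (simp_all add: frame_def LOADS_def)
      moreover have "a < 3 \<or> 5 \<le> a" using a by auto
      ultimately show ?thesis by (auto simp: init_with)
    qed
  next
    have fr: "frame LOADS (?i ns) r" "frame LOADS (?i ns') r'" using r(1) r'(1) by (simp_all add: exec_frame)
    then show "rmem r = rmem r'" "buffer r = buffer r'" "map snd (outputs r) = map snd (outputs r')"
      by (simp_all add: frame_def LOADS_def init_state_def inp_with_def)
  qed
  then obtain t where "exec NEIGHBORS r' t" "agree (- {3, 4, 31}) s t"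
    using exec_agree[OF r(2) reads_NEIGHBORS] by blast
  then show ?thesis using exec_deterministic[OF r'(2)] by (simp add: agree_def)
qed

lemma outputs_sets_unique:
  assumes "outputs_sets hull_problem I s Ss" "outputs_sets hull_problem I s' Ss'"
    "map snd (outputs s) = map snd (outputs s')"
  shows "Ss = Ss'"
  using assms unfolding outputs_sets_def list_all2_conv_all_nth
  by (intro nth_equalityI) (auto simp: represents_def)

lemma nb_sets_eq:
  assumes "represents hull_problem I ns S"
    "exec (Seq LOADS NEIGHBORS) (init_state (inp_with hull_problem I ns)) s" "outputs_sets hull_problem I s Ss"
  shows "nb_sets I S = set Ss"
proof
  show "set Ss \<subseteq> nb_sets I S" using assms unfolding nb_sets_def by blast
  show "nb_sets I S \<subseteq> set Ss"
  proof
    fix S' assume "S' \<in> nb_sets I S"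
    then obtain ns' s' Ss' where "represents hull_problem I ns' S" "outputs_sets hull_problem I s' Ss'" "S' \<in> set Ss'"
      "exec (Seq LOADS NEIGHBORS) (init_state (inp_with hull_problem I ns')) s'" unfolding nb_sets_def by blast
    then show "S' \<in> set Ss"
      using outputs_sets_unique[OF assms(3)] neighbors_order_independent[OF assms(1) _ assms(2)] by metis
  qed
qed

lemma represents_exists:
  assumes "sol S"
  shows "represents hull_problem I (sorted_list_of_set S) (P ` S)"
  using assms sol_subset sol_finite by (simp add: represents_iff)

lemma nb_sets_proximity:
  assumes "S \<in> solutions hull_problem I"
  shows "nb_sets I S \<subseteq> solutions hull_problem I"
    and "T \<in> solutions hull_problem I \<Longrightarrow> S \<noteq> T \<Longrightarrow>
      \<exists>S'\<in>nb_sets I S. card (common S T) < card (common S' T)"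
proof -
  obtain S0 where S0: "sol S0" "S = P ` S0" using assms by (auto simp: solutions_eq)
  obtain s Ts where r: "exec (Seq LOADS NEIGHBORS) (init_state (inp_with hull_problem I (sorted_list_of_set S0))) s"
    "outputs_sets hull_problem I s (map ((`) P) Ts)" "Ball (set Ts) sol"
    "\<forall>v<np. P v \<notin> X_of I \<longrightarrow> (\<forall>y\<le>nx. \<exists>S'\<in>set Ts. neighbor S0 v y S')"
    using neighbors_run[OF represents_exists[OF S0(1)] S0(1)] by blast
  have nb: "nb_sets I S = (`) P ` set Ts"
    unfolding S0(2) using nb_sets_eq[OF represents_exists[OF S0(1)] r(1,2)] by simp
  show "nb_sets I S \<subseteq> solutions hull_problem I" using r(3) by (auto simp: nb solutions_eq)
  assume "T \<in> solutions hull_problem I" "S \<noteq> T"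
  then obtain T0 where T0: "sol T0" "T = P ` T0" "S0 \<noteq> T0" using S0 by (auto simp: solutions_eq)
  obtain S' where S': "S' \<in> set Ts" "prox S0 T0 < prox S' T0"
    using proximity[OF S0(1) T0(1,3)] r(4) by blast
  have "sol S'" using S'(1) r(3) by blast
  then have "card (common S T) < card (common (P ` S') T)"
    using S'(2) S0 T0 sol_subset by (simp add: common(2) index_set_image)
  then show "\<exists>S'\<in>nb_sets I S. card (common S T) < card (common S' T)"
    unfolding nb using S'(1) by blast
qed

lemma work_le_power: "work \<le> 2 * (1 + (np + nx)) ^ 4"
proof -
  let ?N = "1 + (np + nx)"
  have a: "Suc np \<le> ?N" "Suc nx \<le> ?N" by simp_all
  have 1: "Suc np * Suc nx \<le> ?N * ?N" by (rule mult_le_mono[OF a])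
  have "ne \<le> ?N * ?N" using ne_le mult_le_mono[of np ?N np ?N] by linarith
  with 1 have "ne + Suc np * Suc nx \<le> 2 * (?N * ?N)" by linarith
  then have "work \<le> (?N * ?N) * (2 * (?N * ?N))"
    unfolding work_def by (rule mult_le_mono[OF 1])
  also have "\<dots> = 2 * ?N ^ 4" by (simp only: power4_eq_xxxx mult_ac)
  finally show ?thesis .
qed

text \<open>With at least one point and one obstacle each successor at most doubles its argument.
  This costs a factor 4 in each of two places; the logarithm is nonnegative.\<close>

lemma work_le_delay_bound:
  assumes "1 \<le> np" "1 \<le> nx"
  shows "real work \<le> 16 * delay_bound np nx ne"
proof -
  have "Suc np * Suc nx \<le> (2 * np) * (2 * nx)" by (rule mult_le_mono) (use assms in auto)
  then have 1: "Suc np * Suc nx \<le> 4 * (np * nx)" by simp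
  have "work \<le> (4 * (np * nx)) * (ne + 4 * (np * nx))"
    unfolding work_def by (rule mult_le_mono[OF 1]) (use 1 in simp)
  also have "\<dots> \<le> 4 * (np * nx) * (4 * (ne + np * nx))"
    by (rule mult_le_mono2) simp
  finally have "real work \<le> real (16 * (np * nx * (ne + np * nx)))"
    by (simp only: of_nat_le_iff)
  also have "\<dots> = 16 * (real np * real nx * (real ne + real np * real nx))" by simp
  also have "\<dots> \<le> 16 * delay_bound np nx ne"
  proof -
    have log: "0 \<le> log 2 (real np)"
      by (subst zero_le_log_cancel_iff) (use assms(1) in auto)
    then have "real np * real nx \<le> real np * (real nx + log 2 (real np))"
      by (intro mult_left_mono) auto
    then show ?thesis unfolding delay_bound_def using log by (intro mult_left_mono add_left_mono) auto
  qed
  finally show ?thesis .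
qed

text \<open>Here \<open>1 + n \<le> 2 * n\<close> for \<open>n = np + nx\<close>, which turns the
  constant 2 of \<open>work_le_power\<close> into \<open>2 * 2 ^ 4 = 32\<close>.\<close>

lemma work_le_power_pos:
  assumes "1 \<le> np + nx"
  shows "real work \<le> 32 * real (np + nx) ^ 4"
proof -
  have "(1 + (np + nx)) ^ 4 \<le> (2 * (np + nx)) ^ 4" by (rule power_mono) (use assms in auto)
  then have "work \<le> 2 * (2 * (np + nx)) ^ 4" using work_le_power by linarith
  also have "\<dots> = 32 * (np + nx) ^ 4" by (simp only: power_mult_distrib) simp
  finally have "real work \<le> real (32 * (np + nx) ^ 4)" by (simp only: of_nat_le_iff)
  then show ?thesis by simp
qed

end

text \<open>With \<open>n = j + h\<close>, the edges contribute at most \<open>n ^ 2\<close> to the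
  bracket, and the rest at most \<open>2 * n ^ 2\<close> because the logarithm of \<open>j\<close>
  is at most \<open>j\<close>; hence the constant 3.\<close>

lemma delay_bound_le_power:
  assumes "m \<le> j choose 2"
  shows "delay_bound j h m \<le> 3 * real (j + h) ^ 4"
proof (cases "j = 0")
  case True
  then show ?thesis by (simp add: delay_bound_def)
next
  case False
  let ?n = "real (j + h)"
  have n: "real j \<le> ?n" "real h \<le> ?n" "0 \<le> real j" "0 \<le> real h" by simp_all
  have "j choose 2 \<le> j * j"
    using choose_two[of j] by (metis div_le_dividend le_trans mult_le_mono2 diff_le_self)
  then have "real m \<le> real (j * j)" using assms by (simp only: of_nat_le_iff)
  also have "\<dots> \<le> ?n * ?n" using n by (simp add: mult_mono)
  finally have m: "real m \<le> ?n * ?n" .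
  have "log 2 (real j) \<le> real j"
    using False log2_of_power_le[of j j] less_exp[of j] by simp
  then have "real h + log 2 (real j) \<le> 2 * ?n" using n by (simp add: algebra_simps)
  then have "real j * (real h + log 2 (real j)) \<le> ?n * (2 * ?n)"
    using n False by (intro mult_mono) auto
  with m have "real m + real j * (real h + log 2 (real j)) \<le> 3 * (?n * ?n)" by linarith
  moreover have "real j * real h \<le> ?n * ?n" using n by (intro mult_mono) auto
  moreover have "0 \<le> real m + real j * (real h + log 2 (real j))" using False by simp
  ultimately have "delay_bound j h m \<le> (?n * ?n) * (3 * (?n * ?n))"
    unfolding delay_bound_def by (intro mult_mono) auto
  also have "\<dots> = 3 * ?n ^ 4" by (simp only: power4_eq_xxxx mult_ac)
  finally show ?thesis .
qed

lemma instances_iff: "I \<in> instances hull_problem \<longleftrightarrow> hull_inst I"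
  by (simp add: hull_problem_def hull_inst_def)

lemma inp_size_eq: "inp_size hull_problem I = length (pts I) + length (obstacles I)"
  by (simp add: hull_problem_def)

lemma finds_solution: "finds_solution_polytime hull_problem FINDING"
  unfolding finds_solution_polytime_def
\<comment> \<open>The polynomial \<open>8000 * (1 + x) ^ 4\<close>: 4000 comes from
  \<open>finding_run\<close> and the factor 2 from \<open>work_le_power\<close>.\<close>
proof (intro exI[of _ "[:8000:] * [:1, 1:] ^ 4"] ballI)
  fix I assume "I \<in> instances hull_problem"
  then interpret hull_inst I by (simp add: instances_iff)
  obtain s S where s: "exec FINDING (init_state (inp hull_problem I)) s" "outputs_sets hull_problem I s [S]"
    "S \<in> solutions hull_problem I" "clock s \<le> 4000 * work" using finding_run by blast
  have "clock s \<le> poly ([:8000:] * [:1, 1:] ^ 4) (inp_size hull_problem I)"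
    using s(4) work_le_power by (simp add: inp_size_eq)
  with s show "\<exists>s S. exec FINDING (init_state (inp hull_problem I)) s \<and> outputs_sets hull_problem I s [S] \<and>
    S \<in> solutions hull_problem I \<and> clock s \<le> poly ([:8000:] * [:1, 1:] ^ 4) (inp_size hull_problem I)" by blast
qed

lemma computes_neighbors: "computes_polytime hull_problem (Seq LOADS NEIGHBORS) nb_sets"
  unfolding computes_polytime_def
proof (intro exI[of _ "[:80000:] * [:1, 1:] ^ 4"] ballI allI impI)
  fix I S ns assume "I \<in> instances hull_problem" and S: "S \<in> solutions hull_problem I"
    and ns: "represents hull_problem I ns S"
  then interpret hull_inst I by (simp add: instances_iff)
  obtain S0 where S0: "sol S0" "S = P ` S0" using S by (auto simp: solutions_eq)
  obtain s Ts where s: "exec (Seq LOADS NEIGHBORS) (init_state (inp_with hull_problem I ns)) s"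
    "outputs_sets hull_problem I s (map ((`) P) Ts)" "clock s \<le> 40000 * work"
    using neighbors_run[OF _ S0(1)] ns S0(2) by blast
  have "clock s \<le> poly ([:80000:] * [:1, 1:] ^ 4) (inp_size hull_problem I)"
    using s(3) work_le_power by (simp add: inp_size_eq)
  with s nb_sets_eq[OF ns s(1,2)] show "\<exists>s Ss. exec (Seq LOADS NEIGHBORS) (init_state (inp_with hull_problem I ns)) s \<and>
      outputs_sets hull_problem I s Ss \<and> set Ss = nb_sets I S \<and>
      clock s \<le> poly ([:80000:] * [:1, 1:] ^ 4) (inp_size hull_problem I)" by metis
qed

lemma hull_problem_proximity_searchable: "proximity_searchable hull_problem"
  unfolding proximity_searchable_def
proof (intro exI[of _ hull_inst.common] exI[of _ nb_sets] conjI ballI impI)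
  fix I S assume "I \<in> instances hull_problem" and S: "S \<in> solutions hull_problem I"
  then interpret hull_inst I by (simp add: instances_iff)
  show "nb_sets I S \<subseteq> solutions hull_problem I" by (rule nb_sets_proximity(1)[OF S])
  fix T assume "T \<in> solutions hull_problem I"
  then show "common S T \<subseteq> universe hull_problem I" by (simp add: common(1))
next
  show "\<exists>c. finds_solution_polytime hull_problem c" using finds_solution by blast
  show "\<exists>c. computes_polytime hull_problem c nb_sets" using computes_neighbors by blast
next
  fix I S T assume "I \<in> instances hull_problem" and ST: "S \<in> solutions hull_problem I" "T \<in> solutions hull_problem I" "S \<noteq> T"
  then interpret hull_inst I by (simp add: instances_iff)
  show "\<exists>S'\<in>nb_sets I S. card (common S T) < card (common S' T)"
    using nb_sets_proximity(2)[OF ST] .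
qed

theorem theorem9p4:
  shows "proximity_searchable hull_problem \<and>
    (\<exists>(c :: com) (C :: real). \<forall>I\<in>instances hull_problem.
      \<exists>s. exec c (init_state (inp hull_problem I)) s \<and>
        lists_solutions hull_problem I s \<and>
        (let j = card (V_of I); h = card (X_of I); m = card (E_of I); n = j + h in
          (j \<ge> 1 \<and> h \<ge> 1 \<longrightarrow> real (delay s) \<le> C * delay_bound j h m) \<and>
          (n \<ge> 1 \<longrightarrow> real (delay s) \<le> C * real n ^ 4))) \<and>
    (\<exists>C :: real. \<forall>j h m :: nat. m \<le> j choose 2 \<longrightarrow> delay_bound j h m \<le> C * real (j + h) ^ 4)"
proof (intro conjI)
  show "proximity_searchable hull_problem" by (rule hull_problem_proximity_searchable)
  show "\<exists>C :: real. \<forall>j h m :: nat. m \<le> j choose 2 \<longrightarrow> delay_bound j h m \<le> C * real (j + h) ^ 4"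
    using delay_bound_le_power by blast
  show "\<exists>(c :: com) (C :: real). \<forall>I\<in>instances hull_problem.
      \<exists>s. exec c (init_state (inp hull_problem I)) s \<and>
        lists_solutions hull_problem I s \<and>
        (let j = card (V_of I); h = card (X_of I); m = card (E_of I); n = j + h in
          (j \<ge> 1 \<and> h \<ge> 1 \<longrightarrow> real (delay s) \<le> C * delay_bound j h m) \<and>
          (n \<ge> 1 \<longrightarrow> real (delay s) \<le> C * real n ^ 4))"
  \<comment> \<open>\<open>1600000 = 50000 * 32\<close>, the product of the constants in
    \<open>listing_run\<close> and \<open>work_le_power_pos\<close>; the bound in \<open>j\<close>,
    \<open>h\<close> and \<open>m\<close> gets by with a factor 16 in place of 32.\<close>
  proof (intro exI[of _ LISTING] exI[of _ "1600000 :: real"] ballI)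
    fix I assume "I \<in> instances hull_problem"
    then interpret hull_inst I by (simp add: instances_iff)
    obtain s where s: "exec LISTING (init_state (inp hull_problem I)) s" "lists_solutions hull_problem I s"
      "delay s \<le> 50000 * work" using listing_run by blast
    have d: "real (delay s) \<le> 50000 * real work" using of_nat_mono[OF s(3), where 'a = real] by simp
    have "real (delay s) \<le> 1600000 * delay_bound np nx ne" if "1 \<le> np" "1 \<le> nx"
      using d work_le_delay_bound[OF that] by linarith
    moreover have "real (delay s) \<le> 1600000 * real (np + nx) ^ 4" if "1 \<le> np + nx"
      using d work_le_power_pos[OF that] by linarith
    ultimately show "\<exists>s. exec LISTING (init_state (inp hull_problem I)) s \<and>
        lists_solutions hull_problem I s \<and>
        (let j = card (V_of I); h = card (X_of I); m = card (E_of I); n = j + h in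
          (j \<ge> 1 \<and> h \<ge> 1 \<longrightarrow> real (delay s) \<le> 1600000 * delay_bound j h m) \<and>
          (n \<ge> 1 \<longrightarrow> real (delay s) \<le> 1600000 * real n ^ 4))"
      using s(1,2) unfolding Let_def card_V card_X card_E by blast
  qed
qed

end
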